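(* The decision problem 1-over-2-Rikudo is in $\mathsf{P}$: there is a polynomial-time algorithm which, given a Rikudo game $(\tau,m,p)$ such that the set of numbers already placed by $m$ is exactly $\{2x+1 \mid x\in\mathbb{N}\}\cap[n]$ with $n=|\tau|$ (that is, all odd numbers of $[n]$ and no others), decides whether the game admits a solution.
   Context: $\mathbb{N}$ contains $0$. Let $\mathcal{C}$ be the set of cells of the regular hexagonal tiling of the plane; two distinct cells are adjacent when they share an edge. (Concretely, one may identify $\mathcal{C}$ with $\mathbb{Z}^2$ so that $(a,b)$ is adjacent to $(a\pm1,b)$, $(a,b\pm1)$, $(a+1,b-1)$, $(a-1,b+1)$.) For $\sigma\subseteq\mathcal{C}$, let $G_\sigma$ be the loopless graph with vertex set $\sigma$ whose edges are the pairs of adjacent cells of $\sigma$; $\sigma$ is called connected when $G_\sigma$ is connected. A Rikudo game is a triple $(\tau,m,p)$ where $\tau\subset\mathcal{C}$ is a finite connected set of cells and, with $n=|\tau|$ and $[n]=\{1,\dots,n\}$: $m:\tau\to[n]$ is a partial injective map (numbers already placed), and $p$ is a subset of the adjacency relation of $G_\tau$ (given adjacencies). All data are finite and given explicitly. A solution of $(\tau,m,p)$ is a bijection $s:\tau\to[n]$ such that: (i) any two cells $c,c'\in\tau$ with $|s(c)-s(c')|=1$ are adjacent; (ii) $s(c)=m(c)$ for every cell $c$ on which $m$ is defined; (iii) $|s(c)-s(c')|=1$ for every pair $(c,c')\in p$. *)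

theory Defs
  imports
    "HOL-Computational_Algebra.Polynomial"
    "Graph_Theory.Pair_Digraph"
    "Graph_Theory.Digraph_Component"
begin

section \<open>Deterministic multi-tape Turing machines and the class P\<close>

text \<open>
  Input words range over a finite alphabet, given as a type \<open>'a\<close> of class \<open>finite\<close>.
  A machine may use finitely many further working symbols.
\<close>

datatype 'a tape_symbol = Blank | Letter 'a | Work nat

datatype direction = Left | Stay | Right

record 'a tm =
  num_tapes :: nat
  states :: "nat set"
  symbols :: "'a tape_symbol set"
  start :: nat
  accept :: nat
  reject :: nat
  delta :: "nat \<Rightarrow> 'a tape_symbol list \<Rightarrow> nat \<times> ('a tape_symbol \<times> direction) list"

text \<open>
  Only the finite restriction of \<open>delta\<close> to proper states and to tuples of proper symbols
  matters, and well-formedness makes that restriction closed; hence a well-formed machine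
  is a finite object.
\<close>

definition turing_machine :: "'a tm \<Rightarrow> bool" where
  "turing_machine M \<longleftrightarrow>
     num_tapes M \<ge> 1 \<and>
     finite (states M) \<and> {start M, accept M, reject M} \<subseteq> states M \<and> accept M \<noteq> reject M \<and>
     finite (symbols M) \<and> Blank \<in> symbols M \<and> range Letter \<subseteq> symbols M \<and>
     (\<forall>q \<in> states M. \<forall>as. length as = num_tapes M \<and> set as \<subseteq> symbols M \<longrightarrow>
        fst (delta M q as) \<in> states M \<and>
        length (snd (delta M q as)) = num_tapes M \<and>
        fst ` set (snd (delta M q as)) \<subseteq> symbols M)"

text \<open>A tape is infinite in both directions and comes with the position of its head.\<close>

type_synonym 'a tape = "(int \<Rightarrow> 'a tape_symbol) \<times> int"

type_synonym 'a configuration = "nat \<times> 'a tape list"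

definition read_tape :: "'a tape \<Rightarrow> 'a tape_symbol" where
  "read_tape tp = fst tp (snd tp)"

fun shift :: "direction \<Rightarrow> int" where
  "shift Left = -1"
| "shift Stay = 0"
| "shift Right = 1"

fun act :: "'a tape_symbol \<times> direction \<Rightarrow> 'a tape \<Rightarrow> 'a tape" where
  "act (a, d) (f, i) = (f(i := a), i + shift d)"

fun step :: "'a tm \<Rightarrow> 'a configuration \<Rightarrow> 'a configuration" where
  "step M (q, tps) =
     (if q = accept M \<or> q = reject M then (q, tps)
      else let (q', acts) = delta M q (map read_tape tps) in (q', map2 act acts tps))"

definition input_tape :: "'a list \<Rightarrow> 'a tape" where
  "input_tape w =
     ((\<lambda>i. if 0 \<le> i \<and> i < int (length w) then Letter (w ! nat i) else Blank), 0)"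

definition initial_configuration :: "'a tm \<Rightarrow> 'a list \<Rightarrow> 'a configuration" where
  "initial_configuration M w =
     (start M, input_tape w # replicate (num_tapes M - 1) (\<lambda>_. Blank, 0))"

definition decides_in_time :: "'a tm \<Rightarrow> 'a list set \<Rightarrow> (nat \<Rightarrow> nat) \<Rightarrow> bool" where
  "decides_in_time M L T \<longleftrightarrow>
     (\<forall>w. \<exists>t \<le> T (length w).
        fst ((step M ^^ t) (initial_configuration M w)) = (if w \<in> L then accept M else reject M))"

definition class_P :: "'a::finite list set set" where
  "class_P = {L. \<exists>M (b :: nat poly). turing_machine M \<and> decides_in_time M L (poly b)}"


section \<open>Rikudo games\<close>

type_synonym cell = "int \<times> int"

definition adjacent :: "cell \<Rightarrow> cell \<Rightarrow> bool" where
  "adjacent c c' \<longleftrightarrow>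
     (fst c' - fst c, snd c' - snd c) \<in> {(1, 0), (-1, 0), (0, 1), (0, -1), (1, -1), (-1, 1)}"

definition cell_graph :: "cell set \<Rightarrow> cell pair_pre_digraph" where
  "cell_graph \<sigma> = \<lparr>pverts = \<sigma>, parcs = {(c, c'). c \<in> \<sigma> \<and> c' \<in> \<sigma> \<and> adjacent c c'}\<rparr>"

type_synonym game = "cell set \<times> (cell \<rightharpoonup> nat) \<times> (cell \<times> cell) set"

fun rikudo_game :: "game \<Rightarrow> bool" where
  "rikudo_game (\<tau>, m, p) \<longleftrightarrow>
     finite \<tau> \<and> Digraph_Component.connected (with_proj (cell_graph \<tau>)) \<and>
     dom m \<subseteq> \<tau> \<and> ran m \<subseteq> {1..card \<tau>} \<and> inj_on m (dom m) \<and>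
     p \<subseteq> parcs (cell_graph \<tau>)"

fun solution :: "game \<Rightarrow> (cell \<Rightarrow> nat) \<Rightarrow> bool" where
  "solution (\<tau>, m, p) s \<longleftrightarrow>
     bij_betw s \<tau> {1..card \<tau>} \<and>
     (\<forall>c \<in> \<tau>. \<forall>c' \<in> \<tau>. \<bar>int (s c) - int (s c')\<bar> = 1 \<longrightarrow> adjacent c c') \<and>
     (\<forall>c \<in> dom m. m c = Some (s c)) \<and>
     (\<forall>(c, c') \<in> p. \<bar>int (s c) - int (s c')\<bar> = 1)"

fun odd_numbers_placed :: "game \<Rightarrow> bool" where
  "odd_numbers_placed (\<tau>, m, p) \<longleftrightarrow> ran m = {2 * x + 1 | x. True} \<inter> {1..card \<tau>}"


section \<open>Games as words\<close>

text \<open>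
  A game is written as the list of its cells, each with its coordinates and, if there is one,
  the number placed on it, followed by the list of the given adjacencies. Numbers are in
  binary, least significant digit first and without superfluous zeros (so \<open>0\<close> has no digits);
  every integer starts with its sign. For example, with digits \<open>0\<close>, \<open>1\<close>, the cell
  \<open>(2, -1)\<close> carrying the number \<open>3\<close> is written \<open>+01-1#11;\<close>
\<close>

datatype letter = Digit bool | Plus | Minus | Hash | Semicolon | Bar

instance letter :: finite
proof
  have "x \<in> {Digit True, Digit False, Plus, Minus, Hash, Semicolon, Bar}" for x
    by (cases x) (auto split: bool.splits)
  then show "finite (UNIV :: letter set)"
    by (meson finite.emptyI finite.insertI finite_subset subsetI)
qed

fun enc_nat :: "nat \<Rightarrow> letter list" where
  "enc_nat n = (if n = 0 then [] else Digit (odd n) # enc_nat (n div 2))"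

declare enc_nat.simps [simp del]

definition enc_int :: "int \<Rightarrow> letter list" where
  "enc_int z = (if z \<ge> 0 then Plus else Minus) # enc_nat (nat \<bar>z\<bar>)"

definition enc_coords :: "cell \<Rightarrow> letter list" where
  "enc_coords c = enc_int (fst c) @ enc_int (snd c)"

definition enc_cell :: "(cell \<rightharpoonup> nat) \<Rightarrow> cell \<Rightarrow> letter list" where
  "enc_cell m c =
     enc_coords c @ (case m c of None \<Rightarrow> [] | Some k \<Rightarrow> Hash # enc_nat k) @ [Semicolon]"

definition enc_pair :: "cell \<times> cell \<Rightarrow> letter list" where
  "enc_pair e = enc_coords (fst e) @ enc_coords (snd e) @ [Semicolon]"

text \<open>A game has one encoding for each way of listing its cells and given adjacencies.\<close>

fun encodes :: "letter list \<Rightarrow> game \<Rightarrow> bool" where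
  "encodes w (\<tau>, m, p) \<longleftrightarrow>
     (\<exists>cs ps. distinct cs \<and> set cs = \<tau> \<and> distinct ps \<and> set ps = p \<and>
        w = concat (map (enc_cell m) cs) @ [Bar] @ concat (map enc_pair ps))"

text \<open>
  The language of the decision problem: the encodings of its yes-instances. A decider rejects
  encodings of unsolvable instances as well as words that do not encode an instance.
\<close>

definition one_over_two_rikudo :: "letter list set" where
  "one_over_two_rikudo =
     {w. \<exists>g. encodes w g \<and> rikudo_game g \<and> odd_numbers_placed g \<and> (\<exists>s. solution g s)}"

end

theory Submission
  imports Defs "HOL-Library.Product_Plus"
begin

text \<open>
  With all odd numbers placed, every even number \<open>k\<close> must go to a free cell that is adjacent to the
  cells of \<open>k - 1\<close> and \<open>k + 1\<close> and respects the given adjacencies, and these conditions do not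
  interact: a solution is a perfect matching between even numbers and free cells. Two distinct
  cells have at most two common neighbours, so every even number has at most two candidates, except
  possibly the last one, whose cell is guessed by exhaustive search. A free cell with at most one
  candidate number can be matched and removed; once all degrees are two, Hall's theorem applies.

  Polynomial time is obtained from a small stack language that compiles to multi-tape machines.
  Data are binary trees, written in prefix code on a stack, and the functions that can be computed
  in polynomial time in this representation are closed under pairing, case distinction and folds
  over lists with polynomially bounded accumulators. The decider parses a word, compares it with
  the encoding of what it has parsed, and runs the peeling algorithm.
\<close>

section \<open>A structured stack language\<close>

text \<open>Of two consecutive numbers exactly one is even, and its odd partner has a fixed cell;
  this is why the placements of the even numbers do not interact. Peeling works on the cells because
  the bound of two is known for the numbers: if every remaining cell has at least two takers, equal
  counts force all degrees to be two. A cell without takers is removed as well; this leaves more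
  numbers than cells, which the comparison of the two counts at the end detects. On the machine side
  the danger is iteration: a polynomial-time step repeated along a list can make its data grow
  exponentially. Folds therefore ask for a bound on all intermediate values, and the procedures are
  shaped to have one: the connectivity test shrinks a list of unreached cells, peeling only filters,
  and the parser adds a constant amount per letter. Order and subtraction of numbers are avoided;
  equality, successor, doubling, parity and sign tests suffice.\<close>

type_synonym 'a stacks = "'a tape_symbol list list"

definition peek :: "'a tape_symbol list \<Rightarrow> 'a tape_symbol" where
  "peek l = (if l = [] then Blank else hd l)"

lemma peek_simps [simp]: "peek [] = Blank" "peek (a # l) = a"
  by (simp_all add: peek_def)

datatype 'a prog =
    Skip
  | Push nat "'a tape_symbol"
  | Pop nat
  | Copy nat nat
  | Seq "'a prog" "'a prog" (infixr ";;" 60)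
  | Cond nat "'a tape_symbol set" "'a prog" "'a prog"
  | Loop nat "'a tape_symbol set" "'a prog"

text \<open>The times are the exact numbers of machine steps: a push has to move the head first and
  write afterwards, and a branch or loop body that is entered costs a test and a jump at its end.
  \<open>Copy\<close> asks for \<open>i \<noteq> j\<close> because the head of tape \<open>j\<close>
  has already moved when the symbol on tape \<open>i\<close> is read.\<close>

inductive exec :: "'a prog \<Rightarrow> 'a stacks \<Rightarrow> nat \<Rightarrow> 'a stacks \<Rightarrow> bool" where
  skip: "exec Skip st 0 st"
| push: "i < length st \<Longrightarrow> exec (Push i a) st 2 (st[i := a # st ! i])"
| pop: "i < length st \<Longrightarrow> exec (Pop i) st 1 (st[i := tl (st ! i)])"
| copy: "i < length st \<Longrightarrow> j < length st \<Longrightarrow> i \<noteq> j \<Longrightarrow> st ! i \<noteq> [] \<Longrightarrow>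
    exec (Copy i j) st 2 (st[j := hd (st ! i) # st ! j])"
| seq: "exec p st t st' \<Longrightarrow> exec q st' u st'' \<Longrightarrow> exec (p ;; q) st (t + u) st''"
| condT: "v < length st \<Longrightarrow> peek (st ! v) \<in> A \<Longrightarrow> exec p st t st' \<Longrightarrow>
    exec (Cond v A p q) st (1 + t + 1) st'"
| condF: "v < length st \<Longrightarrow> peek (st ! v) \<notin> A \<Longrightarrow> exec q st t st' \<Longrightarrow>
    exec (Cond v A p q) st (1 + t) st'"
| loopF: "v < length st \<Longrightarrow> peek (st ! v) \<notin> A \<Longrightarrow> exec (Loop v A p) st 1 st"
| loopT: "v < length st \<Longrightarrow> peek (st ! v) \<in> A \<Longrightarrow> exec p st t st' \<Longrightarrow>
    exec (Loop v A p) st' u st'' \<Longrightarrow> exec (Loop v A p) st (1 + t + 1 + u) st''"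

lemma exec_length: "exec p st t st' \<Longrightarrow> length st' = length st"
  by (induction rule: exec.induct) auto

text \<open>Turns a time bound into a bound on the size of the result; see
  \<open>ptime_pbound\<close>.\<close>

lemma exec_size:
  "exec p st t st' \<Longrightarrow> length (concat st') \<le> length (concat st) + t"
proof (induction rule: exec.induct)
  case (push i st a)
  then show ?case by (auto simp: length_concat map_update sum_list_update)
next
  case (pop i st)
  then have "length (st ! i) \<le> sum_list (map length st)"
    by (metis elem_le_sum_list length_map nth_map)
  then show ?case using pop by (auto simp: length_concat map_update sum_list_update)
next
  case (copy i st j)
  then show ?case by (auto simp: length_concat map_update sum_list_update)
qed auto

section \<open>Compilation to Turing machines\<close>

text \<open>
  A stack lives to the right of the head, its top under the head; what is left of the head is
  garbage. Hence the initial input tape already is a stack.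
\<close>

definition represents :: "'a tape_symbol list \<Rightarrow> 'a tape \<Rightarrow> bool" where
  "represents l tp \<longleftrightarrow> (\<forall>k. fst tp (snd tp + int k) = (if k < length l then l ! k else Blank))"

lemma represents_read: "represents l tp \<Longrightarrow> read_tape tp = peek l"
  unfolding represents_def read_tape_def peek_def
  by (drule spec[of _ 0]) (auto simp: hd_conv_nth)

text \<open>\<open>act\<close> writes before it moves. So the first step writes back the symbol just
  read, and the second overwrites the garbage cell on the left.\<close>

lemma represents_push:
  assumes "represents l tp"
  shows "represents (b # l) (act (b, Stay) (act (read_tape tp, Left) tp))"
proof -
  obtain f i where tp: "tp = (f, i)" by force
  have "f (i - 1 + int k) = (if k - 1 < length l then l ! (k - 1) else Blank)" if "k > 0" for k
  proof -
    from that obtain j where "k = Suc j" using gr0_implies_Suc by blast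
    then show ?thesis using assms by (simp add: represents_def tp)
  qed
  then show ?thesis
    using assms by (auto simp: represents_def tp read_tape_def nth_Cons' less_Suc_eq_0_disj)
qed

text \<open>The popped symbol stays behind as garbage. On an empty stack the head moves over a blank
  and the stack remains empty.\<close>

lemma represents_pop:
  assumes "represents l tp"
  shows "represents (tl l) (act (read_tape tp, Right) tp)"
proof -
  obtain f i where tp: "tp = (f, i)" by force
  have "f (i + 1 + int k) = (if Suc k < length l then l ! Suc k else Blank)" for k
    using assms[unfolded represents_def, rule_format, of "Suc k"] by (simp add: tp add_ac)
  then show ?thesis
    by (auto simp: represents_def tp read_tape_def nth_tl)
qed

text \<open>Besides the state for the test, \<open>Cond\<close> and \<open>Loop\<close> have one
  state for a jump: past the second branch, or back to the test.\<close>

fun psize :: "'a prog \<Rightarrow> nat" where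
  "psize Skip = 0"
| "psize (Push i a) = 2"
| "psize (Pop i) = 1"
| "psize (Copy i j) = 2"
| "psize (p ;; q) = psize p + psize q"
| "psize (Cond v A p q) = psize p + psize q + 2"
| "psize (Loop v A p) = psize p + 2"

definition stay :: "'a tape_symbol list \<Rightarrow> ('a tape_symbol \<times> direction) list" where
  "stay as = map (\<lambda>a. (a, Stay)) as"

text \<open>\<open>compile p a\<close> runs \<open>p\<close> on the states from \<open>a\<close> on and leaves in state \<open>a + psize p\<close>.\<close>

fun compile ::
  "'a prog \<Rightarrow> nat \<Rightarrow> nat \<Rightarrow> 'a tape_symbol list \<Rightarrow> nat \<times> ('a tape_symbol \<times> direction) list"
where
  "compile Skip a q as = (a, stay as)"
| "compile (Push i b) a q as =
    (if q = a then (a + 1, (stay as)[i := (as ! i, Left)]) else (a + 2, (stay as)[i := (b, Stay)]))"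
| "compile (Pop i) a q as = (a + 1, (stay as)[i := (as ! i, Right)])"
| "compile (Copy i j) a q as =
    (if q = a then (a + 1, (stay as)[j := (as ! j, Left)])
     else (a + 2, (stay as)[j := (as ! i, Stay)]))"
| "compile (p ;; r) a q as =
    (if q < a + psize p then compile p a q as else compile r (a + psize p) q as)"
| "compile (Cond v A p r) a q as =
    (if q = a then (if as ! v \<in> A then a + 1 else a + 2 + psize p, stay as)
     else if q < a + 1 + psize p then compile p (a + 1) q as
     else if q = a + 1 + psize p then (a + 2 + psize p + psize r, stay as)
     else compile r (a + 2 + psize p) q as)"
| "compile (Loop v A p) a q as =
    (if q = a then (if as ! v \<in> A then a + 1 else a + 2 + psize p, stay as)
     else if q < a + 1 + psize p then compile p (a + 1) q as
     else (a, stay as))"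

fun wf_prog :: "nat \<Rightarrow> 'a tape_symbol set \<Rightarrow> 'a prog \<Rightarrow> bool" where
  "wf_prog k S Skip \<longleftrightarrow> True"
| "wf_prog k S (Push i a) \<longleftrightarrow> i < k \<and> a \<in> S"
| "wf_prog k S (Pop i) \<longleftrightarrow> i < k"
| "wf_prog k S (Copy i j) \<longleftrightarrow> i < k \<and> j < k"
| "wf_prog k S (p ;; q) \<longleftrightarrow> wf_prog k S p \<and> wf_prog k S q"
| "wf_prog k S (Cond v A p q) \<longleftrightarrow> wf_prog k S p \<and> wf_prog k S q"
| "wf_prog k S (Loop v A p) \<longleftrightarrow> wf_prog k S p"

lemma length_stay [simp]: "length (stay as) = length as"
  by (simp add: stay_def)

lemma fst_stay [simp]: "fst ` set (stay as) = set as"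
  by (force simp: stay_def)

lemma set_stay_update:
  "(x, d') \<in> set ((stay as)[i := (b, d)]) \<Longrightarrow> set as \<subseteq> S \<Longrightarrow> b \<in> S \<Longrightarrow> x \<in> S"
  using set_update_subset_insert[of "stay as" i "(b, d)"] by (fastforce simp: stay_def)

lemma compile_wf:
  assumes "wf_prog k S p" "length as = k" "set as \<subseteq> S" "a \<le> q" "q < a + psize p"
  shows "a \<le> fst (compile p a q as) \<and> fst (compile p a q as) \<le> a + psize p \<and>
    length (snd (compile p a q as)) = k \<and> fst ` set (snd (compile p a q as)) \<subseteq> S"
  using assms
proof (induction p arbitrary: a)
  case (Seq p1 p2)
  show ?case
  proof (cases "q < a + psize p1")
    case True
    then show ?thesis using Seq.IH(1)[of a] Seq.prems by auto
  next
    case False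
    then show ?thesis using Seq.IH(2)[of "a + psize p1"] Seq.prems by auto
  qed
next
  case (Cond v A p1 p2)
  consider "q = a" | "q \<noteq> a" "q < a + 1 + psize p1" | "q = a + 1 + psize p1"
    | "q > a + 1 + psize p1" by linarith
  then show ?case
  proof cases
    case 2
    then show ?thesis using Cond.IH(1)[of "a + 1"] Cond.prems by auto
  next
    case 4
    then show ?thesis using Cond.IH(2)[of "a + 2 + psize p1"] Cond.prems by auto
  qed (use Cond.prems in auto)
next
  case (Loop v A p)
  consider "q = a" | "q \<noteq> a" "q < a + 1 + psize p" | "q = a + 1 + psize p"
    using Loop.prems by fastforce
  then show ?case
  proof cases
    case 2
    then show ?thesis using Loop.IH(1)[of "a + 1"] Loop.prems by auto
  qed (use Loop.prems in auto)
qed (auto dest!: set_stay_update[where S = S] simp: subset_code(1))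

lemma map2_act_update:
  assumes "i < length tps"
  shows "map2 act ((stay (map read_tape tps))[i := x]) tps = tps[i := act x (tps ! i)]"
proof (rule nth_equalityI)
  fix j assume j: "j < length (map2 act ((stay (map read_tape tps))[i := x]) tps)"
  have "act (read_tape tp, Stay) tp = tp" for tp :: "'a tape"
    by (cases tp) (simp add: read_tape_def)
  then show "map2 act ((stay (map read_tape tps))[i := x]) tps ! j = tps[i := act x (tps ! i)] ! j"
    using j assms by (auto simp: stay_def nth_list_update)
qed simp

lemma map2_act_stay: "map2 act (stay (map read_tape tps)) tps = tps"
proof (rule nth_equalityI)
  fix j assume j: "j < length (map2 act (stay (map read_tape tps)) tps)"
  have "act (read_tape tp, Stay) tp = tp" for tp :: "'a tape"
    by (cases tp) (simp add: read_tape_def)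
  then show "map2 act (stay (map read_tape tps)) tps ! j = tps ! j"
    using j by (auto simp: stay_def)
qed simp

text \<open>The halting states are excluded because \<open>step\<close> does nothing in
  them.\<close>

definition hosts :: "'a tm \<Rightarrow> 'a prog \<Rightarrow> nat \<Rightarrow> bool" where
  "hosts M p a \<longleftrightarrow> (\<forall>q. a \<le> q \<and> q < a + psize p \<longrightarrow>
     q \<noteq> accept M \<and> q \<noteq> reject M \<and> delta M q = compile p a q)"

lemma step_hosts:
  "hosts M p a \<Longrightarrow> a \<le> q \<Longrightarrow> q < a + psize p \<Longrightarrow>
   step M (q, tps) = (let (q', acts) = compile p a q (map read_tape tps) in (q', map2 act acts tps))"
  by (simp add: hosts_def)

abbreviation reaches :: "'a tm \<Rightarrow> nat \<Rightarrow> 'a configuration \<Rightarrow> 'a configuration \<Rightarrow> bool" where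
  "reaches M t c c' \<equiv> (step M ^^ t) c = c'"

lemma reaches_add: "reaches M t c c' \<Longrightarrow> reaches M u c' c'' \<Longrightarrow> reaches M (t + u) c c''"
  by (simp add: funpow_add add.commute[of t])

text \<open>The induction runs over the execution and not over the program, since a loop re-enters
  its own first state \<open>a\<close>. Subprograms are hosted at their offsets inside the block of
  states.\<close>

lemma exec_compile:
  assumes "exec p st t st'" "hosts M p a" "list_all2 represents st tps"
  shows "\<exists>tps'. list_all2 represents st' tps' \<and> reaches M t (a, tps) (a + psize p, tps')"
  using assms
proof (induction arbitrary: a tps rule: exec.induct)
  case (skip st)
  then show ?case by auto
next
  case (push i st b)
  let ?tps1 = "tps[i := act (read_tape (tps ! i), Left) (tps ! i)]"
  let ?tps2 = "?tps1[i := act (b, Stay) (?tps1 ! i)]"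
  have i: "i < length tps" using push by (auto dest: list_all2_lengthD)
  have "step M (a, tps) = (a + 1, ?tps1)"
    using push i by (subst step_hosts) (auto simp: map2_act_update)
  moreover have "step M (a + 1, ?tps1) = (a + 2, ?tps2)"
    using push i by (subst step_hosts) (auto simp: map2_act_update simp del: act.simps)
  ultimately have "reaches M 2 (a, tps) (a + 2, ?tps2)"
    by (simp add: numeral_2_eq_2)
  moreover have "list_all2 represents (st[i := b # st ! i]) ?tps2"
  proof -
    have "represents (b # st ! i) (act (b, Stay) (?tps1 ! i))"
      using represents_push[of "st ! i" "tps ! i" b] push i
      by (simp add: list_all2_conv_all_nth del: act.simps)
    then show ?thesis using push i
      by (auto simp: list_all2_conv_all_nth nth_list_update simp del: act.simps)
  qed
  ultimately show ?case by auto
next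
  case (pop i st)
  let ?tps1 = "tps[i := act (read_tape (tps ! i), Right) (tps ! i)]"
  have i: "i < length tps" using pop by (auto dest: list_all2_lengthD)
  have "step M (a, tps) = (a + 1, ?tps1)"
    using pop i by (subst step_hosts) (auto simp: map2_act_update)
  moreover have "list_all2 represents (st[i := tl (st ! i)]) ?tps1"
    using represents_pop[of "st ! i" "tps ! i"] pop i
    by (auto simp: list_all2_conv_all_nth nth_list_update simp del: act.simps)
  ultimately show ?case by auto
next
  case (copy i st j)
  let ?tps1 = "tps[j := act (read_tape (tps ! j), Left) (tps ! j)]"
  let ?tps2 = "?tps1[j := act (hd (st ! i), Stay) (?tps1 ! j)]"
  have i: "i < length tps" "j < length tps" using copy by (auto dest: list_all2_lengthD)
  have r: "read_tape (tps ! i) = hd (st ! i)"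
    using represents_read[of "st ! i" "tps ! i"] copy i by (auto simp: list_all2_conv_all_nth peek_def)
  have "step M (a, tps) = (a + 1, ?tps1)"
    using copy i by (subst step_hosts) (auto simp: map2_act_update)
  moreover have "step M (a + 1, ?tps1) = (a + 2, ?tps2)"
    using copy i r by (subst step_hosts) (auto simp: map2_act_update simp del: act.simps)
  ultimately have "reaches M 2 (a, tps) (a + 2, ?tps2)"
    by (simp add: numeral_2_eq_2)
  moreover have "list_all2 represents (st[j := hd (st ! i) # st ! j]) ?tps2"
  proof -
    have "represents (hd (st ! i) # st ! j) (act (hd (st ! i), Stay) (?tps1 ! j))"
      using represents_push[of "st ! j" "tps ! j" "hd (st ! i)"] copy i
      by (simp add: list_all2_conv_all_nth del: act.simps)
    then show ?thesis using copy i
      by (auto simp: list_all2_conv_all_nth nth_list_update simp del: act.simps)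
  qed
  ultimately show ?case by auto
next
  case (seq p st t st' q u st'')
  have "hosts M p a" "hosts M q (a + psize p)"
    using seq.prems(1) by (auto simp: hosts_def fun_eq_iff)
  from seq.IH(1)[OF this(1) seq.prems(2)] seq.IH(2)[OF this(2)] show ?case
    by (metis reaches_add psize.simps(5) add.assoc)
next
  case (condT v st A p t st' q)
  have "hosts M p (a + 1)" using condT.prems(1) by (auto simp: hosts_def fun_eq_iff)
  from condT.IH[OF this condT.prems(2)] obtain tps' where
    1: "list_all2 represents st' tps'" "reaches M t (a + 1, tps) (a + 1 + psize p, tps')" by auto
  have v: "v < length tps" "read_tape (tps ! v) \<in> A"
    using condT represents_read[of "st ! v" "tps ! v"] by (auto simp: list_all2_conv_all_nth)
  have "reaches M 1 (a, tps) (a + 1, tps)"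
    using condT v by (simp add: step_hosts[of _ _ a] map2_act_stay del: step.simps)
  moreover have
    "reaches M 1 (a + 1 + psize p, tps') (a + psize (Cond v A p q), tps')"
    using condT by (simp add: step_hosts[of _ _ a] map2_act_stay del: step.simps)
  ultimately show ?case using 1 by (metis reaches_add)
next
  case (condF v st A q t st' p)
  have "hosts M q (a + 2 + psize p)" using condF.prems(1) by (auto simp: hosts_def fun_eq_iff)
  from condF.IH[OF this condF.prems(2)] obtain tps' where
    1: "list_all2 represents st' tps'"
    "reaches M t (a + 2 + psize p, tps) (a + psize (Cond v A p q), tps')"
    by (auto simp: add_ac)
  have v: "v < length tps" "read_tape (tps ! v) \<notin> A"
    using condF represents_read[of "st ! v" "tps ! v"] by (auto simp: list_all2_conv_all_nth)
  have "reaches M 1 (a, tps) (a + 2 + psize p, tps)"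
    using condF v by (simp add: step_hosts[of _ _ a] map2_act_stay del: step.simps)
  then show ?case using 1 by (metis reaches_add)
next
  case (loopF v st A p)
  have v: "v < length tps" "read_tape (tps ! v) \<notin> A"
    using loopF represents_read[of "st ! v" "tps ! v"] by (auto simp: list_all2_conv_all_nth)
  have "reaches M 1 (a, tps) (a + psize (Loop v A p), tps)"
    using loopF v by (simp add: step_hosts[of _ _ a] map2_act_stay del: step.simps)
  then show ?case using loopF by blast
next
  case (loopT v st A p t st' u st'')
  have "hosts M p (a + 1)" using loopT.prems(1) by (auto simp: hosts_def fun_eq_iff)
  from loopT.IH(1)[OF this loopT.prems(2)] obtain tps' where
    1: "list_all2 represents st' tps'" "reaches M t (a + 1, tps) (a + 1 + psize p, tps')" by auto
  from loopT.IH(2)[OF loopT.prems(1) 1(1)] obtain tps'' where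
    2: "list_all2 represents st'' tps''" "reaches M u (a, tps') (a + psize (Loop v A p), tps'')"
    by auto
  have v: "v < length tps" "read_tape (tps ! v) \<in> A"
    using loopT represents_read[of "st ! v" "tps ! v"] by (auto simp: list_all2_conv_all_nth)
  have "reaches M 1 (a, tps) (a + 1, tps)"
    using loopT v by (simp add: step_hosts[of _ _ a] map2_act_stay del: step.simps)
  moreover have "reaches M 1 (a + 1 + psize p, tps') (a, tps')"
    using loopT by (simp add: step_hosts[of _ _ a] map2_act_stay del: step.simps)
  ultimately show ?case using 1 2 by (metis reaches_add)
qed

text \<open>Exact times matter only for the simulation; from here on upper bounds are
  composed.\<close>

definition runs :: "'a prog \<Rightarrow> nat \<Rightarrow> 'a stacks \<Rightarrow> 'a stacks \<Rightarrow> bool" where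
  "runs p n st st' \<longleftrightarrow> (\<exists>t \<le> n. exec p st t st')"

text \<open>States \<open>0\<close> and \<open>1\<close> are the verdicts, so the program starts at
  \<open>2\<close>. Its exit state \<open>2 + psize p\<close> spends one step on inspecting the top
  of stack \<open>0\<close>.\<close>

definition machine :: "nat \<Rightarrow> 'a tape_symbol set \<Rightarrow> 'a prog \<Rightarrow> 'a tape_symbol \<Rightarrow> 'a tm" where
  "machine k S p yes = \<lparr>num_tapes = k, states = {0..2 + psize p}, symbols = S,
     start = 2, accept = 0, reject = 1,
     delta = (\<lambda>q as. if q < 2 then (q, stay as) else if q < 2 + psize p then compile p 2 q as
                else (if as ! 0 = yes then 0 else 1, stay as))\<rparr>"

theorem class_P_if_runs:
  fixes L :: "'a::finite list set"
  assumes wf: "wf_prog (Suc k) S p" and S: "finite S" "Blank \<in> S" "range Letter \<subseteq> S"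
    and runs: "\<And>w. \<exists>st. runs p (poly b (length w)) (map Letter w # replicate k []) st \<and>
                  (peek (st ! 0) = yes \<longleftrightarrow> w \<in> L)"
  shows "L \<in> class_P"
proof -
  let ?M = "machine (Suc k) S p yes"
  have "turing_machine ?M"
  proof -
    have "fst (delta ?M q as) \<le> 2 + psize p \<and> length (snd (delta ?M q as)) = Suc k \<and>
        fst ` set (snd (delta ?M q as)) \<subseteq> S"
      if "q \<le> 2 + psize p" "length as = Suc k" "set as \<subseteq> S" for q as
      using compile_wf[OF wf that(2,3), of 2 q] that by (auto simp: machine_def)
    then show ?thesis
      unfolding turing_machine_def using S by (simp add: machine_def)
  qed
  \<comment> \<open>The additional \<open>1\<close> pays for the step from the exit state to the
    verdict.\<close>
  moreover have "decides_in_time ?M L (poly (b + 1))"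
    unfolding decides_in_time_def
  proof
    fix w
    from runs[of w] obtain st t where t: "t \<le> poly b (length w)"
      "exec p (map Letter w # replicate k []) t st" and yes: "peek (st ! 0) = yes \<longleftrightarrow> w \<in> L"
      by (auto simp: runs_def)
    have "hosts ?M p 2" by (auto simp: hosts_def machine_def)
    moreover have "list_all2 represents (map Letter w # replicate k [])
        (snd (initial_configuration ?M w))"
      by (auto simp: initial_configuration_def represents_def input_tape_def machine_def
          list_all2_conv_all_nth nth_Cons')
    ultimately obtain tps where tps: "list_all2 represents st tps"
      "reaches ?M t (initial_configuration ?M w) (2 + psize p, tps)"
      using exec_compile[OF t(2), of ?M 2] by (fastforce simp: initial_configuration_def machine_def)
    have len: "length tps = Suc k" "length st = Suc k"
      using list_all2_lengthD[OF tps(1)] exec_length[OF t(2)] by auto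
    have "fst (step ?M (2 + psize p, tps)) = (if read_tape (tps ! 0) = yes then 0 else 1)"
      using len by (auto simp: machine_def)
    moreover have "read_tape (tps ! 0) = peek (st ! 0)"
      using tps(1) len by (auto simp: list_all2_conv_all_nth intro: represents_read)
    ultimately have "fst ((step ?M ^^ (t + 1)) (initial_configuration ?M w))
        = (if w \<in> L then accept ?M else reject ?M)"
      using tps(2) yes by (simp add: machine_def)
    moreover have "t + 1 \<le> poly (b + 1) (length w)" using t(1) by simp
    ultimately show "\<exists>t\<le>poly (b + 1) (length w). fst ((step ?M ^^ t) (initial_configuration ?M w))
        = (if w \<in> L then accept ?M else reject ?M)" by blast
  qed
  ultimately show ?thesis unfolding class_P_def by blast
qed

section \<open>Trees on stacks\<close>

lemma runs_mono: "runs p n st st' \<Longrightarrow> n \<le> m \<Longrightarrow> runs p m st st'"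
  by (auto simp: runs_def intro: le_trans)

lemma runs_weaken: "runs p n st st' \<Longrightarrow> n \<le> m \<Longrightarrow> st' = st'' \<Longrightarrow> runs p m st st''"
  by (auto simp: runs_def intro: le_trans)

lemma runs_Skip: "runs Skip 0 st st"
  by (auto simp: runs_def intro: exec.intros)

lemma runs_Push: "i < length st \<Longrightarrow> runs (Push i a) 2 st (st[i := a # st ! i])"
  by (auto simp: runs_def intro: exec.intros)

lemma runs_Pop: "i < length st \<Longrightarrow> runs (Pop i) 1 st (st[i := tl (st ! i)])"
  unfolding runs_def by (blast intro: exec.intros)

lemma runs_Copy: "i < length st \<Longrightarrow> j < length st \<Longrightarrow> i \<noteq> j \<Longrightarrow> st ! i \<noteq> [] \<Longrightarrow>
    runs (Copy i j) 2 st (st[j := hd (st ! i) # st ! j])"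
  by (auto simp: runs_def intro: exec.intros)

lemma runs_Seq: "runs p n st st' \<Longrightarrow> runs q m st' st'' \<Longrightarrow> runs (p ;; q) (n + m) st st''"
  unfolding runs_def by (meson add_mono exec.seq)

lemma runs_CondT: "v < length st \<Longrightarrow> peek (st ! v) \<in> A \<Longrightarrow> runs p n st st' \<Longrightarrow>
    runs (Cond v A p q) (n + 2) st st'"
  unfolding runs_def
proof (elim exE conjE)
  fix t assume "v < length st" "peek (st ! v) \<in> A" "t \<le> n" "exec p st t st'"
  then show "\<exists>t\<le>n + 2. exec (Cond v A p q) st t st'"
    by (intro exI[of _ "1 + t + 1"] conjI exec.condT) simp_all
qed

lemma runs_CondF: "v < length st \<Longrightarrow> peek (st ! v) \<notin> A \<Longrightarrow> runs q n st st' \<Longrightarrow>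
    runs (Cond v A p q) (n + 2) st st'"
  unfolding runs_def
proof (elim exE conjE)
  fix t assume "v < length st" "peek (st ! v) \<notin> A" "t \<le> n" "exec q st t st'"
  then show "\<exists>t\<le>n + 2. exec (Cond v A p q) st t st'"
    by (intro exI[of _ "1 + t"] conjI exec.condF) simp_all
qed

lemma runs_Loop_end: "v < length st \<Longrightarrow> peek (st ! v) \<notin> A \<Longrightarrow> runs (Loop v A p) 1 st st"
  unfolding runs_def by (blast intro: exec.intros)

lemma runs_Loop_step:
  assumes "v < length st" "peek (st ! v) \<in> A" "runs p n st st'" "runs (Loop v A p) m st' st''"
  shows "runs (Loop v A p) (n + m + 2) st st''"
proof -
  from assms(3,4) obtain t u where "t \<le> n" "u \<le> m" "exec p st t st'" "exec (Loop v A p) st' u st''"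
    by (auto simp: runs_def)
  then show ?thesis
    using exec.loopT[OF assms(1,2)] unfolding runs_def
    by (intro exI[of _ "1 + t + 1 + u"]) auto
qed

section \<open>Binary trees and their preorder code\<close>

datatype tree = Leaf | Node tree tree


fun code :: "tree \<Rightarrow> 'a tape_symbol list" where
  "code Leaf = [Work 0]"
| "code (Node s t) = Work (Suc 0) # code s @ code t"

fun tsize :: "tree \<Rightarrow> nat" where
  "tsize Leaf = 1"
| "tsize (Node s t) = Suc (tsize s + tsize t)"

lemma length_code [simp]: "length (code t) = tsize t"
  by (induction t) auto

lemma set_code: "set (code t) \<subseteq> {Work 0, Work (Suc 0)}"
  by (induction t) auto

lemma tsize_pos: "0 < tsize t"
  by (cases t) auto

text \<open>Preorder notation is self-delimiting. The remainders \<open>u\<close> and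
  \<open>v\<close> are carried along so that the induction can pass from the left subtree to the
  right one.\<close>

lemma code_prefix_free: "code s @ u = code t @ v \<Longrightarrow> s = t \<and> u = v"
proof (induction s arbitrary: t u v)
  case Leaf
  then show ?case by (cases t) simp_all
next
  case (Node s1 s2)
  show ?case
  proof (cases t)
    case Leaf
    then show ?thesis using Node.prems by simp
  next
    case t: (Node t1 t2)
    then have eq: "code s1 @ code s2 @ u = code t1 @ code t2 @ v" using Node.prems by simp
    note 1 = Node.IH(1)[OF eq]
    then have "code s2 @ u = code t2 @ v" using eq by simp
    from Node.IH(2)[OF this] 1 t show ?thesis by simp
  qed
qed

lemma code_inject [simp]: "code s = code t \<longleftrightarrow> s = t"
  using code_prefix_free[of s "[]" t "[]"] by (auto simp only: append_Nil2)

text \<open>The symbol \<open>Work 2\<close> marks the bottom of the part of a stack that is in use.\<close>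

abbreviation mark :: "'a tape_symbol" where "mark \<equiv> Work 2"

text \<open>Moving a block symbol by symbol reverses it, so a code comes back in order after an even
  number of moves.\<close>

definition transfer :: "nat \<Rightarrow> nat \<Rightarrow> 'a prog" where
  "transfer i j = Loop i (- {mark}) (Copy i j ;; Pop i) ;; Pop i"

lemma runs_transfer:
  assumes "i < length st" "j < length st" "i \<noteq> j" "st ! i = zs @ mark # a" "mark \<notin> set zs"
  shows "runs (transfer i j) (5 * length zs + 2) st (st[i := a, j := rev zs @ st ! j])"
proof -
  have "runs (Loop i (- {mark}) (Copy i j ;; Pop i)) (5 * length zs + 1) st
          (st[i := mark # a, j := rev zs @ st ! j])"
    using assms
  proof (induction zs arbitrary: st)
    case Nil
    then have "st[i := mark # a, j := rev [] @ st ! j] = st"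
      by (auto intro!: nth_equalityI simp: nth_list_update)
    then show ?case using Nil runs_Loop_end[of i st "- {mark}"] by simp
  next
    case (Cons z zs)
    let ?st = "st[j := z # st ! j, i := zs @ mark # a]"
    have "runs (Copy i j ;; Pop i) 3 st ?st"
      using Cons.prems
      by (intro runs_weaken[OF runs_Seq[OF runs_Copy runs_Pop]]) auto
    note 1 = this
    have "runs (Loop i (- {mark}) (Copy i j ;; Pop i)) (3 + (5 * length zs + 1) + 2) st
          (?st[i := mark # a, j := rev zs @ ?st ! j])"
      by (rule runs_Loop_step[OF _ _ 1 Cons.IH]) (use Cons.prems in auto)
    then show ?case
      by (rule runs_weaken) (use Cons.prems in \<open>auto intro!: nth_equalityI simp: nth_list_update\<close>)
  qed
  then show ?thesis
    unfolding transfer_def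
    by (rule runs_weaken[OF runs_Seq[OF _ runs_Pop]])
      (use assms in \<open>auto intro!: nth_equalityI simp: nth_list_update\<close>)
qed

text \<open>
  Pops the code of one tree; stack \<open>3\<close> counts in unary the subtrees that are still to be read.
\<close>

definition move_body :: "nat \<Rightarrow> 'a prog" where
  "move_body j = Cond 0 {Work 1} (Push 3 (Work 1)) (Pop 3) ;; Copy 0 j ;; Pop 0"

definition move_tree :: "nat \<Rightarrow> 'a prog" where
  "move_tree j = Push j mark ;; Push 3 mark ;; Push 3 (Work 1) ;;
     Loop 3 {Work 1} (move_body j) ;; Pop 3"

text \<open>Stack \<open>j\<close> holds \<open>x\<close> and the other one of stacks
  \<open>1\<close> and \<open>2\<close> holds \<open>y\<close>; thus both instances of
  \<open>move_tree\<close> are verified at once.\<close>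

definition frame ::
  "nat \<Rightarrow> 'a tape_symbol list \<Rightarrow> 'a tape_symbol list \<Rightarrow> 'a tape_symbol list \<Rightarrow> 'a tape_symbol list \<Rightarrow> 'a stacks"
where
  "frame j s x y c = (if j = 1 then [s, x, y, c] else [s, y, x, c])"

lemma frame_simps [simp]:
  "length (frame j s x y c) = 4" "frame j s x y c ! 0 = s" "frame j s x y c ! 3 = c"
  "(frame j s x y c)[0 := s'] = frame j s' x y c" "(frame j s x y c)[3 := c'] = frame j s x y c'"
  by (simp_all add: frame_def)

lemma frame_target:
  assumes "j \<in> {1, 2}"
  shows "frame j s x y c ! j = x" "(frame j s x y c)[j := x'] = frame j s x' y c"
  using assms by (auto simp: frame_def)

lemma runs_move_body:
  assumes "j \<in> {1, 2}"
  shows "runs (move_body j) 7 (frame j (Work 0 # s) x y (Work 1 # c)) (frame j s (Work 0 # x) y c)"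
    and "runs (move_body j) 7 (frame j (Work 1 # s) x y c) (frame j s (Work 1 # x) y (Work 1 # c))"
proof -
  have j: "j < 4" "j \<noteq> 0" using assms by auto
  have 1: "runs (Copy 0 j ;; Pop 0) 3 (frame j (a # s) x y c) (frame j s (a # x) y c)" for a c
    by (rule runs_weaken[OF runs_Seq[OF runs_Copy runs_Pop]]) (use j in \<open>simp_all add: frame_target[OF assms]\<close>)
  have 2: "runs (Cond 0 {Work 1} (Push 3 (Work 1)) (Pop 3)) 3
      (frame j (Work 0 # s) x y (Work 1 # c)) (frame j (Work 0 # s) x y c)"
    by (rule runs_weaken[OF runs_CondF[OF _ _ runs_Pop]]) simp_all
  have 3: "runs (Cond 0 {Work 1} (Push 3 (Work 1)) (Pop 3)) 4
      (frame j (Work 1 # s) x y c) (frame j (Work 1 # s) x y (Work 1 # c))"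
    by (rule runs_weaken[OF runs_CondT[OF _ _ runs_Push]]) simp_all
  show "runs (move_body j) 7 (frame j (Work 0 # s) x y (Work 1 # c)) (frame j s (Work 0 # x) y c)"
    unfolding move_body_def by (rule runs_weaken[OF runs_Seq[OF 2 1]]) simp_all
  show "runs (move_body j) 7 (frame j (Work 1 # s) x y c) (frame j s (Work 1 # x) y (Work 1 # c))"
    unfolding move_body_def by (rule runs_weaken[OF runs_Seq[OF 3 1]]) simp_all
qed

text \<open>Generalised to the list \<open>ts\<close> of all trees still to be read, one for each
  unit of the counter. A leaf removes the first tree; a node replaces it by its two subtrees, whose
  total size is smaller by one. The factor \<open>9\<close> is \<open>7\<close> for the body and
  \<open>2\<close> for the loop.\<close>

lemma runs_move_loop:
  fixes x :: "'a tape_symbol list"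
  assumes "j \<in> {1, 2}"
  shows "runs (Loop 3 {Work 1} (move_body j)) (9 * sum_list (map tsize ts) + 1)
     (frame j (concat (map code ts) @ r) x y (replicate (length ts) (Work 1) @ mark # k))
     (frame j r (rev (concat (map code ts)) @ x) y (mark # k))"
proof (induction "sum_list (map tsize ts)" arbitrary: x ts rule: less_induct)
  case less
  show ?case
  proof (cases ts)
    case Nil
    then show ?thesis
      by (intro runs_weaken[OF runs_Loop_end]) simp_all
  next
    case (Cons t ts')
    show ?thesis
    proof (cases t)
      case Leaf
      have "runs (Loop 3 {Work 1} (move_body j)) (9 * sum_list (map tsize ts') + 1)
          (frame j (concat (map code ts') @ r) (Work 0 # x) y (replicate (length ts') (Work 1) @ mark # k))
          (frame j r (rev (concat (map code ts')) @ Work 0 # x) y (mark # k))"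
        by (rule less) (simp add: Cons Leaf)
      from runs_Loop_step[OF _ _ runs_move_body(1)[OF assms] this]
      have "runs (Loop 3 {Work 1} (move_body j)) (7 + (9 * sum_list (map tsize ts') + 1) + 2)
          (frame j (Work 0 # concat (map code ts') @ r) x y (Work 1 # replicate (length ts') (Work 1) @ mark # k))
          (frame j r (rev (concat (map code ts')) @ Work 0 # x) y (mark # k))"
        by simp
      then show ?thesis
        by (simp add: Cons Leaf)
    next
      case (Node t1 t2)
      let ?ts = "t1 # t2 # ts'"
      have *: "runs (Loop 3 {Work 1} (move_body j)) (9 * sum_list (map tsize ?ts) + 1)
          (frame j (concat (map code ?ts) @ r) (Work 1 # x) y
            (Work 1 # replicate (length ts) (Work 1) @ mark # k))
          (frame j r (rev (concat (map code ?ts)) @ Work 1 # x) y (mark # k))"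
        using less[of ?ts "Work 1 # x"] by (simp add: Cons Node)
      from runs_Loop_step[OF _ _ runs_move_body(2)[OF assms] *]
      have "runs (Loop 3 {Work 1} (move_body j)) (7 + (9 * sum_list (map tsize ?ts) + 1) + 2)
          (frame j (Work 1 # concat (map code ?ts) @ r) x y
            (replicate (length ts) (Work 1) @ mark # k))
          (frame j r (rev (concat (map code ?ts)) @ Work 1 # x) y (mark # k))"
        by (simp add: Cons)
      then show ?thesis
        by (simp add: Cons Node)
    qed
  qed
qed

lemma runs_move_tree:
  assumes "j \<in> {1, 2}"
  shows "runs (move_tree j) (9 * tsize t + 8)
     (frame j (code t @ r) x y k) (frame j r (rev (code t) @ mark # x) y (k :: 'a tape_symbol list))"
proof -
  have 1: "runs (Loop 3 {Work 1} (move_body j)) (9 * tsize t + 1)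
      (frame j (code t @ r) (mark # x) y (Work 1 # mark # k))
      (frame j r (rev (code t) @ mark # x) y (mark # k))"
    using runs_move_loop[OF assms, of "[t]" r "mark # x" y k]
    by simp
  have j: "j < 4" using assms by auto
  have 2: "runs (Push j mark) 2 (frame j (code t @ r) x y k) (frame j (code t @ r) (mark # x) y k)"
    by (rule runs_weaken[OF runs_Push]) (simp_all add: frame_target[OF assms] j)
  have 3: "runs (Push 3 a) 2 (frame j s x y k) (frame j s x y (a # k))" for s x a k
    by (rule runs_weaken[OF runs_Push]) simp_all
  have 4: "runs (Pop 3) 1 (frame j s x y (a # k)) (frame j s x y k)" for s x a
    by (rule runs_weaken[OF runs_Pop]) simp_all
  show ?thesis
    unfolding move_tree_def
    by (rule runs_weaken[OF runs_Seq[OF 2 runs_Seq[OF 3 runs_Seq[OF 3 runs_Seq[OF 1 4]]]]]) simp_all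
qed

lemma runs_move_tree_1:
    "runs (move_tree 1) (9 * tsize t + 8)
       [code t @ r, x, y, k] [r, rev (code t) @ mark # x, y, k :: 'a tape_symbol list]"
  and runs_move_tree_2:
    "runs (move_tree 2) (9 * tsize t + 8)
       [code t @ r, y, x, k] [r, y, rev (code t) @ mark # x, k :: 'a tape_symbol list]"
  using runs_move_tree[of 1 t r x y k] runs_move_tree[of 2 t r x y k] by (simp_all add: frame_def)

section \<open>Copying, dropping, swapping and comparing trees\<close>

definition dup :: "'a prog" where
  "dup = move_tree 1 ;; Push 2 mark ;;
     Loop 1 (- {mark}) (Copy 1 0 ;; Copy 1 2 ;; Pop 1) ;; transfer 2 1 ;; transfer 1 0"

definition drop_tree :: "'a prog" where
  "drop_tree = move_tree 1 ;; Loop 1 (- {mark}) (Pop 1) ;; Pop 1"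

definition swap :: "'a prog" where
  "swap = move_tree 1 ;; move_tree 2 ;; transfer 1 0 ;; transfer 2 0"

lemma mark_notin_code [simp]: "mark \<notin> set (code t)"
  using set_code[of t] by auto

lemma runs_dup_loop:
  "mark \<notin> set zs \<Longrightarrow> runs (Loop 1 (- {mark}) (Copy 1 0 ;; Copy 1 2 ;; Pop 1)) (7 * length zs + 1)
     [s0, zs @ mark # s1, s2, s3] [rev zs @ s0, mark # s1, rev zs @ s2, s3]"
proof (induction zs arbitrary: s0 s2)
  case Nil
  then show ?case by (intro runs_weaken[OF runs_Loop_end]) auto
next
  case (Cons z zs)
  have 1: "runs (Copy 1 0 ;; Copy 1 2 ;; Pop 1) 5
      [s0, (z # zs) @ mark # s1, s2, s3] [z # s0, zs @ mark # s1, z # s2, s3]"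
    by (rule runs_weaken[OF runs_Seq[OF runs_Copy runs_Seq[OF runs_Copy runs_Pop]]]) simp_all
  have 2: "runs (Loop 1 (- {mark}) (Copy 1 0 ;; Copy 1 2 ;; Pop 1)) (7 * length zs + 1)
     [z # s0, zs @ mark # s1, z # s2, s3] [rev zs @ z # s0, mark # s1, rev zs @ z # s2, s3]"
    using Cons by simp
  show ?case
    by (rule runs_weaken[OF runs_Loop_step[OF _ _ 1 2]]) (use Cons.prems in auto)
qed

text \<open>One pass over stack \<open>1\<close> writes one copy to stack \<open>0\<close> and one
  to stack \<open>2\<close>; the latter goes back by way of stack \<open>1\<close>, which restores
  its order. Since \<open>tsize t\<close> is positive, the generous factor absorbs the additive
  constants.\<close>

lemma runs_dup:
  "runs dup (60 * tsize t) [code t @ s0, s1, s2, s3] [code t @ code t @ s0, s1, s2, s3]"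
proof -
  have 1: "runs (move_tree 1) (9 * tsize t + 8) [code t @ s0, s1, s2, s3]
     [s0, rev (code t) @ mark # s1, s2, s3]"
    by (rule runs_move_tree_1)
  have 2: "runs (Push 2 mark) 2 [s0, rev (code t) @ mark # s1, s2, s3]
     [s0, rev (code t) @ mark # s1, mark # s2, s3]"
    by (intro runs_weaken[OF runs_Push]) auto
  have 3: "runs (Loop 1 (- {mark}) (Copy 1 0 ;; Copy 1 2 ;; Pop 1)) (7 * tsize t + 1)
     [s0, rev (code t) @ mark # s1, mark # s2, s3]
     [code t @ s0, mark # s1, code t @ mark # s2, s3]"
    by (intro runs_weaken[OF runs_dup_loop]) auto
  have 4: "runs (transfer 2 1) (5 * tsize t + 2)
     [code t @ s0, mark # s1, code t @ mark # s2, s3]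
     [code t @ s0, rev (code t) @ mark # s1, s2, s3]"
    by (intro runs_weaken[OF runs_transfer[where zs = "code t"]]) auto
  have 5: "runs (transfer 1 0) (5 * tsize t + 2)
     [code t @ s0, rev (code t) @ mark # s1, s2, s3] [code t @ code t @ s0, s1, s2, s3]"
    by (intro runs_weaken[OF runs_transfer[where zs = "rev (code t)"]]) auto
  show ?thesis
    unfolding dup_def using tsize_pos[of t]
    by (intro runs_weaken[OF runs_Seq[OF 1 runs_Seq[OF 2 runs_Seq[OF 3 runs_Seq[OF 4 5]]]]]) auto
qed

lemma runs_drop_tree:
  "runs drop_tree (30 * tsize t) [code t @ s0, s1, s2, s3] [s0, s1, s2, s3]"
proof -
  have 1: "runs (move_tree 1) (9 * tsize t + 8) [code t @ s0, s1, s2, s3]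
     [s0, rev (code t) @ mark # s1, s2, s3]"
    by (rule runs_move_tree_1)
  have "runs (Loop 1 (- {mark}) (Pop 1)) (3 * length zs + 1)
     [s0, zs @ mark # s1, s2, s3] [s0, mark # s1, s2, s3]" if "mark \<notin> set zs" for zs
    using that
  proof (induction zs)
    case Nil
    then show ?case by (intro runs_weaken[OF runs_Loop_end]) auto
  next
    case (Cons z zs)
    have 1: "runs (Pop 1) 1 [s0, (z # zs) @ mark # s1, s2, s3] [s0, zs @ mark # s1, s2, s3]"
      by (rule runs_weaken[OF runs_Pop]) simp_all
    have 2: "runs (Loop 1 (- {mark}) (Pop 1)) (3 * length zs + 1)
        [s0, zs @ mark # s1, s2, s3] [s0, mark # s1, s2, s3]"
      using Cons by simp
    show ?case
      by (rule runs_weaken[OF runs_Loop_step[OF _ _ 1 2]]) (use Cons.prems in auto)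
  qed
  from this[of "rev (code t)"] have 2: "runs (Loop 1 (- {mark}) (Pop 1)) (3 * tsize t + 1)
     [s0, rev (code t) @ mark # s1, s2, s3] [s0, mark # s1, s2, s3]"
    by simp
  have 3: "runs (Pop 1) 1 [s0, mark # s1, s2, s3] [s0, s1, s2, s3]"
    by (intro runs_weaken[OF runs_Pop]) auto
  show ?thesis
    unfolding drop_tree_def using tsize_pos[of t]
    by (intro runs_weaken[OF runs_Seq[OF 1 runs_Seq[OF 2 3]]]) auto
qed

lemma runs_swap:
  "runs swap (24 * (tsize t + tsize u))
     [code t @ code u @ s0, s1, s2, s3] [code u @ code t @ s0, s1, s2, s3]"
proof -
  have 1: "runs (move_tree 1) (9 * tsize t + 8) [code t @ code u @ s0, s1, s2, s3]
     [code u @ s0, rev (code t) @ mark # s1, s2, s3]"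
    by (rule runs_move_tree_1)
  have 2: "runs (move_tree 2) (9 * tsize u + 8)
     [code u @ s0, rev (code t) @ mark # s1, s2, s3]
     [s0, rev (code t) @ mark # s1, rev (code u) @ mark # s2, s3]"
    by (rule runs_move_tree_2)
  have 3: "runs (transfer 1 0) (5 * tsize t + 2)
     [s0, rev (code t) @ mark # s1, rev (code u) @ mark # s2, s3]
     [code t @ s0, s1, rev (code u) @ mark # s2, s3]"
    by (intro runs_weaken[OF runs_transfer[where zs = "rev (code t)"]]) auto
  have 4: "runs (transfer 2 0) (5 * tsize u + 2)
     [code t @ s0, s1, rev (code u) @ mark # s2, s3] [code u @ code t @ s0, s1, s2, s3]"
    by (intro runs_weaken[OF runs_transfer[where zs = "rev (code u)"]]) auto
  show ?thesis
    unfolding swap_def using tsize_pos[of t] tsize_pos[of u]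
    by (intro runs_weaken[OF runs_Seq[OF 1 runs_Seq[OF 2 runs_Seq[OF 3 4]]]]) auto
qed

text \<open>The fold places the pushes of later symbols first, so the first symbol of the code ends
  up on top.\<close>

definition push_tree :: "tree \<Rightarrow> 'a prog" where
  "push_tree t = foldr (\<lambda>a p. p ;; Push 0 a) (code t) Skip"

lemma runs_push_tree:
  "runs (push_tree t) (2 * tsize t) [s0, s1, s2, s3] [code t @ s0, s1, s2, s3]"
proof -
  have "runs (foldr (\<lambda>a p. p ;; Push 0 a) l Skip) (2 * length l) [s0, s1, s2, s3] [l @ s0, s1, s2, s3]" for l
  proof (induction l)
    case Nil
    show ?case by (simp add: runs_Skip)
  next
    case (Cons a l)
    then show ?case by (auto intro!: runs_weaken[OF runs_Seq[OF Cons runs_Push]])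
  qed
  from this[of "code t"] show ?thesis by (simp add: push_tree_def)
qed

definition mismatch :: "'a prog" where
  "mismatch = Pop 3 ;; Push 3 (Work 0)"

text \<open>If the second code runs out first, stack \<open>2\<close> shows \<open>mark\<close>,
  which counts as a mismatch with either symbol. The mark is never popped here and keeps shielding
  what lies below.\<close>

definition compare_body :: "'a prog" where
  "compare_body =
     Cond 1 {Work 0} (Cond 2 {Work 0} Skip mismatch) (Cond 2 {Work 1} Skip mismatch) ;;
     Pop 1 ;; Cond 2 {mark} Skip (Pop 2)"

text \<open>Stack \<open>3\<close> holds \<open>Work 1\<close> until a difference is found.\<close>

definition compare :: "'a prog" where
  "compare = move_tree 1 ;; move_tree 2 ;; Push 3 (Work 1) ;;
     Loop 1 (- {mark}) compare_body ;; Pop 1 ;;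
     Loop 2 (- {mark}) (mismatch ;; Pop 2) ;; Pop 2 ;;
     Cond 3 {Work 1} (push_tree (Node Leaf Leaf)) (push_tree Leaf) ;; Pop 3"

lemma runs_mismatch: "runs mismatch 3 [s0, s1, s2, f # s3] [s0, s1, s2, Work 0 # s3]"
  unfolding mismatch_def by (rule runs_weaken[OF runs_Seq[OF runs_Pop runs_Push]]) simp_all

lemma runs_compare_body:
  assumes "z \<in> {Work 0, Work 1}" "set ys \<subseteq> {Work 0, Work 1}"
  shows "runs compare_body 13 [r, z # zs, ys @ mark # b, f # c]
     [r, zs, tl ys @ mark # b, (if ys \<noteq> [] \<and> hd ys = z then f else Work 0) # c]"
proof -
  have 1: "runs (Cond 1 {Work 0} (Cond 2 {Work 0} Skip mismatch) (Cond 2 {Work 1} Skip mismatch)) 7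
      [r, z # zs, ys @ mark # b, f # c]
      [r, z # zs, ys @ mark # b, (if ys \<noteq> [] \<and> hd ys = z then f else Work 0) # c]"
    if "z = Work 0"
  proof (cases "ys \<noteq> [] \<and> hd ys = z")
    case True
    then show ?thesis using that
      by (intro runs_weaken[OF runs_CondT[OF _ _ runs_CondT[OF _ _ runs_Skip]]])
        (auto simp: peek_def)
  next
    case False
    then show ?thesis using that
      by (intro runs_weaken[OF runs_CondT[OF _ _ runs_CondF[OF _ _ runs_mismatch]]])
        (cases ys, auto simp: peek_def)+
  qed
  have 2: "runs (Cond 1 {Work 0} (Cond 2 {Work 0} Skip mismatch) (Cond 2 {Work 1} Skip mismatch)) 7
      [r, z # zs, ys @ mark # b, f # c]
      [r, z # zs, ys @ mark # b, (if ys \<noteq> [] \<and> hd ys = z then f else Work 0) # c]"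
    if "z = Work 1"
  proof (cases "ys \<noteq> [] \<and> hd ys = z")
    case True
    then show ?thesis using that
      by (intro runs_weaken[OF runs_CondF[OF _ _ runs_CondT[OF _ _ runs_Skip]]])
        (auto simp: peek_def)
  next
    case False
    then show ?thesis using that
      by (intro runs_weaken[OF runs_CondF[OF _ _ runs_CondF[OF _ _ runs_mismatch]]])
        (cases ys, auto simp: peek_def)+
  qed
  have 3: "runs (Pop 1) 1 [r, z # zs, ys @ mark # b, f # c] [r, zs, ys @ mark # b, f # c]" for f
    by (intro runs_weaken[OF runs_Pop]) auto
  have 4: "runs (Cond 2 {mark} Skip (Pop 2)) 3 [r, zs, ys @ mark # b, f # c]
      [r, zs, tl ys @ mark # b, f # c]" for f
  proof (cases ys)
    case Nil
    then show ?thesis by (intro runs_weaken[OF runs_CondT[OF _ _ runs_Skip]]) auto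
  next
    case (Cons y ys')
    then show ?thesis using assms(2) by (intro runs_weaken[OF runs_CondF[OF _ _ runs_Pop]]) auto
  qed
  from assms(1) 1 2 have 5:
    "runs (Cond 1 {Work 0} (Cond 2 {Work 0} Skip mismatch) (Cond 2 {Work 1} Skip mismatch)) 7
      [r, z # zs, ys @ mark # b, f # c]
      [r, z # zs, ys @ mark # b, (if ys \<noteq> [] \<and> hd ys = z then f else Work 0) # c]" by blast
  show ?thesis
    unfolding compare_body_def
    by (intro runs_weaken[OF runs_Seq[OF 5 runs_Seq[OF 3 4]]]) auto
qed

text \<open>The flag alone misses the case that the second list is longer, which shows only in a
  nonempty rest \<open>ys'\<close>; \<open>compare\<close> turns such a rest into a mismatch
  afterwards.\<close>

lemma runs_compare_loop:
  assumes "set xs \<subseteq> {Work 0, Work 1}" "set ys \<subseteq> {Work 0, Work 1}" "f \<in> {Work 0, Work 1}"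
  shows "\<exists>ys' f'. runs (Loop 1 (- {mark}) compare_body) (15 * length xs + 1)
      [r, xs @ mark # a, ys @ mark # b, f # c] [r, mark # a, ys' @ mark # b, f' # c] \<and>
      (f' = Work 1 \<and> ys' = [] \<longleftrightarrow> f = Work 1 \<and> xs = ys) \<and> f' \<in> {Work 0, Work 1} \<and>
      set ys' \<subseteq> {Work 0, Work 1} \<and> length ys' \<le> length ys"
  using assms
proof (induction xs arbitrary: ys f)
  case Nil
  have "runs (Loop 1 (- {mark}) compare_body) (15 * length [] + 1)
      [r, [] @ mark # a, ys @ mark # b, f # c] [r, mark # a, ys @ mark # b, f # c]"
    by (intro runs_weaken[OF runs_Loop_end]) auto
  then show ?case using Nil by blast
next
  case (Cons x xs)
  let ?f = "if ys \<noteq> [] \<and> hd ys = x then f else Work 0"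
  have tl: "set (tl ys) \<subseteq> {Work 0, Work 1}" using Cons.prems by (cases ys) auto
  have f: "set xs \<subseteq> {Work 0, Work 1}" "?f \<in> {Work 0, Work 1}" using Cons.prems by auto
  from Cons.IH[OF f(1) tl f(2)] obtain ys' f' where IH: "runs (Loop 1 (- {mark}) compare_body) (15 * length xs + 1)
      [r, xs @ mark # a, tl ys @ mark # b, ?f # c] [r, mark # a, ys' @ mark # b, f' # c]"
      "f' = Work 1 \<and> ys' = [] \<longleftrightarrow> ?f = Work 1 \<and> xs = tl ys" "f' \<in> {Work 0, Work 1}"
      "set ys' \<subseteq> {Work 0, Work 1}" "length ys' \<le> length (tl ys)"
    by (elim exE conjE) (rule that)
  have body: "runs compare_body 13 [r, (x # xs) @ mark # a, ys @ mark # b, f # c]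
      [r, xs @ mark # a, tl ys @ mark # b, ?f # c]"
    using runs_compare_body[of x ys r "xs @ mark # a" b f c] Cons.prems by simp
  have "runs (Loop 1 (- {mark}) compare_body) (15 * length (x # xs) + 1)
      [r, (x # xs) @ mark # a, ys @ mark # b, f # c] [r, mark # a, ys' @ mark # b, f' # c]"
    by (rule runs_weaken[OF runs_Loop_step[OF _ _ body IH(1)]]) (use Cons.prems in auto)
  moreover have "f' = Work 1 \<and> ys' = [] \<longleftrightarrow> f = Work 1 \<and> x # xs = ys"
    using IH(2) by (cases ys) auto
  ultimately show ?case using IH by (intro exI[of _ ys'] exI[of _ f']) auto
qed

lemma runs_compare:
  "runs compare (100 * (tsize t + tsize u)) [code t @ code u @ s0, s1, s2, s3]
     [code (if t = u then Node Leaf Leaf else Leaf) @ s0, s1, s2, s3]"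
proof -
  have 1: "runs (move_tree 1) (9 * tsize t + 8) [code t @ code u @ s0, s1, s2, s3]
     [code u @ s0, rev (code t) @ mark # s1, s2, s3]"
    by (rule runs_move_tree_1)
  have 2: "runs (move_tree 2) (9 * tsize u + 8)
     [code u @ s0, rev (code t) @ mark # s1, s2, s3]
     [s0, rev (code t) @ mark # s1, rev (code u) @ mark # s2, s3]"
    by (rule runs_move_tree_2)
  have 3: "runs (Push 3 (Work 1)) 2 [s0, rev (code t) @ mark # s1, rev (code u) @ mark # s2, s3]
     [s0, rev (code t) @ mark # s1, rev (code u) @ mark # s2, Work 1 # s3]"
    by (intro runs_weaken[OF runs_Push]) auto
  obtain ys' f' where 4: "runs (Loop 1 (- {mark}) compare_body) (15 * tsize t + 1)
      [s0, rev (code t) @ mark # s1, rev (code u) @ mark # s2, Work 1 # s3]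
      [s0, mark # s1, ys' @ mark # s2, f' # s3]"
      and flag: "f' = Work 1 \<and> ys' = [] \<longleftrightarrow> rev (code t) = (rev (code u) :: 'a tape_symbol list)"
      and ys': "set ys' \<subseteq> {Work 0, Work 1}" "length ys' \<le> tsize u"
    using runs_compare_loop[of "rev (code t)" "rev (code u)" "Work 1" s0 s1 s2 s3]
      set_code[of t] set_code[of u] by auto
  have 5: "runs (Pop 1) 1 [s0, mark # s1, ys' @ mark # s2, f' # s3]
      [s0, s1, ys' @ mark # s2, f' # s3]"
    by (intro runs_weaken[OF runs_Pop]) auto
  have "runs (Loop 2 (- {mark}) (mismatch ;; Pop 2)) (6 * length ys' + 1)
      [s0, s1, ys' @ mark # s2, f # s3] [s0, s1, mark # s2, (if ys' = [] then f else Work 0) # s3]" for f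
    using ys'(1)
  proof (induction ys' arbitrary: f)
    case Nil
    then show ?case by (intro runs_weaken[OF runs_Loop_end]) auto
  next
    case (Cons y ys)
    have 1: "runs (mismatch ;; Pop 2) 4
      [s0, s1, (y # ys) @ mark # s2, f # s3] [s0, s1, ys @ mark # s2, Work 0 # s3]"
      by (rule runs_weaken[OF runs_Seq[OF runs_mismatch runs_Pop]]) simp_all
    have 2: "runs (Loop 2 (- {mark}) (mismatch ;; Pop 2)) (6 * length ys + 1)
        [s0, s1, ys @ mark # s2, Work 0 # s3] [s0, s1, mark # s2, Work 0 # s3]"
      using Cons.IH[of "Work 0"] Cons.prems by simp
    show ?case
      by (rule runs_weaken[OF runs_Loop_step[OF _ _ 1 2]]) (use Cons.prems in auto)
  qed
  then have 6: "runs (Loop 2 (- {mark}) (mismatch ;; Pop 2)) (6 * tsize u + 1)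
      [s0, s1, ys' @ mark # s2, f' # s3]
      [s0, s1, mark # s2, (if ys' = [] then f' else Work 0) # s3]"
    by (rule runs_mono) (use ys'(2) in simp)
  have 7: "runs (Pop 2) 1 [s0, s1, mark # s2, f # s3] [s0, s1, s2, f # s3]" for f
    by (intro runs_weaken[OF runs_Pop]) auto
  have 8: "runs (Cond 3 {Work 1} (push_tree (Node Leaf Leaf)) (push_tree Leaf)) 8
     [s0, s1, s2, f # s3] [code (if f = Work 1 then Node Leaf Leaf else Leaf) @ s0, s1, s2, f # s3]" for f
  proof (cases "f = Work 1")
    case True
    then show ?thesis by (intro runs_weaken[OF runs_CondT[OF _ _ runs_push_tree]]) auto
  next
    case False
    then show ?thesis by (intro runs_weaken[OF runs_CondF[OF _ _ runs_push_tree]]) auto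
  qed
  have 9: "runs (Pop 3) 1 [x, s1, s2, f # s3] [x, s1, s2, s3]" for f x
    by (intro runs_weaken[OF runs_Pop]) auto
  have "(if ys' = [] then f' else Work 0) = Work 1 \<longleftrightarrow> t = u"
    using flag by auto
  then show ?thesis
    unfolding compare_def using tsize_pos[of t] tsize_pos[of u]
    by (intro runs_weaken[OF runs_Seq[OF 1 runs_Seq[OF 2 runs_Seq[OF 3 runs_Seq[OF 4
              runs_Seq[OF 5 runs_Seq[OF 6 runs_Seq[OF 7 runs_Seq[OF 8 9]]]]]]]]]) auto
qed

section \<open>Polynomial-time functions on encoded data\<close>

class enc =
  fixes enc :: "'a \<Rightarrow> tree"
  assumes enc_inject [simp]: "enc x = enc y \<longleftrightarrow> x = y"

definition sz :: "'a::enc \<Rightarrow> nat" where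
  "sz x = tsize (enc x)"

lemma sz_pos: "0 < sz x"
  by (simp add: sz_def tsize_pos)

text \<open>Natural coefficients make every polynomial monotone, so bounds can be substituted into
  bounds.\<close>

lemma poly_nat_mono: "x \<le> y \<Longrightarrow> poly p x \<le> poly (p :: nat poly) y"
  by (induction p) (auto intro: add_mono mult_mono)

definition pbound :: "('a::enc \<Rightarrow> nat) \<Rightarrow> bool" where
  "pbound h \<longleftrightarrow> (\<exists>p. \<forall>x. h x \<le> poly p (sz x))"

named_theorems pbound_intros

lemma pbound_const [pbound_intros]: "pbound (\<lambda>x. c)"
  unfolding pbound_def by (intro exI[of _ "[:c:]"]) simp

lemma pbound_sz [pbound_intros]: "pbound sz"
  unfolding pbound_def by (intro exI[of _ "[:0, 1:]"]) simp

lemma pbound_add [pbound_intros]: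
  assumes "pbound g" "pbound h" shows "pbound (\<lambda>x. g x + h x)"
proof -
  from assms obtain p q where "\<And>x. g x \<le> poly p (sz x)" "\<And>x. h x \<le> poly q (sz x)"
    by (auto simp: pbound_def)
  then show ?thesis unfolding pbound_def by (intro exI[of _ "p + q"]) (simp add: add_mono)
qed

lemma pbound_mult [pbound_intros]:
  assumes "pbound g" "pbound h" shows "pbound (\<lambda>x. g x * h x)"
proof -
  from assms obtain p q where "\<And>x. g x \<le> poly p (sz x)" "\<And>x. h x \<le> poly q (sz x)"
    by (auto simp: pbound_def)
  then show ?thesis unfolding pbound_def by (intro exI[of _ "p * q"]) (simp add: mult_mono)
qed

lemma pbound_mono: "pbound h \<Longrightarrow> (\<And>x. g x \<le> h x) \<Longrightarrow> pbound g"
  unfolding pbound_def by (meson le_trans)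

lemma pbound_poly [pbound_intros]:
  assumes "pbound g" shows "pbound (\<lambda>x. poly p (g x))"
proof -
  from assms obtain q where "\<And>x. g x \<le> poly q (sz x)" by (auto simp: pbound_def)
  then show ?thesis unfolding pbound_def
    by (intro exI[of _ "pcompose p q"]) (simp add: poly_pcompose poly_nat_mono)
qed

lemma pbound_compose:
  assumes "pbound h" "pbound (\<lambda>x. sz (f x))" shows "pbound (\<lambda>x. h (f x))"
proof -
  from assms obtain p where "\<And>x. h x \<le> poly p (sz x)" by (auto simp: pbound_def)
  then show ?thesis using pbound_poly[OF assms(2), of p] by (auto intro: pbound_mono)
qed

definition stack_symbols :: "letter tape_symbol set" where
  "stack_symbols = insert Blank (range Letter) \<union> Work ` {0, 1, 2}"

abbreviation valid_prog :: "letter prog \<Rightarrow> bool" where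
  "valid_prog p \<equiv> wf_prog 4 stack_symbols p"

lemma Work_in_stack_symbols:
  "Work 0 \<in> stack_symbols" "Work (Suc 0) \<in> stack_symbols" "mark \<in> stack_symbols"
  by (auto simp: stack_symbols_def)

lemma wf_stack_programs:
  "valid_prog dup" "valid_prog drop_tree" "valid_prog swap" "valid_prog compare" "valid_prog (push_tree t)"
proof -
  note * = Work_in_stack_symbols
  have "valid_prog (foldr (\<lambda>a p. p ;; Push 0 a) l Skip)" if "set l \<subseteq> stack_symbols" for l
    using that by (induction l) auto
  moreover have "set (code t) \<subseteq> stack_symbols" for t
    using set_code[of t] * by auto
  ultimately have push: "valid_prog (push_tree t)" for t
    by (simp add: push_tree_def)
  then show "valid_prog (push_tree t)" .
  show "valid_prog dup" "valid_prog drop_tree" "valid_prog swap" "valid_prog compare"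
    using * by (simp_all add: dup_def drop_tree_def swap_def compare_def move_tree_def
        move_body_def transfer_def compare_body_def mismatch_def push)
qed

text \<open>
  A function is computed on the top of stack \<open>0\<close>; the stacks below and the three auxiliary stacks
  are left as they were, so that programs can be composed freely.
\<close>

definition ptime :: "('a::enc \<Rightarrow> 'b::enc) \<Rightarrow> bool" where
  "ptime f \<longleftrightarrow> (\<exists>p h. valid_prog p \<and> pbound h \<and> (\<forall>x s0 s1 s2 s3.
     runs p (h x) [code (enc x) @ s0, s1, s2, s3] [code (enc (f x)) @ s0, s1, s2, s3]))"

lemma ptimeI:
  assumes "valid_prog p" "pbound h"
    "\<And>x s0 s1 s2 s3.
       runs p (h x) [code (enc x) @ s0, s1, s2, s3] [code (enc (f x)) @ s0, s1, s2, s3]"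
  shows "ptime f"
  unfolding ptime_def using assms by blast

text \<open>The program is run with everything else empty, so that the stacks hold the code alone;
  by \<open>exec_size\<close> they can grow no faster than time passes.\<close>

lemma ptime_pbound [pbound_intros]:
  assumes "ptime f" shows "pbound (\<lambda>x. sz (f x))"
proof -
  from assms obtain p h where "valid_prog p" and h: "pbound h" and
    r: "\<And>x s0 s1 s2 s3.
       runs p (h x) [code (enc x) @ s0, s1, s2, s3] [code (enc (f x)) @ s0, s1, s2, s3]"
    unfolding ptime_def by blast
  have "sz (f x) \<le> sz x + h x" for x
  proof -
    from r[of x "[]" "[]" "[]" "[]"] obtain t where "t \<le> h x"
      "exec p [code (enc x), [], [], []] t [code (enc (f x)), [], [], []]" by (auto simp: runs_def)
    from this(1) exec_size[OF this(2)] show ?thesis by (simp add: sz_def)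
  qed
  then show ?thesis by (rule pbound_mono[OF pbound_add[OF pbound_sz h]])
qed

text \<open>A program sees trees and not types, so it also computes any function that agrees on the
  trees. This transports results between pairs and list cells, or between digit lists and numbers.
  The time bound is first made a polynomial in the size, because \<open>h\<close> lives on the other
  type.\<close>

lemma ptime_retype:
  assumes "ptime f" "\<And>x. \<exists>y. enc y = enc x \<and> enc (f y) = enc (f' x)"
  shows "ptime f'"
proof -
  from assms(1) obtain p h where *: "valid_prog p" "pbound h"
    "\<And>x s0 s1 s2 s3.
       runs p (h x) [code (enc x) @ s0, s1, s2, s3] [code (enc (f x)) @ s0, s1, s2, s3]"
    unfolding ptime_def by blast
  from *(2) obtain q where q: "\<And>x. h x \<le> poly q (sz x)" by (auto simp: pbound_def)
  show ?thesis
  proof (rule ptimeI[OF *(1)])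
    show "pbound (\<lambda>x :: 'c. poly q (sz x))" by (intro pbound_intros)
    fix x :: 'c and s0 s1 s2 s3
    from assms(2) obtain y where y: "enc y = enc x" "enc (f y) = enc (f' x)" by blast
    then show "runs p (poly q (sz x)) [code (enc x) @ s0, s1, s2, s3]
        [code (enc (f' x)) @ s0, s1, s2, s3]"
      using runs_mono[OF *(3)[of y s0 s1 s2 s3] q[of y]] by (simp add: sz_def)
  qed
qed

named_theorems ptime_intros

lemma ptime_id [ptime_intros]: "ptime (\<lambda>x. x)"
  by (rule ptimeI[where p = Skip and h = "\<lambda>_. 0"]) (simp_all add: pbound_const runs_Skip)

lemma ptime_const [ptime_intros]: "ptime (\<lambda>x. c)"
proof (rule ptimeI)
  show "valid_prog (drop_tree ;; push_tree (enc c))" by (simp add: wf_stack_programs)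
  show "pbound (\<lambda>x. 30 * sz x + 2 * sz c)" by (intro pbound_intros)
  fix x :: 'a and s0 s1 s2 s3
  show "runs (drop_tree ;; push_tree (enc c)) (30 * sz x + 2 * sz c) [code (enc x) @ s0, s1, s2, s3]
      [code (enc c) @ s0, s1, s2, s3]"
    by (rule runs_weaken[OF runs_Seq[OF runs_drop_tree runs_push_tree]]) (simp_all add: sz_def)
qed

lemma ptime_compose:
  assumes "ptime g" "ptime f"
  shows "ptime (\<lambda>x. g (f x))"
proof -
  from assms(2) obtain p h where p: "valid_prog p" "pbound h"
    "\<And>x s0 s1 s2 s3. runs p (h x) [code (enc x) @ s0, s1, s2, s3] [code (enc (f x)) @ s0, s1, s2, s3]"
    unfolding ptime_def by blast
  from assms(1) obtain q k where q: "valid_prog q" "pbound k"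
    "\<And>x s0 s1 s2 s3. runs q (k x) [code (enc x) @ s0, s1, s2, s3] [code (enc (g x)) @ s0, s1, s2, s3]"
    unfolding ptime_def by blast
  show ?thesis
  proof (rule ptimeI)
    show "valid_prog (p ;; q)" using p q by simp
    show "pbound (\<lambda>x. h x + k (f x))"
      by (intro pbound_intros p(2) pbound_compose[OF q(2)] assms)
  qed (rule runs_Seq[OF p(3) q(3)])
qed

section \<open>Encodings of data types\<close>

text \<open>The two truth values differ in the first symbol of their codes, so a branch or the final
  verdict needs to read one symbol only.\<close>

instantiation bool :: enc
begin
definition enc_bool :: "bool \<Rightarrow> tree" where
  "enc_bool b = (if b then Node Leaf Leaf else Leaf)"
instance by standard (auto simp: enc_bool_def)
end

instantiation prod :: (enc, enc) enc
begin
definition enc_prod :: "'a \<times> 'b \<Rightarrow> tree" where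
  "enc_prod p = Node (enc (fst p)) (enc (snd p))"
instance by standard (auto simp: enc_prod_def prod_eq_iff)
end

text \<open>A nonempty list has the tree of the pair of its head and tail; \<open>ptime_Cons\<close>
  and \<open>ptime_case_list\<close> rest on this.\<close>

instantiation list :: (enc) enc
begin
primrec enc_list :: "'a list \<Rightarrow> tree" where
  "enc_list [] = Leaf"
| "enc_list (a # l) = Node (enc a) (enc_list l)"
instance
proof
  fix x y :: "'a list"
  show "enc x = enc y \<longleftrightarrow> x = y"
  proof (induction x arbitrary: y)
    case Nil
    show ?case by (cases y) auto
  next
    case (Cons a x)
    then show ?case by (cases y) auto
  qed
qed
end

text \<open>\<open>Some a\<close> has the tree of \<open>(a, False)\<close>, which reduces options
  to pairs.\<close>

instantiation option :: (enc) enc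
begin
definition enc_option :: "'a option \<Rightarrow> tree" where
  "enc_option x = (case x of None \<Rightarrow> Leaf | Some a \<Rightarrow> Node (enc a) Leaf)"
instance by standard (auto simp: enc_option_def split: option.splits)
end

text \<open>Both digits get trees of the same size, so that the size of a number depends on its length only.\<close>

instantiation letter :: enc
begin
primrec enc_letter :: "letter \<Rightarrow> tree" where
  "enc_letter (Digit b) = (if b then Node Leaf (Node Leaf Leaf) else Node (Node Leaf Leaf) Leaf)"
| "enc_letter Plus = Leaf"
| "enc_letter Minus = Node Leaf Leaf"
| "enc_letter Hash = Node (Node Leaf Leaf) (Node Leaf Leaf)"
| "enc_letter Semicolon = Node Leaf (Node Leaf (Node Leaf Leaf))"
| "enc_letter Bar = Node (Node Leaf (Node Leaf Leaf)) Leaf"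
instance
proof
  fix x y :: letter
  show "enc x = enc y \<longleftrightarrow> x = y" by (cases x; cases y) auto
qed
end

fun val_nat :: "letter list \<Rightarrow> nat" where
  "val_nat (Digit b # l) = of_bool b + 2 * val_nat l"
| "val_nat l = 0"

lemma val_enc_nat [simp]: "val_nat (enc_nat n) = n"
proof (induction n rule: less_induct)
  case (less n)
  then show ?case
    by (subst enc_nat.simps) (auto simp: of_bool_def)
qed

lemma enc_nat_inject [simp]: "enc_nat m = enc_nat n \<longleftrightarrow> m = n"
  by (metis val_enc_nat)

lemma enc_int_inject [simp]: "enc_int y = enc_int z \<longleftrightarrow> y = z"
  by (auto simp: enc_int_def split: if_splits)

text \<open>A number has the tree of its binary notation, so that \<open>enc_nat\<close> is the
  identity on trees and can be computed for free; likewise for integers and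
  \<open>enc_int\<close>.\<close>

instantiation nat :: enc
begin
definition enc_nat_tree: "enc n = enc (enc_nat n)"
instance by standard (simp add: enc_nat_tree)
end

instantiation int :: enc
begin
definition enc_int_tree: "enc z = enc (enc_int z)"
instance by standard (simp add: enc_int_tree)
end

lemma sz_bool [simp]: "sz True = 3" "sz False = 1"
  by (simp_all add: sz_def enc_bool_def)

lemma sz_prod [simp]: "sz (a, b) = Suc (sz a + sz b)"
  by (simp add: sz_def enc_prod_def)

lemma sz_list [simp]: "sz [] = 1" "sz (a # l) = Suc (sz a + sz l)"
  by (simp_all add: sz_def)

lemma sz_option [simp]: "sz None = 1" "sz (Some a) = sz a + 2"
  by (simp_all add: sz_def enc_option_def)

lemma sz_letter [simp]:
  "sz (Digit b) = 5" "sz Plus = 1" "sz Minus = 3" "sz Hash = 7" "sz Semicolon = 7" "sz Bar = 7"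
  by (simp_all add: sz_def)

lemma sz_bool_le: "sz (b :: bool) \<le> 3"
  by (cases b) simp_all

lemma length_le_sz: "length l \<le> sz l"
  by (induction l) auto

lemma member_sz: "a \<in> set l \<Longrightarrow> sz a \<le> sz l"
  by (induction l) auto

section \<open>Closure properties\<close>

text \<open>A program leaves alone what lies under its argument, so \<open>f\<close> can run above a
  copy of \<open>x\<close> and \<open>g\<close> above the result of \<open>f\<close>. The last swap
  brings the first component to the top, and \<open>Work 1\<close> is the root of the pair.\<close>

lemma ptime_Pair [ptime_intros]:
  assumes "ptime f" "ptime g"
  shows "ptime (\<lambda>x. (f x, g x))"
proof -
  from assms(1) obtain p h where p: "valid_prog p" "pbound h"
    "\<And>x s0 s1 s2 s3. runs p (h x) [code (enc x) @ s0, s1, s2, s3] [code (enc (f x)) @ s0, s1, s2, s3]"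
    unfolding ptime_def by blast
  from assms(2) obtain q k where q: "valid_prog q" "pbound k"
    "\<And>x s0 s1 s2 s3. runs q (k x) [code (enc x) @ s0, s1, s2, s3] [code (enc (g x)) @ s0, s1, s2, s3]"
    unfolding ptime_def by blast
  let ?p = "dup ;; p ;; swap ;; q ;; swap ;; Push 0 (Work 1)"
  let ?t = "\<lambda>x. 60 * sz x + (h x + (24 * (sz (f x) + sz x) + (k x + (24 * (sz (g x) + sz (f x)) + 2))))"
  show ?thesis
  proof (rule ptimeI)
    show "valid_prog ?p" using p q by (simp add: wf_stack_programs Work_in_stack_symbols)
    show "pbound ?t"
      by (intro pbound_intros p q assms)
    fix x :: 'a and s0 s1 s2 s3
    show "runs ?p (?t x) [code (enc x) @ s0, s1, s2, s3] [code (enc (f x, g x)) @ s0, s1, s2, s3]"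
      by (rule runs_weaken[OF runs_Seq[OF runs_dup runs_Seq[OF p(3) runs_Seq[OF runs_swap
                  runs_Seq[OF q(3) runs_Seq[OF runs_swap runs_Push]]]]]])
        (simp_all add: sz_def enc_prod_def)
  qed
qed

lemma ptime_fst' : "ptime fst"
proof (rule ptimeI)
  show "valid_prog (Pop 0 ;; swap ;; drop_tree)" by (simp add: wf_stack_programs)
  show "pbound (\<lambda>x :: 'a \<times> 'b. 1 + (24 * sz x + 30 * sz x))" by (intro pbound_intros)
  fix x :: "'a \<times> 'b" and s0 s1 s2 s3
  have 1: "runs (Pop 0) 1 [code (enc x) @ s0, s1, s2, s3]
      [code (enc (fst x)) @ code (enc (snd x)) @ s0, s1, s2, s3]"
    by (rule runs_weaken[OF runs_Pop]) (simp_all add: enc_prod_def)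
  show "runs (Pop 0 ;; swap ;; drop_tree) (1 + (24 * sz x + 30 * sz x)) [code (enc x) @ s0, s1, s2, s3]
      [code (enc (fst x)) @ s0, s1, s2, s3]"
    by (rule runs_weaken[OF runs_Seq[OF 1 runs_Seq[OF runs_swap runs_drop_tree]]])
      (simp_all add: sz_def enc_prod_def)
qed

lemma ptime_snd' : "ptime snd"
proof (rule ptimeI)
  show "valid_prog (Pop 0 ;; drop_tree)" by (simp add: wf_stack_programs)
  show "pbound (\<lambda>x :: 'a \<times> 'b. 1 + 30 * sz x)" by (intro pbound_intros)
  fix x :: "'a \<times> 'b" and s0 s1 s2 s3
  have 1: "runs (Pop 0) 1 [code (enc x) @ s0, s1, s2, s3]
      [code (enc (fst x)) @ code (enc (snd x)) @ s0, s1, s2, s3]"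
    by (rule runs_weaken[OF runs_Pop]) (simp_all add: enc_prod_def)
  show "runs (Pop 0 ;; drop_tree) (1 + 30 * sz x) [code (enc x) @ s0, s1, s2, s3]
      [code (enc (snd x)) @ s0, s1, s2, s3]"
    by (rule runs_weaken[OF runs_Seq[OF 1 runs_drop_tree]]) (simp_all add: sz_def enc_prod_def)
qed

lemmas ptime_fst [ptime_intros] = ptime_compose[OF ptime_fst']
lemmas ptime_snd [ptime_intros] = ptime_compose[OF ptime_snd']

lemma ptime_eq' : "ptime (\<lambda>p :: 'a::enc \<times> 'a. fst p = snd p)"
proof (rule ptimeI)
  show "valid_prog (Pop 0 ;; compare)" by (simp add: wf_stack_programs)
  show "pbound (\<lambda>x :: 'a \<times> 'a. 1 + 100 * sz x)" by (intro pbound_intros)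
  fix x :: "'a \<times> 'a" and s0 s1 s2 s3
  have 1: "runs (Pop 0) 1 [code (enc x) @ s0, s1, s2, s3]
      [code (enc (fst x)) @ code (enc (snd x)) @ s0, s1, s2, s3]"
    by (rule runs_weaken[OF runs_Pop]) (simp_all add: enc_prod_def)
  show "runs (Pop 0 ;; compare) (1 + 100 * sz x) [code (enc x) @ s0, s1, s2, s3]
      [code (enc (fst x = snd x)) @ s0, s1, s2, s3]"
    by (rule runs_weaken[OF runs_Seq[OF 1 runs_compare]])
      (simp_all add: sz_def enc_prod_def enc_bool_def)
qed

lemma ptime_eq [ptime_intros]:
  assumes "ptime f" "ptime g"
  shows "ptime (\<lambda>x. f x = g x)"
  using ptime_compose[OF ptime_eq' ptime_Pair[OF assms]] by simp

lemma ptime_If [ptime_intros]: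
  assumes "ptime c" "ptime f" "ptime g"
  shows "ptime (\<lambda>x. if c x then f x else g x)"
proof -
  from assms(1) obtain o' l where c: "valid_prog o'" "pbound l"
    "\<And>x s0 s1 s2 s3. runs o' (l x) [code (enc x) @ s0, s1, s2, s3] [code (enc (c x)) @ s0, s1, s2, s3]"
    unfolding ptime_def by blast
  from assms(2) obtain p h where p: "valid_prog p" "pbound h"
    "\<And>x s0 s1 s2 s3. runs p (h x) [code (enc x) @ s0, s1, s2, s3] [code (enc (f x)) @ s0, s1, s2, s3]"
    unfolding ptime_def by blast
  from assms(3) obtain q k where q: "valid_prog q" "pbound k"
    "\<And>x s0 s1 s2 s3. runs q (k x) [code (enc x) @ s0, s1, s2, s3] [code (enc (g x)) @ s0, s1, s2, s3]"
    unfolding ptime_def by blast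
  let ?p = "dup ;; o' ;; Cond 0 {Work 1} (drop_tree ;; p) (drop_tree ;; q)"
  \<comment> \<open>\<open>92 = 30 * 3 + 2\<close>: dropping a truth value, whose code has at most
    three symbols, and the branching itself.\<close>
  let ?t = "\<lambda>x. 60 * sz x + (l x + (92 + h x + k x))"
  show ?thesis
  proof (rule ptimeI)
    show "valid_prog ?p" using c p q by (simp add: wf_stack_programs)
    show "pbound ?t" by (intro pbound_intros c p q)
    fix x :: 'a and s0 s1 s2 s3
    have "runs (Cond 0 {Work 1} (drop_tree ;; p) (drop_tree ;; q)) (92 + h x + k x)
        [code (enc (c x)) @ code (enc x) @ s0, s1, s2, s3]
        [code (enc (if c x then f x else g x)) @ s0, s1, s2, s3]"
    proof (cases "c x")
      case True
      show ?thesis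
        by (rule runs_weaken[OF runs_CondT[OF _ _ runs_Seq[OF runs_drop_tree p(3)]]])
          (simp_all add: True enc_bool_def)
    next
      case False
      show ?thesis
        by (rule runs_weaken[OF runs_CondF[OF _ _ runs_Seq[OF runs_drop_tree q(3)]]])
          (simp_all add: False enc_bool_def)
    qed
    from runs_Seq[OF runs_dup runs_Seq[OF c(3) this]]
    show "runs ?p (?t x) [code (enc x) @ s0, s1, s2, s3]
        [code (enc (if c x then f x else g x)) @ s0, s1, s2, s3]"
      by (simp add: sz_def)
  qed
qed

lemma ptime_not [ptime_intros]: "ptime f \<Longrightarrow> ptime (\<lambda>x. \<not> f x)"
  using ptime_eq[of f "\<lambda>x. False"] by (simp add: ptime_const)

lemma ptime_conj [ptime_intros]:
  assumes "ptime f" "ptime g"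
  shows "ptime (\<lambda>x. f x \<and> g x)"
proof -
  have "(\<lambda>x. f x \<and> g x) = (\<lambda>x. if f x then g x else False)" by auto
  then show ?thesis by (elim ssubst) (rule ptime_If[OF assms ptime_const])
qed

lemma ptime_disj [ptime_intros]:
  assumes "ptime f" "ptime g"
  shows "ptime (\<lambda>x. f x \<or> g x)"
proof -
  have "(\<lambda>x. f x \<or> g x) = (\<lambda>x. if f x then True else g x)" by auto
  then show ?thesis by (elim ssubst) (rule ptime_If[OF assms(1) ptime_const assms(2)])
qed

lemma ptime_imp [ptime_intros]: "ptime f \<Longrightarrow> ptime g \<Longrightarrow> ptime (\<lambda>x. f x \<longrightarrow> g x)"
  unfolding imp_conv_disj by (rule ptime_disj[OF ptime_not])

text \<open>The common core of case distinctions on lists and options. The first symbol of the code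
  of \<open>l x\<close> selects the branch, and \<open>h\<close> receives the same tree read as a
  value \<open>d\<close> of another type, usually a pair of components.\<close>

lemma ptime_node_cases:
  fixes l :: "'a::enc \<Rightarrow> 'c::enc" and h :: "'a \<times> 'd::enc \<Rightarrow> 'b::enc"
  assumes "ptime l" "ptime g" "ptime h"
    and "\<And>x. enc (l x) = Leaf \<Longrightarrow> r x = g x"
    and "\<And>x. enc (l x) \<noteq> Leaf \<Longrightarrow> \<exists>d. enc d = enc (l x) \<and> r x = h (x, d)"
  shows "ptime r"
proof -
  from assms(1) obtain o' j where c: "valid_prog o'" "pbound j"
    "\<And>x s0 s1 s2 s3. runs o' (j x) [code (enc x) @ s0, s1, s2, s3] [code (enc (l x)) @ s0, s1, s2, s3]"
    unfolding ptime_def by blast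
  from assms(2) obtain p h' where p: "valid_prog p" "pbound h'"
    "\<And>x s0 s1 s2 s3. runs p (h' x) [code (enc x) @ s0, s1, s2, s3] [code (enc (g x)) @ s0, s1, s2, s3]"
    unfolding ptime_def by blast
  from assms(3) obtain q k where q: "valid_prog q" "pbound k"
    "\<And>x s0 s1 s2 s3. runs q (k x) [code (enc x) @ s0, s1, s2, s3] [code (enc (h x)) @ s0, s1, s2, s3]"
    unfolding ptime_def by blast
  from q(2) obtain k' where k': "\<And>x. k x \<le> poly k' (sz x)" unfolding pbound_def by blast
  let ?c = "Cond 0 {Work 1} (swap ;; Push 0 (Work 1) ;; q) (drop_tree ;; p)"
  \<comment> \<open>\<open>sz x + sz (l x) + 1\<close> is the size of \<open>(x, d)\<close>, as
    \<open>d\<close> and \<open>l x\<close> share their tree.\<close>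
  let ?t = "\<lambda>x. 60 * sz x + (j x + (34 + 24 * (sz (l x) + sz x) + h' x + poly k' (sz x + sz (l x) + 1)))"
  show ?thesis
  proof (rule ptimeI)
    show "valid_prog (dup ;; o' ;; ?c)" using c p q by (simp add: wf_stack_programs Work_in_stack_symbols)
    show "pbound ?t" by (intro pbound_intros c p assms)
    fix x :: 'a and s0 s1 s2 s3
    have "runs ?c (34 + 24 * (sz (l x) + sz x) + h' x + poly k' (sz x + sz (l x) + 1))
        [code (enc (l x)) @ code (enc x) @ s0, s1, s2, s3] [code (enc (r x)) @ s0, s1, s2, s3]"
    proof (cases "enc (l x)")
      case Leaf
      show ?thesis
        by (rule runs_weaken[OF runs_CondF[OF _ _ runs_Seq[OF runs_drop_tree p(3)]]])
          (simp_all add: Leaf assms(4))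
    next
      case (Node t u)
      with assms(5)[of x] obtain d where d: "enc d = enc (l x)" "r x = h (x, d)" by auto
      have 1: "runs (Push 0 (Work 1)) 2 [code (enc x) @ code (enc (l x)) @ s0, s1, s2, s3]
          [code (enc (x, d)) @ s0, s1, s2, s3]"
        by (rule runs_weaken[OF runs_Push]) (simp_all add: enc_prod_def d)
      show ?thesis
        by (rule runs_weaken[OF runs_CondT[OF _ _ runs_Seq[OF runs_swap runs_Seq[OF 1 q(3)]]]])
          (use k'[of "(x, d)"] d in \<open>simp_all add: Node sz_def enc_prod_def\<close>)
    qed
    from runs_Seq[OF runs_dup runs_Seq[OF c(3) this]]
    show "runs (dup ;; o' ;; ?c) (?t x) [code (enc x) @ s0, s1, s2, s3] [code (enc (r x)) @ s0, s1, s2, s3]"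
      by (simp add: sz_def)
  qed
qed

lemma ptime_case_list [ptime_intros]:
  fixes l :: "'a::enc \<Rightarrow> 'c::enc list"
  assumes "ptime l" "ptime g" "ptime (\<lambda>p. h (fst p) (fst (snd p)) (snd (snd p)))"
  shows "ptime (\<lambda>x. case l x of [] \<Rightarrow> g x | a # m \<Rightarrow> h x a m)"
proof (rule ptime_node_cases[OF assms])
  fix x assume "enc (l x) \<noteq> Leaf"
  then obtain a m where "l x = a # m" by (cases "l x") auto
  then show "\<exists>d. enc d = enc (l x) \<and> (case l x of [] \<Rightarrow> g x | a # m \<Rightarrow> h x a m) =
      h (fst (x, d)) (fst (snd (x, d))) (snd (snd (x, d)))"
    by (intro exI[of _ "(a, m)"]) (simp add: enc_prod_def)
next
  fix x assume "enc (l x) = Leaf"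
  then show "(case l x of [] \<Rightarrow> g x | a # m \<Rightarrow> h x a m) = g x" by (cases "l x") auto
qed

lemma ptime_case_option [ptime_intros]:
  fixes l :: "'a::enc \<Rightarrow> 'c::enc option"
  assumes "ptime l" "ptime g" "ptime (\<lambda>p. h (fst p) (snd p))"
  shows "ptime (\<lambda>x. case l x of None \<Rightarrow> g x | Some a \<Rightarrow> h x a)"
proof -
  have "ptime (\<lambda>p :: 'a \<times> 'c \<times> bool. (fst p, fst (snd p)))"
    by (intro ptime_intros)
  from ptime_compose[OF assms(3) this]
  have "ptime (\<lambda>p :: 'a \<times> 'c \<times> bool. h (fst p) (fst (snd p)))"
    by simp
  then show ?thesis
  proof (rule ptime_node_cases[OF assms(1,2)])
    fix x assume "enc (l x) \<noteq> Leaf"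
    then obtain a where "l x = Some a" by (cases "l x") (auto simp: enc_option_def)
    then show "\<exists>d. enc d = enc (l x) \<and> (case l x of None \<Rightarrow> g x | Some a \<Rightarrow> h x a) =
        h (fst (x, d)) (fst (snd (x, d :: 'c \<times> bool)))"
      by (intro exI[of _ "(a, False)"]) (simp add: enc_prod_def enc_option_def enc_bool_def)
  next
    fix x assume "enc (l x) = Leaf"
    then show "(case l x of None \<Rightarrow> g x | Some a \<Rightarrow> h x a) = g x"
      by (cases "l x") (auto simp: enc_option_def)
  qed
qed

lemma ptime_Let [ptime_intros]:
  assumes "ptime (\<lambda>p. h (fst p) (snd p))" "ptime f"
  shows "ptime (\<lambda>x. let y = f x in h x y)"
  using ptime_compose[OF assms(1) ptime_Pair[OF ptime_id assms(2)]] by (simp add: Let_def)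

lemma ptime_Cons [ptime_intros]:
  assumes "ptime f" "ptime g"
  shows "ptime (\<lambda>x. f x # g x)"
  by (rule ptime_retype[OF ptime_Pair[OF assms]]) (auto simp: enc_prod_def)

lemma ptime_Some [ptime_intros]:
  assumes "ptime f"
  shows "ptime (\<lambda>x. Some (f x))"
  by (rule ptime_retype[OF ptime_Pair[OF assms ptime_const[of False]]])
    (auto simp: enc_prod_def enc_option_def enc_bool_def)

lemma ptime_tl [ptime_intros]:
  assumes "ptime f"
  shows "ptime (\<lambda>x. tl (f x))"
proof -
  have "tl l = (case l of [] \<Rightarrow> [] | a # m \<Rightarrow> m)" for l :: "'b list" by (cases l) auto
  then show ?thesis using assms by (simp only:) (intro ptime_intros)
qed

text \<open>Bounding the time of a single step is not enough: an accumulator that doubles in each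
  round becomes exponentially large. With all intermediate accumulators bounded by \<open>B\<close>,
  every round takes polynomial time, and there are no more rounds than list elements.\<close>

lemma ptime_foldl_bounded:
  fixes l :: "'a::enc \<Rightarrow> 'b::enc list" and init :: "'a \<Rightarrow> 'c::enc"
  assumes g: "ptime (\<lambda>p. g (fst p) (fst (snd p)) (snd (snd p)))"
    and "ptime init" "ptime l"
    and B: "pbound B" "\<And>x k. sz (foldl (g x) (init x) (take k (l x))) \<le> B x"
  shows "ptime (\<lambda>x. foldl (g x) (init x) (l x))"
proof -
  define next_state where "next_state = (\<lambda>s :: 'b list \<times> 'a \<times> 'c. case fst s of [] \<Rightarrow> s
      | a # m \<Rightarrow> (m, fst (snd s), g (fst (snd s)) (snd (snd s)) a))"
  have g': "ptime (\<lambda>p. g (f1 p) (f2 p) (f3 p))" if "ptime f1" "ptime f2" "ptime f3"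
    for f1 :: "'d::enc \<Rightarrow> 'a" and f2 f3
    using ptime_compose[OF g ptime_Pair[OF that(1) ptime_Pair[OF that(2,3)]]] by simp
  have "ptime next_state" unfolding next_state_def by (intro ptime_intros g')
  then obtain q k where q: "valid_prog q" "pbound k"
    "\<And>x s0 s1 s2 s3.
       runs q (k x) [code (enc x) @ s0, s1, s2, s3] [code (enc (next_state x)) @ s0, s1, s2, s3]"
    unfolding ptime_def by blast
  then obtain P where P: "\<And>x. k x \<le> poly P (sz x)" unfolding pbound_def by blast
  have "ptime (\<lambda>x. (l x, x, init x))" by (intro ptime_intros assms)
  then obtain p h where p: "valid_prog p" "pbound h"
    "\<And>x s0 s1 s2 s3.
       runs p (h x) [code (enc x) @ s0, s1, s2, s3] [code (enc (l x, x, init x)) @ s0, s1, s2, s3]"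
    unfolding ptime_def by blast
  have "ptime (\<lambda>p :: 'a \<times> 'c. snd p)" by (intro ptime_intros)
  then obtain o' j where o': "valid_prog o'" "pbound j"
    "\<And>x s0 s1 s2 s3.
       runs o' (j x) [code (enc x) @ s0, s1, s2, s3] [code (enc (snd (x :: 'a \<times> 'c))) @ s0, s1, s2, s3]"
    unfolding ptime_def by blast
  then obtain Q where Q: "\<And>x. j x \<le> poly Q (sz x)" unfolding pbound_def by blast
  \<comment> \<open>Without its root symbol the code of the state begins with the code of the
    remaining list, so the loop test sees whether that list is empty. Each round puts the root back,
    applies \<open>next_state\<close> and removes the root again.\<close>
  let ?loop = "Loop 0 {Work 1} (Push 0 (Work 1) ;; q ;; Pop 0)"
  let ?t = "\<lambda>x. poly P (sz (l x) + sz x + B x + 2) + 5"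
  have loop: "runs ?loop (length m * ?t x + 1)
      [code (enc m) @ code (enc (x, acc)) @ s0, s1, s2, s3]
      [code Leaf @ code (enc (x, foldl (g x) acc m)) @ s0, s1, s2, s3]"
    if "sz m \<le> sz (l x)" "\<And>k. sz (foldl (g x) acc (take k m)) \<le> B x" for x acc m s0 s1 s2 s3
    using that
  proof (induction m arbitrary: acc)
    case Nil
    show ?case by (rule runs_weaken[OF runs_Loop_end]) simp_all
  next
    case (Cons a m)
    let ?acc = "g x acc a"
    have 1: "runs (Push 0 (Work 1)) 2 [code (enc (a # m)) @ code (enc (x, acc)) @ s0, s1, s2, s3]
        [code (enc (a # m, x, acc)) @ s0, s1, s2, s3]"
      by (rule runs_weaken[OF runs_Push]) (simp_all add: enc_prod_def)
    have 2: "runs (Pop 0) 1 [code (enc (next_state (a # m, x, acc))) @ s0, s1, s2, s3]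
        [code (enc m) @ code (enc (x, ?acc)) @ s0, s1, s2, s3]"
      by (rule runs_weaken[OF runs_Pop]) (simp_all add: enc_prod_def next_state_def)
    have 3: "runs ?loop (length m * ?t x + 1)
        [code (enc m) @ code (enc (x, ?acc)) @ s0, s1, s2, s3]
        [code Leaf @ code (enc (x, foldl (g x) acc (a # m))) @ s0, s1, s2, s3]"
    proof -
      have "sz (foldl (g x) ?acc (take k m)) \<le> B x" for k
        using Cons.prems(2)[of "Suc k"] by simp
      then show ?thesis using Cons.IH[of ?acc] Cons.prems(1) by simp
    qed
    have "sz acc \<le> B x" using Cons.prems(2)[of 0] by simp
    then have "k (a # m, x, acc) \<le> poly P (sz (l x) + sz x + B x + 2)"
      using Cons.prems(1) by (intro le_trans[OF P] poly_nat_mono) simp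
    then show ?case
      by (intro runs_weaken[OF runs_Loop_step[OF _ _ runs_Seq[OF 1 runs_Seq[OF q(3) 2]] 3]]) simp_all
  qed
  let ?T = "\<lambda>x. h x + (1 + ((sz (l x) * ?t x + 1) + (1 + poly Q (sz x + B x + 1))))"
  show ?thesis
  proof (rule ptimeI)
    show "valid_prog (p ;; Pop 0 ;; ?loop ;; Pop 0 ;; o')" using p q o' by (simp add: Work_in_stack_symbols)
    show "pbound ?T" by (intro pbound_intros p assms)
    fix x :: 'a and s0 s1 s2 s3 :: "letter tape_symbol list"
    let ?r = "foldl (g x) (init x) (l x)"
    have 1: "runs (Pop 0) 1 [code (enc (l x, x, init x)) @ s0, s1, s2, s3]
        [code (enc (l x)) @ code (enc (x, init x)) @ s0, s1, s2, s3]"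
      by (rule runs_weaken[OF runs_Pop]) (simp_all add: enc_prod_def)
    have 2: "runs (Pop 0) 1 [code Leaf @ code (enc (x, ?r)) @ s0, s1, s2, s3]
        [code (enc (x, ?r)) @ s0, s1, s2, s3]"
      by (rule runs_weaken[OF runs_Pop]) simp_all
    have 3: "runs o' (j (x, ?r)) [code (enc (x, ?r)) @ s0, s1, s2, s3] [code (enc ?r) @ s0, s1, s2, s3]"
      using o'(3)[of "(x, ?r)"] by simp
    have "sz ?r \<le> B x" using B(2)[of x "length (l x)"] by simp
    then have 4: "j (x, ?r) \<le> poly Q (sz x + B x + 1)"
      by (intro le_trans[OF Q] poly_nat_mono) simp
    have 5: "length (l x) * ?t x \<le> sz (l x) * ?t x"
      by (intro mult_right_mono length_le_sz) simp
    show "runs (p ;; Pop 0 ;; ?loop ;; Pop 0 ;; o') (?T x) [code (enc x) @ s0, s1, s2, s3]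
        [code (enc ?r) @ s0, s1, s2, s3]"
    proof (rule runs_mono[OF runs_Seq[OF p(3) runs_Seq[OF 1
            runs_Seq[OF loop[OF le_refl B(2)] runs_Seq[OF 2 3]]]]])
      show "h x + (1 + (length (l x) * ?t x + 1 + (1 + j (x, ?r)))) \<le> ?T x"
        using 4 5 by linarith
    qed
  qed
qed

text \<open>If a step adds an amount that depends on \<open>x\<close> and the list element but not
  on the accumulator, the growth is additive and the sum over the list stays polynomial.\<close>

lemma ptime_foldl:
  fixes l :: "'a::enc \<Rightarrow> 'b::enc list" and init :: "'a \<Rightarrow> 'c::enc"
  assumes "ptime (\<lambda>p. g (fst p) (fst (snd p)) (snd (snd p)))" "ptime init" "ptime l"
    and C: "pbound C" "\<And>x acc a. sz (g x acc a) \<le> sz acc + C (x, a)"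
  shows "ptime (\<lambda>x. foldl (g x) (init x) (l x))"
proof -
  from C(1) obtain P where P: "\<And>y. C y \<le> poly P (sz y)" unfolding pbound_def by blast
  let ?c = "\<lambda>x. poly P (sz x + sz (l x) + 1)"
  have *: "sz (foldl (g x) acc m) \<le> sz acc + length m * ?c x" if "set m \<subseteq> set (l x)" for x acc m
    using that
  proof (induction m arbitrary: acc)
    case (Cons a m)
    have "C (x, a) \<le> ?c x"
      using Cons.prems member_sz[of a "l x"] by (intro le_trans[OF P] poly_nat_mono) simp
    then show ?case using Cons.IH[of "g x acc a"] Cons.prems C(2)[of x acc a] by simp
  qed simp
  show ?thesis
  proof (rule ptime_foldl_bounded[OF assms(1-3)])
    show "pbound (\<lambda>x. sz (init x) + sz (l x) * ?c x)"
      by (intro pbound_intros assms)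
    fix x k
    have "length (take k (l x)) * ?c x \<le> sz (l x) * ?c x"
      using length_le_sz[of "l x"] by (intro mult_right_mono) auto
    with *[of "take k (l x)" x "init x", OF set_take_subset]
    show "sz (foldl (g x) (init x) (take k (l x))) \<le> sz (init x) + sz (l x) * ?c x"
      by linarith
  qed
qed

section \<open>List operations as folds\<close>

lemma pbound_Suc [pbound_intros]: "pbound h \<Longrightarrow> pbound (\<lambda>x. Suc (h x))"
  using pbound_add[OF pbound_const[of 1]] by simp

lemma ptime_rev [ptime_intros]:
  assumes "ptime l"
  shows "ptime (\<lambda>x. rev (l x))"
proof -
  have "rev m = foldl (\<lambda>acc a. a # acc) [] m" for m :: "'b list"
    by (simp add: foldl_conv_fold fold_Cons_rev)
  moreover have "ptime (\<lambda>x. foldl (\<lambda>acc a. a # acc) [] (l x))"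
    by (rule ptime_foldl[where C = "\<lambda>p. Suc (sz (snd p))"])
      ((intro ptime_intros assms pbound_intros)+, simp)
  ultimately show ?thesis by simp
qed

lemma ptime_foldr:
  fixes l :: "'a::enc \<Rightarrow> 'b::enc list" and init :: "'a \<Rightarrow> 'c::enc"
  assumes "ptime (\<lambda>p. g (fst p) (snd (snd p)) (fst (snd p)))" "ptime init" "ptime l"
    and "pbound C" "\<And>x acc a. sz (g x a acc) \<le> sz acc + C (x, a)"
  shows "ptime (\<lambda>x. foldr (g x) (l x) (init x))"
  unfolding foldr_conv_foldl
  by (rule ptime_foldl[OF assms(1,2) ptime_rev[OF assms(3)] assms(4,5)])

lemma ptime_map [ptime_intros]:
  assumes "ptime (\<lambda>p. h (fst p) (snd p))" "ptime l"
  shows "ptime (\<lambda>x. map (h x) (l x))"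
proof -
  have "ptime (\<lambda>p. h (f1 p) (f2 p))" if "ptime f1" "ptime f2" for f1 :: "'d::enc \<Rightarrow> 'a" and f2
    using ptime_compose[OF assms(1) ptime_Pair[OF that]] by simp
  note h = this
  have "ptime (\<lambda>x. foldr (\<lambda>a acc. h x a # acc) (l x) [])"
    by (rule ptime_foldr[where C = "\<lambda>p. Suc (sz (h (fst p) (snd p)))"])
      ((intro ptime_intros assms pbound_intros h)+, simp)
  moreover have "map f m = foldr (\<lambda>a acc. f a # acc) m []" for f :: "'b \<Rightarrow> 'c" and m
    by (induction m) auto
  ultimately show ?thesis by simp
qed

lemma ptime_filter [ptime_intros]:
  assumes "ptime (\<lambda>p. P (fst p) (snd p))" "ptime l"
  shows "ptime (\<lambda>x. filter (P x) (l x))"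
proof -
  have "ptime (\<lambda>p. P (f1 p) (f2 p))" if "ptime f1" "ptime f2" for f1 :: "'d::enc \<Rightarrow> 'a" and f2
    using ptime_compose[OF assms(1) ptime_Pair[OF that]] by simp
  note h = this
  have "ptime (\<lambda>x. foldr (\<lambda>a acc. if P x a then a # acc else acc) (l x) [])"
    by (rule ptime_foldr[where C = "\<lambda>p. Suc (sz (snd p))"])
      ((intro ptime_intros assms pbound_intros h)+, simp)
  moreover have "filter f m = foldr (\<lambda>a acc. if f a then a # acc else acc) m []" for f :: "'b \<Rightarrow> bool" and m
    by (induction m) auto
  ultimately show ?thesis by simp
qed

lemma ptime_Ball [ptime_intros]:
  assumes "ptime (\<lambda>p. P (fst p) (snd p))" "ptime l"
  shows "ptime (\<lambda>x. \<forall>a\<in>set (l x). P x a)"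
proof -
  have "ptime (\<lambda>x. filter (\<lambda>a. \<not> P x a) (l x) = [])"
    by (intro ptime_intros assms)
  then show ?thesis by (simp add: filter_empty_conv)
qed

lemma ptime_Bex [ptime_intros]:
  assumes "ptime (\<lambda>p. P (fst p) (snd p))" "ptime l"
  shows "ptime (\<lambda>x. \<exists>a\<in>set (l x). P x a)"
proof -
  have "ptime (\<lambda>x. \<not> (\<forall>a\<in>set (l x). \<not> P x a))"
    by (intro ptime_intros assms)
  then show ?thesis by simp
qed

lemma ptime_member [ptime_intros]:
  assumes "ptime f" "ptime l"
  shows "ptime (\<lambda>x. f x \<in> set (l x))"
proof -
  have "ptime (\<lambda>p. f (fst p))" using ptime_compose[OF assms(1) ptime_fst'] .
  then have "ptime (\<lambda>x. \<exists>a\<in>set (l x). a = f x)" by (intro ptime_intros assms)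
  then show ?thesis by simp
qed

lemma ptime_append [ptime_intros]:
  assumes "ptime f" "ptime g"
  shows "ptime (\<lambda>x. f x @ g x)"
proof -
  have "ptime (\<lambda>x. foldr (\<lambda>a acc. a # acc) (f x) (g x))"
    by (rule ptime_foldr[where C = "\<lambda>p. Suc (sz (snd p))"])
      ((intro ptime_intros assms pbound_intros)+, simp)
  moreover have "m @ n = foldr (\<lambda>a acc. a # acc) m n" for m n :: "'b list"
    by (induction m) auto
  ultimately show ?thesis by simp
qed

lemma sz_append: "Suc (sz (l @ m)) = sz l + sz m"
  by (induction l) auto

lemma ptime_concat [ptime_intros]:
  assumes "ptime f"
  shows "ptime (\<lambda>x. concat (f x))"
proof -
  have *: "sz (a @ acc) \<le> sz acc + sz a" for a acc :: "'b list"
    using sz_append[of a acc] by simp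
  have "ptime (\<lambda>x. foldr (\<lambda>a acc. a @ acc) (f x) [])"
    by (rule ptime_foldr[where C = "\<lambda>p. sz (snd p)"])
      ((intro ptime_intros assms pbound_intros)+, simp add: *)
  moreover have "concat m = foldr (\<lambda>a acc. a @ acc) m []" for m :: "'b list list"
    by (induction m) auto
  ultimately show ?thesis by simp
qed

text \<open>The fold returns the suffix read so far next to the verdict, because each new element
  has to be looked up in it.\<close>

lemma ptime_distinct [ptime_intros]:
  assumes "ptime l"
  shows "ptime (\<lambda>x. distinct (l x))"
proof -
  let ?g = "\<lambda>a acc. (a # fst acc, snd acc \<and> a \<notin> set (fst acc))"
  have *: "foldr ?g m ([], True) = (m, distinct m)" for m :: "'b list"
    by (induction m) auto
  have le: "sz (?g a acc) \<le> sz acc + (sz a + 4)" for a :: 'b and acc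
    using sz_bool_le[of "snd acc \<and> a \<notin> set (fst acc)"] by (cases acc) simp
  have "ptime (\<lambda>x. foldr ?g (l x) ([], True))"
    by (rule ptime_foldr[where C = "\<lambda>p. sz (snd p) + 4"])
      ((intro ptime_intros assms pbound_intros)+, use le in simp)
  then have "ptime (\<lambda>x. snd (foldr ?g (l x) ([], True)))" by (rule ptime_snd)
  then show ?thesis by (simp add: *)
qed

section \<open>Binary arithmetic\<close>

fun inc :: "letter list \<Rightarrow> letter list" where
  "inc [] = [Digit True]"
| "inc (d # l) = (if d = Digit True then Digit False # inc l else Digit True # l)"

lemma enc_nat_0 [simp]: "enc_nat 0 = []"
  by (simp add: enc_nat.simps)

lemma enc_nat_double: "enc_nat (of_bool b + 2 * n) = (if n = 0 \<and> \<not> b then [] else Digit b # enc_nat n)"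
  by (subst enc_nat.simps) auto

lemma inc_enc_nat: "inc (enc_nat n) = enc_nat (Suc n)"
proof (induction n rule: less_induct)
  case (less n)
  show ?case
  proof (cases "n = 0")
    case True
    then show ?thesis by (simp add: enc_nat.simps)
  next
    case False
    then show ?thesis
      using less[of "n div 2"] by (subst (1 2) enc_nat.simps) (auto elim!: oddE evenE)
  qed
qed

text \<open>The accumulator consists of the carry and of the digits written so far, in reverse order.\<close>

definition inc_step :: "bool \<times> letter list \<Rightarrow> letter \<Rightarrow> bool \<times> letter list" where
  "inc_step acc d = (fst acc \<and> d = Digit True,
     (if fst acc then (if d = Digit True then Digit False else Digit True) else d) # snd acc)"

definition inc_finish :: "bool \<times> letter list \<Rightarrow> letter list" where
  "inc_finish acc = rev (if fst acc then Digit True # snd acc else snd acc)"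

lemma inc_conv_foldl: "inc l = inc_finish (foldl inc_step (True, []) l)"
proof -
  have *: "foldl inc_step (False, m) l = (False, rev l @ m)" for m l
    by (induction l arbitrary: m) (simp_all add: inc_step_def)
  have "inc_finish (foldl inc_step (True, m) l) = rev m @ inc l" for m l
    by (induction l arbitrary: m) (simp_all add: inc_step_def *, simp_all add: inc_finish_def)
  from this[of "[]"] show ?thesis by simp
qed

lemma ptime_inc: "ptime inc"
proof -
  have "sz (inc_step acc d) \<le> sz acc + (16 + sz d)" for acc d
    using sz_bool_le[of "fst acc \<and> d = Digit True"] by (cases acc) (auto simp: inc_step_def)
  then have "ptime (\<lambda>l. foldl inc_step (True, []) l)"
    by (intro ptime_foldl[where C = "\<lambda>p. 16 + sz (snd p)"])
      (auto simp: inc_step_def intro!: ptime_intros pbound_intros)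
  then have "ptime (\<lambda>l. inc_finish (foldl inc_step (True, []) l))"
    unfolding inc_finish_def by (intro ptime_intros)
  then show ?thesis by (simp add: inc_conv_foldl[abs_def])
qed

lemma ptime_enc_nat' : "ptime enc_nat"
  by (rule ptime_retype[OF ptime_id]) (auto simp: enc_nat_tree)

lemma ptime_enc_int' : "ptime enc_int"
  by (rule ptime_retype[OF ptime_id]) (auto simp: enc_int_tree)

lemmas ptime_enc_nat [ptime_intros] = ptime_compose[OF ptime_enc_nat']
lemmas ptime_enc_int [ptime_intros] = ptime_compose[OF ptime_enc_int']

lemma ptime_Suc [ptime_intros]:
  assumes "ptime f"
  shows "ptime (\<lambda>x. Suc (f x))"
proof -
  from ptime_compose[OF ptime_inc ptime_enc_nat[OF assms]]
  show ?thesis by (rule ptime_retype) (auto simp: enc_nat_tree inc_enc_nat)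
qed

lemma ptime_odd [ptime_intros]:
  assumes "ptime f"
  shows "ptime (\<lambda>x. odd (f x :: nat))"
proof -
  have "ptime (\<lambda>x. case enc_nat (f x) of [] \<Rightarrow> False | d # l \<Rightarrow> d = Digit True)"
    by (intro ptime_intros assms)
  moreover have "(case enc_nat n of [] \<Rightarrow> False | d # l \<Rightarrow> d = Digit True) = odd n" for n
    by (subst enc_nat.simps) auto
  ultimately show ?thesis by simp
qed

text \<open>Prepending a digit; zero is singled out since its notation has no digits. This is the
  step by which the parser builds a number.\<close>

lemma ptime_double [ptime_intros]:
  assumes "ptime f"
  shows "ptime (\<lambda>x. of_bool b + 2 * f x :: nat)"
proof -
  have "ptime (\<lambda>x. if f x = 0 \<and> \<not> b then [] else Digit b # enc_nat (f x))"
    by (intro ptime_intros assms)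
  then show ?thesis
    by (rule ptime_retype) (auto simp only: enc_nat_tree enc_nat_double)
qed

lemma ptime_int [ptime_intros]:
  assumes "ptime f"
  shows "ptime (\<lambda>x. int (f x))"
proof -
  have "ptime (\<lambda>x. Plus # enc_nat (f x))" by (intro ptime_intros assms)
  then show ?thesis by (rule ptime_retype) (auto simp: enc_int_tree enc_int_def)
qed

lemma ptime_neg_int [ptime_intros]:
  assumes "ptime f"
  shows "ptime (\<lambda>x. - int (f x))"
proof -
  have "ptime (\<lambda>x. if f x = 0 then [Plus] else Minus # enc_nat (f x))" by (intro ptime_intros assms)
  then show ?thesis by (rule ptime_retype) (auto simp: enc_int_tree enc_int_def)
qed

lemma ptime_nonneg [ptime_intros]:
  assumes "ptime f"
  shows "ptime (\<lambda>x. (0 :: int) \<le> f x)"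
proof -
  have "ptime (\<lambda>x. case enc_int (f x) of [] \<Rightarrow> False | d # l \<Rightarrow> d = Plus)"
    by (intro ptime_intros assms)
  moreover have "(case enc_int z of [] \<Rightarrow> False | d # l \<Rightarrow> d = Plus) \<longleftrightarrow> 0 \<le> z" for z
    by (simp add: enc_int_def)
  ultimately show ?thesis by simp
qed

lemma ptime_nat_abs [ptime_intros]:
  assumes "ptime f"
  shows "ptime (\<lambda>x. nat \<bar>f x\<bar>)"
proof -
  have "ptime (\<lambda>x. tl (enc_int (f x)))" by (intro ptime_intros assms)
  then show ?thesis by (rule ptime_retype) (auto simp: enc_int_def enc_nat_tree)
qed

text \<open>Subtraction is avoided: from a nonnegative integer to its successor the absolute value
  grows by one, from a negative one it shrinks by one. Adjacency of cells needs no other integer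
  arithmetic.\<close>

lemma ptime_int_succ:
  assumes "ptime f" "ptime g"
  shows "ptime (\<lambda>x. f x - g x = (1 :: int))"
proof -
  have "ptime (\<lambda>x. 0 \<le> g x \<and> 0 \<le> f x \<and> nat \<bar>f x\<bar> = Suc (nat \<bar>g x\<bar>) \<or>
      \<not> 0 \<le> g x \<and> (\<not> 0 \<le> f x \<or> f x = 0) \<and> nat \<bar>g x\<bar> = Suc (nat \<bar>f x\<bar>))"
    by (intro ptime_intros assms)
  moreover have "0 \<le> b \<and> 0 \<le> a \<and> nat \<bar>a\<bar> = Suc (nat \<bar>b\<bar>) \<or>
      \<not> 0 \<le> b \<and> (\<not> 0 \<le> a \<or> a = 0) \<and> nat \<bar>b\<bar> = Suc (nat \<bar>a\<bar>) \<longleftrightarrow> a - b = 1" for a b :: int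
    by auto
  ultimately show ?thesis by simp
qed

section \<open>Sizes of binary numbers\<close>

lemma sz_enc_nat: "sz n = 6 * length (enc_nat n) + 1"
proof -
  have "sz (enc_nat n) = 6 * length (enc_nat n) + 1"
  proof (induction n rule: less_induct)
    case (less n)
    show ?case
    proof (cases "n = 0")
      case False
      then show ?thesis using less[of "n div 2"] by (subst (1 2) enc_nat.simps) simp
    qed simp
  qed
  then show ?thesis by (simp add: sz_def enc_nat_tree)
qed

lemma sz_0 [simp]: "sz (0 :: nat) = 1"
  by (simp add: sz_enc_nat)

lemma length_inc: "length (inc l) \<le> Suc (length l)"
  by (induction l) auto

text \<open>An additive bound, as the fold that computes lengths requires; at most one digit of size
  \<open>5\<close> and one list node are added.\<close>

lemma sz_Suc: "sz (Suc n) \<le> sz n + 6"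
  using length_inc[of "enc_nat n"] by (simp add: sz_enc_nat inc_enc_nat)

lemma sz_double: "sz (of_bool b + 2 * n :: nat) \<le> sz n + 6"
  unfolding sz_enc_nat by (subst enc_nat_double) auto

lemma sz_int: "sz (z :: int) \<le> sz (nat \<bar>z\<bar>) + 4"
  by (simp add: sz_def enc_int_tree enc_int_def enc_nat_tree)

lemma ptime_length [ptime_intros]:
  assumes "ptime l"
  shows "ptime (\<lambda>x. length (l x))"
proof -
  have "ptime (\<lambda>x. foldr (\<lambda>a. Suc) (l x) 0)"
    by (rule ptime_foldr[where C = "\<lambda>p. 6"])
      ((intro ptime_intros assms pbound_intros)+, simp add: sz_Suc)
  moreover have "length m = foldr (\<lambda>a. Suc) m 0" for m :: "'b list"
    by (induction m) auto
  ultimately show ?thesis by simp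
qed

section \<open>Perfect matchings by peeling\<close>

text \<open>Induction on the number of sets. If a proper nonempty subfamily is tight, it is matched
  within its union and the others outside of it. If none is tight, every proper nonempty subfamily
  has an element to spare, and any choice for one set can be fixed.\<close>

theorem hall:
  assumes "finite I" "\<And>i. i \<in> I \<Longrightarrow> finite (F i)" "\<And>S. S \<subseteq> I \<Longrightarrow> card S \<le> card (\<Union> (F ` S))"
  shows "\<exists>f. inj_on f I \<and> (\<forall>i\<in>I. f i \<in> F i)"
  using assms
proof (induction "card I" arbitrary: I F rule: less_induct)
  case less
  note fin = less.prems(1,2) and hall = less.prems(3)
  show ?case
  proof (cases "I = {}")
    case False
    then obtain i where i: "i \<in> I" by blast
    show ?thesis
    proof (cases "\<exists>S. S \<subseteq> I \<and> S \<noteq> {} \<and> S \<noteq> I \<and> card (\<Union> (F ` S)) = card S")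
      case True
      then obtain S where S: "S \<subseteq> I" "S \<noteq> {}" "S \<noteq> I" and tight: "card (\<Union> (F ` S)) = card S" by blast
      have fS: "finite S" using S fin finite_subset by blast
      let ?N = "\<Union> (F ` S)"
      have fN: "finite ?N" using fS fin S by auto
      have "card S < card I" using S fin(1) by (simp add: psubset_card_mono psubset_eq)
      moreover have "T \<subseteq> S \<Longrightarrow> card T \<le> card (\<Union> (F ` T))" for T using hall S by blast
      ultimately obtain f where f: "inj_on f S" "\<forall>i\<in>S. f i \<in> F i"
        using less.hyps[of S F] fS fin S by blast
      have "card (I - S) < card I"
        using S fin(1) by (intro psubset_card_mono) auto
      \<comment> \<open>\<open>T\<close> and \<open>S\<close> together have at least
        \<open>card T + card S\<close> elements in their union, of which \<open>?N\<close> accounts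
        for only \<open>card S\<close>.\<close>
      moreover have "card T \<le> card (\<Union> ((\<lambda>i. F i - ?N) ` T))" if T: "T \<subseteq> I - S" for T
      proof -
        have fT: "finite T" using T fin finite_subset by blast
        have "card T + card S = card (T \<union> S)"
          using T fT fS by (intro card_Un_disjoint[symmetric]) auto
        also have "\<dots> \<le> card (\<Union> (F ` (T \<union> S)))" using hall[of "T \<union> S"] T S by auto
        also have "\<Union> (F ` (T \<union> S)) = \<Union> ((\<lambda>i. F i - ?N) ` T) \<union> ?N" by auto
        also have "card \<dots> \<le> card (\<Union> ((\<lambda>i. F i - ?N) ` T)) + card ?N" by (rule card_Un_le)
        finally show ?thesis using tight by simp
      qed
      ultimately obtain g where g: "inj_on g (I - S)" "\<forall>i\<in>I - S. g i \<in> F i - ?N"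
        using less.hyps[of "I - S" "\<lambda>i. F i - ?N"] fin by auto
      let ?h = "\<lambda>i. if i \<in> S then f i else g i"
      have "inj_on ?h I"
      proof (rule inj_onI)
        fix a b assume ab: "a \<in> I" "b \<in> I" "?h a = ?h b"
        have ne: "f a \<noteq> g b" if "a \<in> S" "b \<in> I - S" for a b
        proof -
          have "f a \<in> ?N" using f(2) that(1) by auto
          moreover have "g b \<notin> ?N" using g(2) that(2) by simp
          ultimately show ?thesis by metis
        qed
        show "a = b"
        proof (cases "a \<in> S"; cases "b \<in> S")
          assume "a \<in> S" "b \<in> S"
          then show ?thesis using ab(3) inj_onD[OF f(1)] by simp
        next
          assume "a \<notin> S" "b \<notin> S"
          then show ?thesis using ab inj_onD[OF g(1)] by simp
        next
          assume "a \<in> S" "b \<notin> S"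
          then show ?thesis using ab ne[of a b] by simp
        next
          assume "a \<notin> S" "b \<in> S"
          then show ?thesis using ab ne[of b a] by simp
        qed
      qed
      moreover have "\<forall>i\<in>I. ?h i \<in> F i" using f(2) g(2) by auto
      ultimately show ?thesis by blast
    next
      case False
      have "F i \<noteq> {}" using hall[of "{i}"] i by auto
      then obtain x where x: "x \<in> F i" by blast
      have "card (I - {i}) < card I" using i fin(1) by (simp add: card_Diff1_less del: card_Diff_insert)
      \<comment> \<open>No proper nonempty subfamily is tight, so removing the single element
        \<open>x\<close> does no harm.\<close>
      moreover have "card T \<le> card (\<Union> ((\<lambda>j. F j - {x}) ` T))" if T: "T \<subseteq> I - {i}" for T
      proof (cases "T = {}")
        case ne: False
        have "card (\<Union> (F ` T)) \<noteq> card T" using False T ne i by blast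
        then have lt: "card T < card (\<Union> (F ` T))" using hall[of T] T by (simp add: subset_Diff_insert)
        have fU: "finite (\<Union> (F ` T))" using T fin finite_subset by (intro finite_UN_I) blast+
        have "\<Union> ((\<lambda>j. F j - {x}) ` T) = \<Union> (F ` T) - {x}" by auto
        moreover have "card (\<Union> (F ` T)) \<le> Suc (card (\<Union> (F ` T) - {x}))"
          using fU by (cases "x \<in> \<Union> (F ` T)") (simp_all add: card_Suc_Diff1 del: UN_iff)
        ultimately show ?thesis using lt by simp
      qed simp
      ultimately obtain g where g: "inj_on g (I - {i})" "\<forall>j\<in>I - {i}. g j \<in> F j - {x}"
        using less.hyps[of "I - {i}" "\<lambda>j. F j - {x}"] fin by auto
      have "inj_on (g(i := x)) I"
        using g i by (auto simp: inj_on_def)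
      moreover have "\<forall>j\<in>I. (g(i := x)) j \<in> F j" using g(2) x by auto
      ultimately show ?thesis by blast
    qed
  qed simp
qed

section \<open>Systems of distinct representatives and peeling\<close>

definition choosable :: "('k \<times> 'v list) list \<Rightarrow> bool" where
  "choosable R \<longleftrightarrow> (\<exists>f. inj_on f (fst ` set R) \<and> (\<forall>(k, vs)\<in>set R. f k \<in> set vs))"

text \<open>A list with empty tail has at most one element: the value \<open>v\<close> has at most
  one taker. A value without takers is removed too, and the lengths of the two lists record the
  loss.\<close>

definition peel :: "('k \<times> 'v list) list \<times> 'v list \<Rightarrow> ('k \<times> 'v list) list \<times> 'v list" where
  "peel s = (case filter (\<lambda>v. tl (filter (\<lambda>r. v \<in> set (snd r)) (fst s)) = []) (snd s) of
      [] \<Rightarrow> s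
    | v # _ \<Rightarrow> (filter (\<lambda>r. v \<notin> set (snd r)) (fst s), filter (\<lambda>u. u \<noteq> v) (snd s)))"

definition peelable :: "('k \<times> 'v list) list \<times> 'v list \<Rightarrow> bool" where
  "peelable s \<longleftrightarrow> distinct (map fst (fst s)) \<and> distinct (snd s) \<and>
     (\<forall>r\<in>set (fst s). set (snd r) \<subseteq> set (snd s) \<and> card (set (snd r)) \<le> 2)"

lemma peel_cases:
  obtains (stable) "peel s = s" "\<And>v. v \<in> set (snd s) \<Longrightarrow> tl (filter (\<lambda>r. v \<in> set (snd r)) (fst s)) \<noteq> []"
  | (step) v where "v \<in> set (snd s)" "tl (filter (\<lambda>r. v \<in> set (snd r)) (fst s)) = []"
      "peel s = (filter (\<lambda>r. v \<notin> set (snd r)) (fst s), filter (\<lambda>u. u \<noteq> v) (snd s))"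
proof (cases "filter (\<lambda>v. tl (filter (\<lambda>r. v \<in> set (snd r)) (fst s)) = []) (snd s)")
  case Nil
  then show ?thesis using stable by (auto simp: peel_def filter_empty_conv)
next
  case (Cons v vs)
  then have "v \<in> set (filter (\<lambda>v. tl (filter (\<lambda>r. v \<in> set (snd r)) (fst s)) = []) (snd s))" by simp
  then have "v \<in> set (snd s)" "tl (filter (\<lambda>r. v \<in> set (snd r)) (fst s)) = []"
    unfolding set_filter by blast+
  then show ?thesis by (rule step) (simp add: peel_def Cons)
qed

lemma tl_filter_eq_Nil:
  assumes "tl (filter P l) = []" "a \<in> set l" "P a" "b \<in> set l" "P b"
  shows "a = b"
proof -
  have "a \<in> set (filter P l)" "b \<in> set (filter P l)" using assms by auto
  with assms(1) show ?thesis by (cases "filter P l") auto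
qed

lemma peelable_peel: "peelable s \<Longrightarrow> peelable (peel s)"
  by (cases s rule: peel_cases)
    (auto simp: peelable_def distinct_map_filter subset_iff)

text \<open>The row that was removed with \<open>v\<close>, if any, gets \<open>v\<close>. All other
  rows choose from lists that do not contain \<open>v\<close>, so no clash arises.\<close>

lemma choosable_backwards:
  assumes "peelable s" "choosable (fst (peel s))"
  shows "choosable (fst s)"
proof (cases s rule: peel_cases)
  case (step v)
  let ?R = "fst s"
  from assms(2) step obtain f where f: "inj_on f (fst ` {r \<in> set ?R. v \<notin> set (snd r)})"
    "\<And>r. r \<in> set ?R \<Longrightarrow> v \<notin> set (snd r) \<Longrightarrow> f (fst r) \<in> set (snd r)"
    by (fastforce simp: choosable_def)
  have keys: "r = r'" if "r \<in> set ?R" "r' \<in> set ?R" "fst r = fst r'" for r r'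
    using that assms(1) by (auto simp: peelable_def distinct_map inj_on_def)
  define g where "g = (\<lambda>k. if \<exists>r\<in>set ?R. v \<in> set (snd r) \<and> fst r = k then v else f k)"
  have g: "g (fst r) = (if v \<in> set (snd r) then v else f (fst r))" if "r \<in> set ?R" for r
    using that keys unfolding g_def by metis
  have "inj_on g (fst ` set ?R)"
  proof (intro inj_onI; elim imageE)
    fix k k' r r' assume r: "r \<in> set ?R" "r' \<in> set ?R" "k = fst r" "k' = fst r'" "g k = g k'"
    show "k = k'"
    proof (cases "v \<in> set (snd r) \<or> v \<in> set (snd r')")
      case True
      have "v \<in> set (snd r) \<and> v \<in> set (snd r')"
        using r g[of r] g[of r'] f(2)[of r] f(2)[of r'] True by (auto split: if_splits)
      then show ?thesis using tl_filter_eq_Nil[OF step(2)] r by blast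
    next
      case False
      then have "k \<in> fst ` {r \<in> set ?R. v \<notin> set (snd r)}" "k' \<in> fst ` {r \<in> set ?R. v \<notin> set (snd r)}"
        using r by blast+
      then show ?thesis using r g[of r] g[of r'] False inj_onD[OF f(1), of k k'] by simp
    qed
  qed
  moreover have "g k \<in> set vs" if "(k, vs) \<in> set ?R" for k vs
    using g[OF that] f(2)[OF that] by auto
  ultimately show ?thesis unfolding choosable_def by blast
qed (use assms in simp)

lemma choosable_image:
  assumes "peelable s" "length (fst s) = length (snd s)"
    "inj_on f (fst ` set (fst s))" "\<forall>(k, vs)\<in>set (fst s). f k \<in> set vs"
  shows "f ` fst ` set (fst s) = set (snd s)"
proof (rule card_subset_eq)
  show "f ` fst ` set (fst s) \<subseteq> set (snd s)"
    using assms(1,4) by (fastforce simp: peelable_def)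
  have "card (f ` fst ` set (fst s)) = card (fst ` set (fst s))" using assms(3) by (rule card_image)
  also have "\<dots> = length (fst s)"
    using assms(1) by (metis distinct_card length_map peelable_def set_map)
  also have "\<dots> = card (set (snd s))" using assms(1,2) by (simp add: peelable_def distinct_card)
  finally show "card (f ` fst ` set (fst s)) = card (set (snd s))" .
qed simp

text \<open>With as many rows as values a choice uses every value. Hence \<open>v\<close> has a
  taker, exactly one row leaves together with it, and both lengths drop by one.\<close>

lemma choosable_forwards:
  assumes "peelable s" "choosable (fst s)" "length (fst s) = length (snd s)"
  shows "choosable (fst (peel s)) \<and> length (fst (peel s)) = length (snd (peel s))"
proof (cases s rule: peel_cases)
  case (step v)
  let ?R = "fst s"
  let ?P = "\<lambda>r. v \<in> set (snd r)"
  from assms(2) obtain f where f: "inj_on f (fst ` set ?R)" "\<forall>(k, vs)\<in>set ?R. f k \<in> set vs"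
    by (auto simp: choosable_def)
  have "v \<in> f ` fst ` set ?R" using choosable_image[OF assms(1,3) f] step(1) by simp
  then obtain r where "r \<in> set ?R" "?P r" using f(2) by fastforce
  then have "filter ?P ?R \<noteq> []" by (auto simp: filter_empty_conv)
  then have "length (filter ?P ?R) = 1" using step(2) by (cases "filter ?P ?R") auto
  then have "length (filter (\<lambda>r. \<not> ?P r) ?R) + 1 = length ?R"
    using sum_length_filter_compl[of ?P ?R] by simp
  moreover have "length (filter (\<lambda>u. u \<noteq> v) (snd s)) + 1 = length (snd s)"
  proof -
    have "length (filter (\<lambda>u. u = v) (snd s)) = card (set (filter (\<lambda>u. u = v) (snd s)))"
      using assms(1) by (simp add: peelable_def distinct_card del: set_filter)
    also have "set (filter (\<lambda>u. u = v) (snd s)) = {v}" using step(1) by auto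
    finally show ?thesis using sum_length_filter_compl[of "\<lambda>u. u = v" "snd s"] by simp
  qed
  ultimately have "length (fst (peel s)) = length (snd (peel s))"
    using assms(3) step(3) by simp
  moreover have "choosable (fst (peel s))"
    unfolding choosable_def using f step(3)
    by (intro exI[of _ f]) (auto intro: inj_on_subset)
  ultimately show ?thesis by simp
qed (use assms in simp)

text \<open>
  When every value has at least two takers, counting shows that all degrees are exactly two, and a
  regular bipartite graph satisfies Hall's condition.
\<close>

lemma choosable_stable:
  assumes p: "peelable s" and len: "length (fst s) = length (snd s)"
    and stable: "\<And>v. v \<in> set (snd s) \<Longrightarrow> tl (filter (\<lambda>r. v \<in> set (snd r)) (fst s)) \<noteq> []"
  shows "choosable (fst s)"
proof -
  let ?R = "set (fst s)" and ?W = "set (snd s)"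
  have dist: "distinct (fst s)" using p by (simp add: peelable_def distinct_map)
  have cards: "card ?R = card ?W" using p len dist by (simp add: peelable_def distinct_card)
  have deg: "2 \<le> card {r \<in> ?R. v \<in> set (snd r)}" if "v \<in> ?W" for v
  proof -
    have "card {r \<in> ?R. v \<in> set (snd r)} = length (filter (\<lambda>r. v \<in> set (snd r)) (fst s))"
      using distinct_card[of "filter (\<lambda>r. v \<in> set (snd r)) (fst s)"] dist by simp
    \<comment> \<open>The case rule separates lists of length zero, one and at least two.\<close>
    then show ?thesis using stable[OF that]
      by (cases "filter (\<lambda>r. v \<in> set (snd r)) (fst s)" rule: remdups_adj.cases) auto
  qed
  have count: "(\<Sum>r\<in>S. card (set (snd r))) = (\<Sum>v\<in>?W. card {r \<in> S. v \<in> set (snd r)})"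
    if "S \<subseteq> ?R" for S
  proof -
    have "finite S" using that finite_subset by blast
    then have "(\<Sum>r\<in>S. card {v \<in> ?W. v \<in> set (snd r)}) = (\<Sum>v\<in>?W. card {r \<in> S. v \<in> set (snd r)})"
      by (intro sum_multicount_gen) auto
    moreover have "{v \<in> ?W. v \<in> set (snd r)} = set (snd r)" if "r \<in> S" for r
      using that \<open>S \<subseteq> ?R\<close> p by (auto simp: peelable_def)
    ultimately show ?thesis by (simp cong: sum.cong)
  qed
  have le2: "card (set (snd r)) \<le> 2" if "r \<in> ?R" for r using p that by (auto simp: peelable_def)
  have eq_total: "(\<Sum>r\<in>?R. card (set (snd r))) = 2 * card ?R"
    and eq_total': "(\<Sum>v\<in>?W. card {r \<in> ?R. v \<in> set (snd r)}) = 2 * card ?W"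
  proof -
    have "(\<Sum>r\<in>?R. card (set (snd r))) \<le> 2 * card ?R"
      using sum_bounded_above[of ?R "\<lambda>r. card (set (snd r))" 2] le2 by simp
    moreover have "2 * card ?W \<le> (\<Sum>v\<in>?W. card {r \<in> ?R. v \<in> set (snd r)})"
      using sum_bounded_below[of ?W 2 "\<lambda>v. card {r \<in> ?R. v \<in> set (snd r)}"] deg by simp
    ultimately show "(\<Sum>r\<in>?R. card (set (snd r))) = 2 * card ?R"
      "(\<Sum>v\<in>?W. card {r \<in> ?R. v \<in> set (snd r)}) = 2 * card ?W"
      using count[of ?R] cards by simp_all
  qed
  have eq2: "card (set (snd r)) = 2" if "r \<in> ?R" for r
  proof (rule ccontr)
    assume "card (set (snd r)) \<noteq> 2"
    then have "card (set (snd r)) < 2" using le2[OF that] by simp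
    then have "(\<Sum>r\<in>?R. card (set (snd r))) < (\<Sum>r\<in>?R. 2)"
      using le2 that by (intro sum_strict_mono_ex1) auto
    then show False using eq_total by simp
  qed
  have deg2: "card {r \<in> ?R. v \<in> set (snd r)} = 2" if "v \<in> ?W" for v
  proof (rule ccontr)
    assume "card {r \<in> ?R. v \<in> set (snd r)} \<noteq> 2"
    then have "2 < card {r \<in> ?R. v \<in> set (snd r)}" using deg[OF that] by simp
    then have "(\<Sum>v\<in>?W. 2) < (\<Sum>v\<in>?W. card {r \<in> ?R. v \<in> set (snd r)})"
      using deg that by (intro sum_strict_mono_ex1) auto
    then show False using eq_total' by simp
  qed
  have "\<exists>g. inj_on g ?R \<and> (\<forall>r\<in>?R. g r \<in> set (snd r))"
  proof (rule hall)
    fix S assume S: "S \<subseteq> ?R"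
    let ?N = "\<Union> ((\<lambda>r. set (snd r)) ` S)"
    have N: "?N \<subseteq> ?W" using S p by (auto simp: peelable_def)
    have "(\<Sum>r\<in>S. card (set (snd r))) = (\<Sum>r\<in>S. 2)"
      using S eq2 by (intro sum.cong) blast+
    then have "2 * card S = (\<Sum>r\<in>S. card (set (snd r)))" by simp
    also have "\<dots> = (\<Sum>v\<in>?W. card {r \<in> S. v \<in> set (snd r)})" by (rule count[OF S])
    also have "\<dots> = (\<Sum>v\<in>?N. card {r \<in> S. v \<in> set (snd r)})"
    proof (rule sum.mono_neutral_right)
      show "\<forall>v\<in>?W - ?N. card {r \<in> S. v \<in> set (snd r)} = 0"
      proof
        fix v assume "v \<in> ?W - ?N"
        then have "{r \<in> S. v \<in> set (snd r)} = {}" by auto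
        then show "card {r \<in> S. v \<in> set (snd r)} = 0" by (simp only: card.empty)
      qed
    qed (use N in auto)
    also have "\<dots> \<le> (\<Sum>v\<in>?N. 2)"
    proof (rule sum_mono)
      fix v assume v: "v \<in> ?N"
      have "card {r \<in> S. v \<in> set (snd r)} \<le> card {r \<in> ?R. v \<in> set (snd r)}"
        using S by (intro card_mono) auto
      then show "card {r \<in> S. v \<in> set (snd r)} \<le> 2" using deg2 v N by auto
    qed
    finally show "card S \<le> card ?N" by simp
  qed auto
  then obtain g where g: "inj_on g ?R" "\<forall>r\<in>?R. g r \<in> set (snd r)" by blast
  have inj: "inj_on fst ?R" using p by (simp add: peelable_def distinct_map)
  \<comment> \<open>\<open>hall\<close> chooses for rows; since keys determine their rows, the
    choice becomes a function of the keys.\<close>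
  have "inj_on (g \<circ> the_inv_into ?R fst) (fst ` ?R)"
    by (intro comp_inj_on inj_on_the_inv_into inj) (simp add: inj the_inv_into_onto g(1))
  moreover have "\<forall>(k, vs)\<in>?R. (g \<circ> the_inv_into ?R fst) k \<in> set vs"
    using g(2) the_inv_into_f_f[OF inj] by force
  ultimately show ?thesis unfolding choosable_def by blast
qed

text \<open>Every effective round lowers the measure, so as many rounds as its initial value reach a
  fixed point. Both the peeling and the connectivity test are run for a fixed number of rounds on
  this ground.\<close>

lemma iterate_stable:
  fixes m :: "'s \<Rightarrow> nat"
  assumes "\<And>s. f s = s \<or> m (f s) < m s" "m s \<le> n"
  shows "f ((f ^^ n) s) = (f ^^ n) s"
  using assms(2)
proof (induction n arbitrary: s)
  case 0
  then show ?case using assms(1)[of s] by auto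
next
  case (Suc n)
  show ?case
  proof (cases "f s = s")
    case True
    then have "(f ^^ k) s = s" for k by (induction k) auto
    then show ?thesis using True by simp
  next
    case False
    then have "m (f s) \<le> n" using assms(1)[of s] Suc.prems by auto
    from Suc.IH[OF this] show ?thesis by (simp add: funpow_swap1)
  qed
qed

text \<open>If a choice exists, each round preserves it together with the equality of lengths.
  Conversely, after enough rounds the state is stable; if the lengths then agree,
  \<open>choosable_stable\<close> gives a choice, and it extends backwards through all
  rounds.\<close>

theorem peel_decides:
  assumes "peelable s" "length (fst s) = length (snd s)" "length (snd s) \<le> n"
  shows "choosable (fst s) \<longleftrightarrow> length (fst ((peel ^^ n) s)) = length (snd ((peel ^^ n) s))"
proof -
  have inv: "peelable ((peel ^^ k) s)" for k
  proof (induction k)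
    case (Suc k)
    then show ?case using peelable_peel[OF Suc] by simp
  qed (use assms(1) in simp)
  have "peel s = s \<or> length (snd (peel s)) < length (snd s)" for s :: "('a \<times> 'b list) list \<times> 'b list"
    by (cases s rule: peel_cases) (auto intro: length_filter_less)
  from iterate_stable[where m = "\<lambda>s. length (snd s)", OF this assms(3)]
  have fixed: "peel ((peel ^^ n) s) = (peel ^^ n) s" .
  have forwards: "choosable (fst ((peel ^^ k) s)) \<and> length (fst ((peel ^^ k) s)) = length (snd ((peel ^^ k) s))"
    if "choosable (fst s)" for k
  proof (induction k)
    case (Suc k)
    then show ?case using choosable_forwards[OF inv, of k] by simp
  qed (use that assms in simp)
  have backwards: "choosable (fst ((peel ^^ k) s)) \<Longrightarrow> choosable (fst s)" for k
  proof (induction k)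
    case (Suc k)
    then show ?case using choosable_backwards[OF inv, of k] by simp
  qed simp
  show ?thesis
  proof
    assume len: "length (fst ((peel ^^ n) s)) = length (snd ((peel ^^ n) s))"
    have "choosable (fst ((peel ^^ n) s))"
    proof (cases "(peel ^^ n) s" rule: peel_cases)
      case stable
      then show ?thesis by (intro choosable_stable[OF inv len])
    next
      case (step v)
      then have "length (snd (peel ((peel ^^ n) s))) < length (snd ((peel ^^ n) s))"
        by (auto intro: length_filter_less)
      then show ?thesis using fixed by simp
    qed
    then show "choosable (fst s)" by (rule backwards)
  qed (use forwards in blast)
qed

section \<open>Deciding Rikudo games\<close>

definition directions :: "cell list" where
  "directions = [(1, 0), (-1, 0), (0, 1), (0, -1), (1, -1), (-1, 1)]"

text \<open>Adjacency depends on a difference of pairs only, which reduces geometric questions to a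
  finite list of vectors.\<close>

lemma adjacent_conv: "adjacent c c' \<longleftrightarrow> c' - c \<in> set directions"
proof -
  have "c' - c = (fst c' - fst c, snd c' - snd c)" by (simp add: prod_eq_iff)
  then show ?thesis by (simp only: adjacent_def directions_def list.set)
qed

lemma adjacent_sym: "adjacent c c' \<longleftrightarrow> adjacent c' c"
proof -
  have "x \<in> set directions \<longleftrightarrow> - x \<in> set directions" for x
    by (cases x) (auto simp: directions_def)
  from this[of "c' - c"] show ?thesis
    by (simp only: adjacent_conv minus_diff_eq)
qed

text \<open>Graph search kept in complement form: \<open>us\<close> holds the cells not yet reached,
  and a cell leaves it when it has a reached neighbour. A list that only shrinks gives both the
  measure for the fixed point and the size bound for the fold.\<close>

definition spread :: "cell list \<Rightarrow> cell list \<Rightarrow> cell list" where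
  "spread cs us = filter (\<lambda>c. \<forall>r\<in>set cs. r \<in> set us \<or> \<not> adjacent r c) us"

definition unreached :: "cell list \<Rightarrow> cell list" where
  "unreached cs = (spread cs ^^ length cs) (tl cs)"

text \<open>Adjacency is symmetric, so the symmetric closure in the definition of connectedness adds
  no arcs. The graph without vertices does not count as connected.\<close>

lemma connected_cell_graph:
  "Digraph_Component.connected (with_proj (cell_graph \<tau>)) \<longleftrightarrow>
     \<tau> \<noteq> {} \<and> (\<forall>c\<in>\<tau>. \<forall>c'\<in>\<tau>. (c, c') \<in> rtrancl_on \<tau> (parcs (cell_graph \<tau>)))"
proof -
  have "parcs (mk_symmetric (with_proj (cell_graph \<tau>))) = parcs (cell_graph \<tau>)"
    unfolding parcs_mk_symmetric by (auto simp: cell_graph_def adjacent_sym)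
  moreover have "pverts (cell_graph \<tau>) = \<tau>" by (simp add: cell_graph_def)
  ultimately show ?thesis
    by (simp add: Digraph_Component.connected_def strongly_connected_def reachable_def)
qed

text \<open>Cells that have left the list are reachable from the first cell, by induction on the
  rounds. At the fixed point no cell of the list has a neighbour outside of it, so a path from the
  first cell never enters the list.\<close>

lemma unreached_eq_Nil:
  assumes "distinct cs" "cs \<noteq> []"
  shows "Digraph_Component.connected (with_proj (cell_graph (set cs))) \<longleftrightarrow> unreached cs = []"
proof -
  let ?E = "parcs (cell_graph (set cs))" and ?R = "rtrancl_on (set cs) (parcs (cell_graph (set cs)))"
  obtain c0 cs' where cs: "cs = c0 # cs'" using assms(2) by (cases cs) auto
  have sym: "sym ?R"
    by (intro rtrancl_on_sym) (auto simp: sym_def cell_graph_def adjacent_sym)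
  have reach: "set ((spread cs ^^ k) (tl cs)) \<subseteq> set cs - {c0} \<and>
      (\<forall>c\<in>set cs - set ((spread cs ^^ k) (tl cs)). (c0, c) \<in> ?R)" for k
  proof (induction k)
    case 0
    then show ?case using cs assms(1) by auto
  next
    case (Suc k)
    let ?U = "(spread cs ^^ k) (tl cs)"
    have "(c0, c) \<in> ?R" if c: "c \<in> set cs" "c \<notin> set (spread cs ?U)" for c
    proof (cases "c \<in> set ?U")
      case True
      then obtain r where r: "r \<in> set cs" "r \<notin> set ?U" "adjacent r c"
        using c(2) unfolding spread_def set_filter by blast
      then have "(c0, r) \<in> ?R" using Suc by blast
      then show ?thesis using r c(1) by (auto simp: cell_graph_def intro: rtrancl_on_into_rtrancl_on)
    qed (use Suc c in blast)
    moreover have "set (spread cs ?U) \<subseteq> set ?U" by (auto simp: spread_def)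
    ultimately show ?case using Suc by auto
  qed
  have fixed: "spread cs (unreached cs) = unreached cs"
    unfolding unreached_def
  proof (rule iterate_stable[where m = length])
    fix us :: "cell list"
    have "filter P us = us \<or> length (filter P us) < length us" for P
      by (cases "\<forall>c\<in>set us. P c") (auto simp: filter_id_conv intro: length_filter_less)
    then show "spread cs us = us \<or> length (spread cs us) < length us"
      unfolding spread_def .
  qed simp
  show ?thesis
  proof
    assume conn: "Digraph_Component.connected (with_proj (cell_graph (set cs)))"
    have "c \<notin> set (unreached cs)" if "(c0, c) \<in> ?R" for c
      using that
    proof (induction rule: rtrancl_on_induct)
      case base
      then show ?case using reach[of "length cs"] by (auto simp: unreached_def)
    next
      case (step b c)
      show ?case
      proof
        assume "c \<in> set (unreached cs)"
        then have "c \<in> set (spread cs (unreached cs))" using fixed by simp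
        then show False using step by (auto simp: spread_def cell_graph_def)
      qed
    qed
    then have "set cs \<inter> set (unreached cs) = {}"
      using conn cs by (auto simp: connected_cell_graph)
    moreover have "set (unreached cs) \<subseteq> set cs"
      using conjunct1[OF reach[of "length cs"]] unfolding unreached_def by blast
    ultimately have "set (unreached cs) = {}" by (metis inf.absorb2)
    then show "unreached cs = []" by simp
  next
    assume "unreached cs = []"
    then have "(c0, c) \<in> ?R" if "c \<in> set cs" for c
      using reach[of "length cs"] that by (simp add: unreached_def)
    then have "(c, c') \<in> ?R" if "c \<in> set cs" "c' \<in> set cs" for c c'
      using that sym by (meson rtrancl_on_trans symD)
    then show "Digraph_Component.connected (with_proj (cell_graph (set cs)))"
      using assms(2) by (simp add: connected_cell_graph)
  qed
qed

section \<open>Neighbourhoods in the hexagonal grid\<close>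

lemma finite_neighbours: "finite {v. adjacent a v}"
proof (rule finite_subset)
  show "{v. adjacent a v} \<subseteq> (\<lambda>d. a + d) ` set directions"
  proof
    fix v assume "v \<in> {v. adjacent a v}"
    moreover have "v = a + (v - a)" by (simp add: prod_eq_iff)
    ultimately show "v \<in> (\<lambda>d. a + d) ` set directions"
      by (intro image_eqI[of _ _ "v - a"]) (simp_all add: adjacent_conv)
  qed
qed simp

text \<open>One common neighbour \<open>v\<close> writes \<open>b - a\<close> as the difference of
  the directions \<open>v - a\<close> and \<open>v - b\<close>. Any common neighbour
  \<open>w\<close> is then given by a direction \<open>x = w - a\<close> for which
  \<open>x - (b - a)\<close> is a direction too. This leaves the pairs of distinct directions, which
  are checked by evaluation.\<close>

lemma common_neighbours:
  assumes "a \<noteq> b"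
  shows "card {v. adjacent a v \<and> adjacent b v} \<le> 2"
proof -
  let ?S = "{v. adjacent a v \<and> adjacent b v}"
  show ?thesis
  proof (cases "?S = {}")
    case False
    then obtain v where v: "adjacent a v" "adjacent b v" by blast
    let ?d = "v - a" and ?e = "v - b"
    let ?l = "filter (\<lambda>x. x - (?d - ?e) \<in> set directions) directions"
    have de: "?d \<in> set directions" "?e \<in> set directions" "?d \<noteq> ?e"
      using v assms by (simp_all add: adjacent_conv)
    have inj: "inj_on (\<lambda>v. v - a) ?S" by (auto intro: inj_onI)
    have "(\<lambda>v. v - a) ` ?S \<subseteq> set ?l"
    proof
      fix x assume "x \<in> (\<lambda>v. v - a) ` ?S"
      then obtain w where w: "adjacent a w" "adjacent b w" "x = w - a" by blast
      then have "x - (?d - ?e) = w - b" by (simp add: prod_eq_iff)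
      then show "x \<in> set ?l" using w by (simp only: set_filter mem_Collect_eq adjacent_conv)
    qed
    then have "card ((\<lambda>v. v - a) ` ?S) \<le> card (set ?l)"
      by (intro card_mono) auto
    also have "\<dots> \<le> length ?l" by (rule card_length)
    also have "\<dots> \<le> 2"
    proof -
      have "\<forall>d\<in>set directions. \<forall>e\<in>set directions. d \<noteq> e \<longrightarrow>
          length (filter (\<lambda>x. x - (d - e) \<in> set directions) directions) \<le> 2"
        by code_simp
      from mp[OF bspec[OF bspec[OF this de(1)] de(2)] de(3)] show ?thesis .
    qed
    finally show ?thesis unfolding card_image[OF inj] .
  qed (simp only: card.empty)
qed

section \<open>Solutions as matchings of even numbers with free cells\<close>

definition near :: "nat option \<Rightarrow> nat \<Rightarrow> bool" where
  "near x k = (case x of None \<Rightarrow> False | Some j \<Rightarrow> Suc j = k \<or> j = Suc k)"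

text \<open>Since \<open>near None k\<close> is false, a given adjacency between two free cells
  excludes both of them, and rightly so: two even numbers are never consecutive.\<close>

definition fits :: "game \<Rightarrow> nat \<Rightarrow> cell \<Rightarrow> bool" where
  "fits = (\<lambda>(\<tau>, m, p) k v. (\<forall>c\<in>\<tau>. near (m c) k \<longrightarrow> adjacent c v) \<and>
     (\<forall>(a, b)\<in>p. (a = v \<longrightarrow> near (m b) k) \<and> (b = v \<longrightarrow> near (m a) k)))"

definition evens :: "nat \<Rightarrow> nat set" where
  "evens n = {k. even k \<and> 1 \<le> k \<and> k \<le> n}"

lemma odd_numbers_placed_conv:
  "odd_numbers_placed (\<tau>, m, p) \<longleftrightarrow> ran m = {k. odd k \<and> k \<le> card \<tau>}"
proof -
  have "{2 * x + 1 | x. True} \<inter> {1..card \<tau>} = {k. odd k \<and> k \<le> card \<tau>}"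
    by (auto elim!: oddE)
  then show ?thesis by simp
qed

text \<open>With equal cardinalities, an injection of the even numbers into the free cells is
  onto.\<close>

lemma card_free:
  assumes "rikudo_game (\<tau>, m, p)" "odd_numbers_placed (\<tau>, m, p)"
  shows "card {c \<in> \<tau>. m c = None} = card (evens (card \<tau>))"
proof -
  let ?O = "{k. odd k \<and> k \<le> card \<tau>}"
  have fin: "finite \<tau>" and dom: "dom m \<subseteq> \<tau>" and inj: "inj_on m (dom m)" using assms(1) by auto
  have ran: "ran m = ?O" using assms(2) odd_numbers_placed_conv by blast
  have "m ` dom m = Some ` ran m"
    by (force simp: ran_def dom_def image_iff)
  then have "card (dom m) = card (ran m)"
    using inj by (metis card_image inj_Some inj_on_subset subset_UNIV)
  moreover have "{c \<in> \<tau>. m c = None} = \<tau> - dom m" using dom by auto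
  moreover have "card (\<tau> - dom m) = card \<tau> - card (dom m)"
    using fin dom by (meson card_Diff_subset finite_subset)
  moreover have "card (evens (card \<tau>)) + card ?O = card (evens (card \<tau>) \<union> ?O)"
    by (intro card_Un_disjoint[symmetric]) (auto simp: evens_def)
  moreover have "evens (card \<tau>) \<union> ?O = {1..card \<tau>}"
    by (auto simp: evens_def Suc_le_eq intro: Nat.gr0I)
  ultimately show ?thesis using ran by simp
qed

text \<open>All odd numbers are placed and \<open>s\<close> extends \<open>m\<close>, so injectivity
  of \<open>s\<close> leaves no odd number for a free cell.\<close>

lemma solution_parity:
  assumes "odd_numbers_placed (\<tau>, m, p)" "solution (\<tau>, m, p) s" "c \<in> \<tau>" "dom m \<subseteq> \<tau>"
  shows "m c = (if odd (s c) then Some (s c) else None)"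
proof -
  have bij: "bij_betw s \<tau> {1..card \<tau>}" and m: "\<And>c. c \<in> dom m \<Longrightarrow> m c = Some (s c)"
    using assms(2) by auto
  have ran: "ran m = {k. odd k \<and> k \<le> card \<tau>}" using assms(1) odd_numbers_placed_conv by blast
  show ?thesis
  proof (cases "odd (s c)")
    case True
    have "s c \<in> ran m" using ran True bij assms(3) by (auto simp: bij_betw_def)
    then obtain d where d: "m d = Some (s c)" by (auto simp: ran_def)
    then have "s d = s c" "d \<in> \<tau>" using m[OF domI[of m d "s c"]] d assms(4) by auto
    then have "d = c" using bij assms(3) by (auto simp: bij_betw_def inj_on_def)
    then show ?thesis using d True by simp
  next
    case False
    have "s c \<notin> ran m" using False ran by simp
    then have "c \<notin> dom m" using m[of c] by (metis ranI)
    then show ?thesis using False by auto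
  qed
qed

lemma parity_step:
  fixes i j :: nat
  assumes "\<bar>int i - int j\<bar> = 1"
  shows "even i \<longleftrightarrow> odd j"
  using assms by presburger

text \<open>The matching is the inverse of \<open>s\<close> on the even numbers. A given adjacency
  joins consecutive numbers, one of which is even, so one of its two cells is free.\<close>

lemma solution_imp_matching:
  assumes game: "rikudo_game (\<tau>, m, p)" and odds: "odd_numbers_placed (\<tau>, m, p)"
    and sol: "solution (\<tau>, m, p) s"
  defines "E \<equiv> evens (card \<tau>)"
  shows "(\<forall>a b. (a, b) \<in> p \<longrightarrow> m a = None \<or> m b = None) \<and>
    (\<exists>f. inj_on f E \<and> (\<forall>k\<in>E. f k \<in> \<tau> \<and> m (f k) = None \<and> fits (\<tau>, m, p) k (f k)))"
proof -
  have bij: "bij_betw s \<tau> {1..card \<tau>}"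
    and adj: "\<And>c c'. c \<in> \<tau> \<Longrightarrow> c' \<in> \<tau> \<Longrightarrow> \<bar>int (s c) - int (s c')\<bar> = 1 \<Longrightarrow> adjacent c c'"
    and pairs: "\<And>a b. (a, b) \<in> p \<Longrightarrow> \<bar>int (s a) - int (s b)\<bar> = 1"
    using sol by auto
  have p: "a \<in> \<tau>" "b \<in> \<tau>" if "(a, b) \<in> p" for a b
    using game that by (auto simp: cell_graph_def)
  have m: "m c = (if odd (s c) then Some (s c) else None)" if "c \<in> \<tau>" for c
    using solution_parity[OF odds sol that] game by simp
  have near: "near (m c) k \<longleftrightarrow> \<bar>int (s c) - int k\<bar> = 1" if "c \<in> \<tau>" "even k" for c k
  proof (cases "odd (s c)")
    case True
    then show ?thesis using m[OF that(1)] by (auto simp: near_def)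
  next
    case False
    then have "\<bar>int (s c) - int k\<bar> \<noteq> 1" using that(2) by presburger
    then show ?thesis using m[OF that(1)] False by (simp add: near_def)
  qed
  define f where "f = inv_into \<tau> s"
  have f: "f k \<in> \<tau>" "s (f k) = k" if "k \<in> E" for k
  proof -
    have "k \<in> s ` \<tau>" using bij that by (auto simp: bij_betw_def E_def evens_def)
    then show "f k \<in> \<tau>" "s (f k) = k" by (auto simp: f_def inv_into_into f_inv_into_f)
  qed
  have "fits (\<tau>, m, p) k (f k)" if k: "k \<in> E" for k
  proof -
    have even: "even k" using k by (simp add: E_def evens_def)
    have "adjacent c (f k)" if "c \<in> \<tau>" "near (m c) k" for c
      using adj[of c "f k"] near[of c k] f[OF k] that even by simp
    moreover have "near (m b) k" if "(f k, b) \<in> p" for b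
      using pairs[OF that] near[of b k] f[OF k] p[OF that] even by (simp add: abs_minus_commute)
    moreover have "near (m a) k" if "(a, f k) \<in> p" for a
      using pairs[OF that] near[of a k] f[OF k] p[OF that] even by simp
    ultimately show ?thesis by (auto simp: fits_def)
  qed
  moreover have "m (f k) = None" if "k \<in> E" for k
    using m[of "f k"] f[OF that] that by (simp add: E_def evens_def)
  moreover have "inj_on f E" using f(2) by (rule inj_on_inverseI)
  moreover have "m a = None \<or> m b = None" if "(a, b) \<in> p" for a b
  proof -
    have "even (s a) \<or> even (s b)" using pairs[OF that] by presburger
    then show ?thesis using m[OF p(1)[OF that]] m[OF p(2)[OF that]] by auto
  qed
  ultimately show ?thesis using f(1) by blast
qed

text \<open>The solution is \<open>m\<close> on placed cells and the inverse of \<open>f\<close> on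
  free cells, all of which \<open>f\<close> hits. Of two cells with consecutive numbers exactly one
  is free, and \<open>fits\<close> for its number supplies the adjacency. The hypothesis on
  \<open>p\<close> gives a free cell in the same way for the given adjacencies.\<close>

lemma matching_imp_solution:
  assumes game: "rikudo_game (\<tau>, m, p)" and odds: "odd_numbers_placed (\<tau>, m, p)"
  defines "E \<equiv> evens (card \<tau>)"
  assumes pairs: "\<And>a b. (a, b) \<in> p \<Longrightarrow> m a = None \<or> m b = None"
    and inj: "inj_on f E"
    and f: "\<And>k. k \<in> E \<Longrightarrow> f k \<in> \<tau> \<and> m (f k) = None \<and> fits (\<tau>, m, p) k (f k)"
  shows "\<exists>s. solution (\<tau>, m, p) s"
proof -
  let ?F = "{c \<in> \<tau>. m c = None}"
  have fin: "finite \<tau>" and dom: "dom m \<subseteq> \<tau>" and inj_m: "inj_on m (dom m)" using game by auto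
  have p: "a \<in> \<tau>" "b \<in> \<tau>" "adjacent a b" if "(a, b) \<in> p" for a b
    using game that by (auto simp: cell_graph_def)
  have ran: "ran m = {k. odd k \<and> k \<le> card \<tau>}" using odds odd_numbers_placed_conv by blast
  have image: "f ` E = ?F"
  proof (rule card_subset_eq)
    show "finite ?F" using fin by simp
    show "f ` E \<subseteq> ?F" using f by auto
    show "card (f ` E) = card ?F"
      using card_free[OF game odds] card_image[OF inj] by (simp add: E_def)
  qed
  define s where "s = (\<lambda>c. case m c of Some k \<Rightarrow> k | None \<Rightarrow> inv_into E f c)"
  have s_Some: "s c = k" "odd k" "k \<le> card \<tau>" if "m c = Some k" for c k
  proof -
    have "k \<in> ran m" using that by (rule ranI)
    then show "s c = k" "odd k" "k \<le> card \<tau>" using that ran by (simp_all add: s_def)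
  qed
  have s_None: "s c \<in> E" "f (s c) = c" if "c \<in> \<tau>" "m c = None" for c
  proof -
    have "c \<in> f ` E" using image that by blast
    then show "s c \<in> E" "f (s c) = c"
      using that by (auto simp: s_def inv_into_into f_inv_into_f simp del: inv_into_f_eq)
  qed
  have even_None: "m c = None \<longleftrightarrow> even (s c)" if "c \<in> \<tau>" for c
    using s_Some(1,2)[of c] s_None(1)[OF that] by (cases "m c") (auto simp: E_def evens_def)
  have inj_s: "inj_on s \<tau>"
  proof (rule inj_onI)
    fix c c' assume c: "c \<in> \<tau>" "c' \<in> \<tau>" "s c = s c'"
    show "c = c'"
    proof (cases "m c")
      case None
      then show ?thesis using even_None s_None(2) c by metis
    next
      case (Some k)
      then obtain k' where k': "m c' = Some k'" using even_None c by (metis not_None_eq)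
      then have "m c = m c'" using Some s_Some(1) c(3) by metis
      moreover have "c \<in> dom m" "c' \<in> dom m" using Some k' by (simp_all add: domIff)
      ultimately show ?thesis by (rule inj_onD[OF inj_m])
    qed
  qed
  have "s c \<in> {1..card \<tau>}" if "c \<in> \<tau>" for c
  proof (cases "m c")
    case None
    then show ?thesis using s_None(1)[OF that] by (simp add: E_def evens_def)
  next
    case (Some k)
    then show ?thesis using s_Some[of c k] by (simp add: Suc_le_eq odd_pos)
  qed
  then have "s ` \<tau> = {1..card \<tau>}"
    using card_image[OF inj_s] by (intro card_subset_eq) auto
  with inj_s have bij: "bij_betw s \<tau> {1..card \<tau>}" by (simp add: bij_betw_def)
  have near: "near (m c) k \<longleftrightarrow> \<bar>int (s c) - int k\<bar> = 1" if "m c \<noteq> None" for c k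
    using that s_Some(1)[of c] by (auto simp: near_def)
  have fits: "adjacent c v" if "c \<in> \<tau>" "v \<in> \<tau>" "m v = None" "\<bar>int (s c) - int (s v)\<bar> = 1" for c v
  proof -
    have "m c \<noteq> None" using even_None that by (metis parity_step)
    then have "near (m c) (s v)" using near that(4) by simp
    then show ?thesis using f[OF s_None(1)[OF that(2,3)]] s_None(2)[OF that(2,3)] that(1)
      by (auto simp: fits_def)
  qed
  have "adjacent c c'" if c: "c \<in> \<tau>" "c' \<in> \<tau>" "\<bar>int (s c) - int (s c')\<bar> = 1" for c c'
  proof (cases "m c'")
    case None
    then show ?thesis using fits c by simp
  next
    case (Some k)
    then have "m c = None" using even_None c by (metis option.distinct(1) parity_step)
    then show ?thesis using fits[of c' c] c by (simp add: adjacent_sym abs_minus_commute)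
  qed
  moreover have "m c = Some (s c)" if "c \<in> dom m" for c
    using that s_Some(1)[of c] by auto
  moreover have "\<bar>int (s a) - int (s b)\<bar> = 1" if ab: "(a, b) \<in> p" for a b
  proof -
    \<comment> \<open>\<open>near\<close> fails on \<open>None\<close>, so the premise itself
      ensures that \<open>v\<close> carries a number.\<close>
    have *: "near (m v) (s u) \<Longrightarrow> \<bar>int (s v) - int (s u)\<bar> = 1" for u v
      by (metis near near_def option.simps(4))
    from pairs[OF ab] show ?thesis
    proof
      assume a: "m a = None"
      then have "near (m b) (s a)"
        using f[OF s_None(1)[OF p(1)[OF ab] a]] s_None(2)[OF p(1)[OF ab] a] ab by (auto simp: fits_def)
      from *[OF this] show ?thesis by simp
    next
      assume b: "m b = None"
      then have "near (m a) (s b)"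
        using f[OF s_None(1)[OF p(2)[OF ab] b]] s_None(2)[OF p(2)[OF ab] b] ab by (auto simp: fits_def)
      from *[OF this] show ?thesis .
    qed
  qed
  ultimately have "solution (\<tau>, m, p) s" using bij by auto
  then show ?thesis by blast
qed

text \<open>
  Only the last number, if it is even, may fit in more than two cells; the decider therefore tries
  all cells \<open>c\<close> for it.
\<close>

lemma card_fitting:
  assumes "odd_numbers_placed (\<tau>, m, p)" "dom m \<subseteq> \<tau>" "k \<in> evens (card \<tau>)" "k \<noteq> card \<tau>"
  shows "finite {v. fits (\<tau>, m, p) k v}" "card {v. fits (\<tau>, m, p) k v} \<le> 2"
proof -
  have ran: "ran m = {k. odd k \<and> k \<le> card \<tau>}" using assms(1) odd_numbers_placed_conv by blast
  obtain j where j: "k = Suc j" using assms(3) by (cases k) (auto simp: evens_def)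
  \<comment> \<open>Both \<open>k - 1\<close> and \<open>k + 1\<close> are placed: they are odd, and
    \<open>k\<close> is not the last number.\<close>
  have "j \<in> ran m" "Suc k \<in> ran m" using ran assms(3,4) j by (auto simp: evens_def)
  then obtain a b where ab: "m a = Some j" "m b = Some (Suc k)" by (auto simp: ran_def)
  then have "a \<noteq> b" using j by auto
  have "a \<in> \<tau>" "b \<in> \<tau>" using ab assms(2) by auto
  then have sub: "{v. fits (\<tau>, m, p) k v} \<subseteq> {v. adjacent a v \<and> adjacent b v}"
    using ab j by (auto simp: fits_def near_def)
  have fin: "finite {v. adjacent a v \<and> adjacent b v}"
    using finite_neighbours[of a] by (rule rev_finite_subset) auto
  show "finite {v. fits (\<tau>, m, p) k v}" using sub fin by (rule finite_subset)
  show "card {v. fits (\<tau>, m, p) k v} \<le> 2"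
    using card_mono[OF fin sub] common_neighbours[OF \<open>a \<noteq> b\<close>] by linarith
qed

section \<open>The decision procedure\<close>

text \<open>The two layers of \<open>option\<close> collapse: cells outside the list and cells
  without a number both give \<open>None\<close>.\<close>

definition label :: "(cell \<times> nat option) list \<Rightarrow> cell \<rightharpoonup> nat" where
  "label cs c = (case map_of cs c of None \<Rightarrow> None | Some x \<Rightarrow> x)"

definition game_of :: "(cell \<times> nat option) list \<Rightarrow> (cell \<times> cell) list \<Rightarrow> game" where
  "game_of cs ps = (set (map fst cs), label cs, set ps)"

definition placed :: "(cell \<times> nat option) list \<Rightarrow> nat list" where
  "placed cs = concat (map (\<lambda>x. case snd x of None \<Rightarrow> [] | Some k \<Rightarrow> [k]) cs)"

definition free :: "(cell \<times> nat option) list \<Rightarrow> cell list" where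
  "free cs = map fst (filter (\<lambda>x. snd x = None) cs)"

text \<open>Phrased with equality and successor only, so that no order on binary numbers has to be
  computed: the list is closed under subtracting two, reaches \<open>n\<close> or
  \<open>n - 1\<close>, and contains neither \<open>n + 1\<close> nor \<open>n + 2\<close>.\<close>

definition odd_check :: "nat list \<Rightarrow> nat \<Rightarrow> bool" where
  "odd_check ks n \<longleftrightarrow>
     (\<forall>k\<in>set ks. odd k \<and> (k = Suc 0 \<or> (\<exists>j\<in>set ks. k = Suc (Suc j)))) \<and>
     (\<exists>k\<in>set ks. k = n \<or> Suc k = n) \<and> Suc n \<notin> set ks \<and> Suc (Suc n) \<notin> set ks"

definition fits_list ::
  "(cell \<times> nat option) list \<Rightarrow> (cell \<times> cell) list \<Rightarrow> nat \<Rightarrow> cell \<Rightarrow> bool"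
where
  "fits_list cs ps k v \<longleftrightarrow> (\<forall>x\<in>set cs. near (snd x) k \<longrightarrow> adjacent (fst x) v) \<and>
     (\<forall>e\<in>set ps. (fst e = v \<longrightarrow> (\<exists>x\<in>set cs. fst x = snd e \<and> near (snd x) k)) \<and>
                (snd e = v \<longrightarrow> (\<exists>x\<in>set cs. fst x = fst e \<and> near (snd x) k)))"

text \<open>Every positive even number is the successor of an odd one; when \<open>n\<close> is odd,
  \<open>n + 1\<close> has to be left out.\<close>

definition even_list :: "(cell \<times> nat option) list \<Rightarrow> nat list" where
  "even_list cs = filter (\<lambda>k. k \<noteq> Suc (length cs)) (map Suc (placed cs))"

text \<open>The cell \<open>c\<close> is the guess for the last number. For odd \<open>n\<close> the
  guess has no effect on a well-formed game, because \<open>n\<close> is then not among the numbers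
  to be matched.\<close>

definition candidates ::
  "(cell \<times> nat option) list \<Rightarrow> (cell \<times> cell) list \<Rightarrow> cell \<Rightarrow> (nat \<times> cell list) list"
where
  "candidates cs ps c =
     map (\<lambda>k. (k, filter (\<lambda>v. fits_list cs ps k v \<and> (k = length cs \<longrightarrow> v = c)) (free cs))) (even_list cs)"

text \<open>The list \<open>cs\<close> serves as a clock: the fold runs one round per cell, and
  there are at most that many free cells.\<close>

definition peeled ::
  "(cell \<times> nat option) list \<Rightarrow> (cell \<times> cell) list \<Rightarrow> cell \<Rightarrow> (nat \<times> cell list) list \<times> cell list"
where
  "peeled cs ps c = foldl (\<lambda>s _. peel s) (candidates cs ps c, free cs) cs"

definition well_formed :: "(cell \<times> nat option) list \<Rightarrow> (cell \<times> cell) list \<Rightarrow> bool" where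
  "well_formed cs ps \<longleftrightarrow> distinct (map fst cs) \<and> distinct ps \<and>
     cs \<noteq> [] \<and> unreached (map fst cs) = [] \<and>
     (\<forall>e\<in>set ps. fst e \<in> set (map fst cs) \<and> snd e \<in> set (map fst cs) \<and> adjacent (fst e) (snd e)) \<and>
     distinct (placed cs) \<and> odd_check (placed cs) (length cs)"

definition accepts :: "(cell \<times> nat option) list \<Rightarrow> (cell \<times> cell) list \<Rightarrow> bool" where
  "accepts cs ps \<longleftrightarrow> well_formed cs ps \<and>
     (\<forall>e\<in>set ps. fst e \<in> set (free cs) \<or> snd e \<in> set (free cs)) \<and>
     (\<exists>c\<in>set (map fst cs). length (fst (peeled cs ps c)) = length (snd (peeled cs ps c)))"

lemma label_eq: "distinct (map fst cs) \<Longrightarrow> x \<in> set cs \<Longrightarrow> label cs (fst x) = snd x"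
  by (cases x) (simp add: label_def)

lemma label_outside: "c \<notin> fst ` set cs \<Longrightarrow> label cs c = None"
  by (simp add: label_def map_of_eq_None_iff[THEN iffD2])

lemma label_Some_iff:
  assumes "distinct (map fst cs)"
  shows "label cs c = Some k \<longleftrightarrow> (c, Some k) \<in> set cs"
proof -
  have "label cs c = Some k \<longleftrightarrow> map_of cs c = Some (Some k)"
    by (simp add: label_def split: option.split)
  then show ?thesis using assms by simp
qed

lemma placed_conv: "placed cs = map (\<lambda>x. the (snd x)) (filter (\<lambda>x. snd x \<noteq> None) cs)"
  by (induction cs) (auto simp: placed_def split: option.splits)

lemma set_placed: "distinct (map fst cs) \<Longrightarrow> set (placed cs) = ran (label cs)"
  unfolding ran_def label_Some_iff by (force simp: placed_conv)

lemma set_free: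
  "distinct (map fst cs) \<Longrightarrow> set (free cs) = {c \<in> set (map fst cs). label cs c = None}"
  using label_eq[of cs] by (force simp: free_def)

lemma distinct_placed:
  assumes "distinct (map fst cs)"
  shows "distinct (placed cs) \<longleftrightarrow> inj_on (label cs) (dom (label cs))"
proof -
  have dist: "distinct cs" and inj: "inj_on fst (set cs)" using assms by (auto simp: distinct_map)
  have "distinct (placed cs) \<longleftrightarrow>
      (\<forall>c d k. (c, Some k) \<in> set cs \<longrightarrow> (d, Some k) \<in> set cs \<longrightarrow> c = d)"
    unfolding placed_conv distinct_map inj_on_def using dist by fastforce
  also have "\<dots> \<longleftrightarrow> inj_on (label cs) (dom (label cs))"
    unfolding inj_on_def dom_def label_Some_iff[OF assms, symmetric] by (auto; metis)
  finally show ?thesis .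
qed

lemma odd_check_iff:
  assumes "n \<ge> 1"
  shows "odd_check ks n \<longleftrightarrow> set ks = {k. odd k \<and> k \<le> n}"
proof
  assume check: "odd_check ks n"
  have down: "j \<in> set ks" if "k \<in> set ks" "odd j" "j \<le> k" for j k
    using that
  proof (induction k rule: less_induct)
    case (less k)
    show ?case
    proof (cases "j = k")
      case False
      then have "j < k" using less.prems by simp
      moreover have "odd k" using check less.prems by (simp add: odd_check_def)
      ultimately have "Suc j < k" using less.prems(2) by (metis Suc_lessI even_Suc)
      then obtain i where "i \<in> set ks" "k = Suc (Suc i)"
        using check less.prems by (fastforce simp: odd_check_def)
      then show ?thesis using less.IH[of i] less.prems(2) \<open>Suc j < k\<close> by simp
    qed (use less.prems in simp)
  qed
  have "k \<le> n" if "k \<in> set ks" for k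
  proof (rule ccontr)
    assume "\<not> k \<le> n"
    moreover have "odd k" using that check by (simp add: odd_check_def)
    \<comment> \<open>One of \<open>n + 1\<close> and \<open>n + 2\<close> is odd and at most
      \<open>k\<close>; by downward closure it would be in the list.\<close>
    ultimately have "odd n \<Longrightarrow> Suc (Suc n) \<le> k" "Suc n \<le> k"
      by (presburger, simp)
    then have "Suc n \<in> set ks \<or> Suc (Suc n) \<in> set ks"
      using down[OF that, of "Suc n"] down[OF that, of "Suc (Suc n)"] by (cases "odd n") auto
    then show False using check by (simp add: odd_check_def)
  qed
  moreover have "j \<in> set ks" if "odd j" "j \<le> n" for j
  proof -
    obtain k where k: "k \<in> set ks" "k = n \<or> Suc k = n" "odd k"
      using check unfolding odd_check_def by blast
    then have "j \<le> k" using that by (metis even_Suc le_Suc_eq)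
    then show ?thesis using down k(1) that(1) by blast
  qed
  ultimately show "set ks = {k. odd k \<and> k \<le> n}"
    using check unfolding odd_check_def by blast
next
  assume ks: "set ks = {k. odd k \<and> k \<le> n}"
  have "k = Suc 0 \<or> (\<exists>j\<in>set ks. k = Suc (Suc j))" if "odd k" "k \<le> n" for k
  proof (cases k)
    case (Suc i)
    then show ?thesis using that ks by (cases i) auto
  qed (use that in simp)
  moreover have "\<exists>k\<in>set ks. k = n \<or> Suc k = n"
  proof (cases "odd n")
    case False
    then obtain i where "n = Suc i" using assms by (cases n) auto
    then show ?thesis using False ks by auto
  qed (use ks in \<open>auto intro!: bexI[of _ n]\<close>)
  ultimately show "odd_check ks n"
    unfolding odd_check_def using ks by auto
qed

text \<open>The empty list is treated apart: its graph is not connected, so it describes no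
  game.\<close>

lemma well_formed_iff:
  "well_formed cs ps \<longleftrightarrow> distinct (map fst cs) \<and> distinct ps \<and>
     rikudo_game (game_of cs ps) \<and> odd_numbers_placed (game_of cs ps)"
proof (cases "distinct (map fst cs) \<and> cs \<noteq> []")
  case True
  then have dist: "distinct (map fst cs)" and ne: "map fst cs \<noteq> []" by auto
  have card: "card (set (map fst cs)) = length cs" using dist by (metis distinct_card length_map)
  have dom: "dom (label cs) \<subseteq> set (map fst cs)" using label_outside[of _ cs] by fastforce
  have odd: "odd_check (placed cs) (length cs) \<longleftrightarrow> odd_numbers_placed (game_of cs ps)"
    using odd_check_iff[of "length cs" "placed cs"] ne set_placed[OF dist] card
    unfolding game_of_def odd_numbers_placed_conv by (simp add: Suc_le_eq del: set_map)
  have pairs: "(\<forall>e\<in>set ps. fst e \<in> set (map fst cs) \<and> snd e \<in> set (map fst cs) \<and> adjacent (fst e) (snd e))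
      \<longleftrightarrow> set ps \<subseteq> parcs (cell_graph (set (map fst cs)))"
  proof -
    have "e \<in> parcs (cell_graph \<sigma>) \<longleftrightarrow> fst e \<in> \<sigma> \<and> snd e \<in> \<sigma> \<and> adjacent (fst e) (snd e)" for e \<sigma>
      by (cases e) (simp add: cell_graph_def)
    then show ?thesis by (simp only: subset_eq)
  qed
  have "odd_numbers_placed (game_of cs ps) \<Longrightarrow> ran (label cs) \<subseteq> {1..length cs}"
    using card unfolding game_of_def by (simp del: set_map)
  then show ?thesis
    using dist ne card dom
    unfolding well_formed_def odd pairs distinct_placed[OF dist]
    by (auto simp: game_of_def unreached_eq_Nil[OF dist ne, symmetric] simp del: set_map
        odd_numbers_placed.simps)
next
  case False
  then show ?thesis by (auto simp: well_formed_def game_of_def connected_cell_graph)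
qed

lemma fits_list_iff:
  assumes "distinct (map fst cs)"
  shows "fits_list cs ps k v \<longleftrightarrow> fits (game_of cs ps) k v"
proof -
  have "near (label cs c) k \<longleftrightarrow> (\<exists>x\<in>set cs. fst x = c \<and> near (snd x) k)" for c
  proof (cases "c \<in> fst ` set cs")
    case True
    then obtain x where "x \<in> set cs" "c = fst x" by blast
    moreover have "near (snd y) k = near (label cs c) k" if "y \<in> set cs" "fst y = c" for y
      using label_eq[OF assms that(1)] that(2) by simp
    ultimately show ?thesis by metis
  next
    case False
    then show ?thesis using label_outside[OF False] by (auto simp: near_def)
  qed
  moreover have "(\<forall>c\<in>set (map fst cs). near (label cs c) k \<longrightarrow> adjacent c v) \<longleftrightarrow>
      (\<forall>x\<in>set cs. near (snd x) k \<longrightarrow> adjacent (fst x) v)"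
    using label_eq[OF assms] by simp
  ultimately show ?thesis
    unfolding fits_list_def fits_def game_of_def by (simp add: case_prod_beta del: set_map)
qed

lemma foldl_iterate: "foldl (\<lambda>s _. f s) s xs = (f ^^ length xs) s"
  by (induction xs arbitrary: s) (simp_all add: funpow_swap1)

text \<open>For a well-formed input the peeling succeeds for \<open>c\<close> exactly if there is a
  matching that sends the last number, if even, to \<open>c\<close>. Letting \<open>c\<close> range
  over all cells removes the pinning, and what is left are the matchings equivalent to
  solutions.\<close>

theorem accepts_iff:
  "accepts cs ps \<longleftrightarrow> distinct (map fst cs) \<and> distinct ps \<and>
     rikudo_game (game_of cs ps) \<and> odd_numbers_placed (game_of cs ps) \<and> (\<exists>s. solution (game_of cs ps) s)"
proof (cases "well_formed cs ps")
  case True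
  define \<tau> m p where "\<tau> = set (map fst cs)" and "m = label cs" and "p = set ps"
  have g: "game_of cs ps = (\<tau>, m, p)" by (simp only: game_of_def \<tau>_def m_def p_def)
  have dist: "distinct (map fst cs)" and game: "rikudo_game (\<tau>, m, p)"
    and odds: "odd_numbers_placed (\<tau>, m, p)"
    using True g by (auto simp: well_formed_iff)
  have card: "card \<tau> = length cs" using dist unfolding \<tau>_def by (metis distinct_card length_map)
  have dom: "dom m \<subseteq> \<tau>" using game by auto
  have ran: "ran m = {k. odd k \<and> k \<le> card \<tau>}" using odds odd_numbers_placed_conv by blast
  have free: "set (free cs) = {c \<in> \<tau>. m c = None}" using set_free[OF dist] by (simp only: \<tau>_def m_def)
  have dist_free: "distinct (free cs)"
    using dist unfolding free_def by (rule distinct_map_filter)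
  have placed: "set (placed cs) = {k. odd k \<and> k \<le> card \<tau>}" "distinct (placed cs)"
    using set_placed[OF dist] ran True by (simp_all add: m_def well_formed_def)
  have evens: "set (even_list cs) = evens (card \<tau>)" "distinct (even_list cs)"
  proof -
    show "distinct (even_list cs)" using placed(2) by (simp add: even_list_def distinct_map)
    have "k \<in> Suc ` {k. odd k \<and> k \<le> card \<tau>} \<and> k \<noteq> Suc (card \<tau>) \<longleftrightarrow> k \<in> evens (card \<tau>)" for k
      by (cases k) (auto simp: evens_def)
    then show "set (even_list cs) = evens (card \<tau>)"
      unfolding even_list_def using placed(1) card by auto
  qed
  have cand: "fst ` set (candidates cs ps c) = evens (card \<tau>)" for c
    using evens(1) by (force simp: candidates_def)
  \<comment> \<open>The equality of lengths that \<open>peel_decides\<close> presupposes.\<close>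
  have len: "length (even_list cs) = length (free cs)"
    using card_free[OF game odds] free evens dist_free by (metis distinct_card)
  have peelable: "peelable (candidates cs ps c, free cs)" for c
    unfolding peelable_def
  proof (intro conjI ballI)
    show "distinct (map fst (fst (candidates cs ps c, free cs)))"
      using evens(2) by (simp add: candidates_def comp_def)
    show "distinct (snd (candidates cs ps c, free cs))" using dist_free by simp
    fix r assume "r \<in> set (fst (candidates cs ps c, free cs))"
    then obtain k where k: "k \<in> evens (card \<tau>)"
      "r = (k, filter (\<lambda>v. fits (\<tau>, m, p) k v \<and> (k = card \<tau> \<longrightarrow> v = c)) (free cs))"
      using evens(1) by (auto simp: candidates_def fits_list_iff[OF dist] g card)
    then show "set (snd r) \<subseteq> set (snd (candidates cs ps c, free cs))" by simp
    show "card (set (snd r)) \<le> 2"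
    \<comment> \<open>The last number is pinned to \<open>c\<close>; every other even number lies
      between two placed ones.\<close>
    proof (cases "k = card \<tau>")
      case True
      then have "set (snd r) \<subseteq> {c}" using k by auto
      then have "card (set (snd r)) \<le> card {c}" by (rule card_mono[rotated]) simp
      then show ?thesis by simp
    next
      case False
      have "set (snd r) \<subseteq> {v. fits (\<tau>, m, p) k v}" using k by auto
      from card_mono[OF card_fitting(1)[OF odds dom k(1) False] this]
        card_fitting(2)[OF odds dom k(1) False]
      show ?thesis by linarith
    qed
  qed
  have peeled: "length (fst (peeled cs ps c)) = length (snd (peeled cs ps c)) \<longleftrightarrow>
      choosable (candidates cs ps c)" for c
  proof -
    have "length (snd (candidates cs ps c, free cs)) \<le> length cs" by (simp add: free_def)
    with peel_decides[OF peelable, of c "length cs"] len show ?thesis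
      unfolding peeled_def foldl_iterate by (simp add: candidates_def)
  qed
  have choosable: "choosable (candidates cs ps c) \<longleftrightarrow>
      (\<exists>f. inj_on f (evens (card \<tau>)) \<and> (\<forall>k\<in>evens (card \<tau>). f k \<in> \<tau> \<and> m (f k) = None \<and>
         fits (\<tau>, m, p) k (f k) \<and> (k = card \<tau> \<longrightarrow> f k = c)))" for c
    unfolding choosable_def cand
    by (simp add: candidates_def fits_list_iff[OF dist] g card evens(1) free conj_assoc)
  have "(\<exists>c\<in>\<tau>. choosable (candidates cs ps c)) \<longleftrightarrow>
      (\<exists>f. inj_on f (evens (card \<tau>)) \<and> (\<forall>k\<in>evens (card \<tau>). f k \<in> \<tau> \<and> m (f k) = None \<and>
         fits (\<tau>, m, p) k (f k)))" (is "?l \<longleftrightarrow> ?r")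
  proof
    assume ?l
    then show ?r unfolding choosable by blast
  next
    assume ?r
    then obtain f where f: "inj_on f (evens (card \<tau>))" "\<forall>k\<in>evens (card \<tau>). f k \<in> \<tau> \<and> m (f k) = None \<and>
         fits (\<tau>, m, p) k (f k)" by blast
    have "\<tau> \<noteq> {}" using True by (auto simp: \<tau>_def well_formed_def)
    \<comment> \<open>If the last number is odd, nothing is guessed and any cell serves, which uses
      that there is a cell.\<close>
    then obtain c where "c \<in> \<tau>" "card \<tau> \<in> evens (card \<tau>) \<longrightarrow> f (card \<tau>) = c"
      using f(2) by (metis all_not_in_conv)
    then have "choosable (candidates cs ps c)" using f unfolding choosable by blast
    then show ?l using \<open>c \<in> \<tau>\<close> by blast
  qed
  moreover have "(\<forall>e\<in>set ps. fst e \<in> set (free cs) \<or> snd e \<in> set (free cs)) \<longleftrightarrow>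
      (\<forall>a b. (a, b) \<in> p \<longrightarrow> m a = None \<or> m b = None)"
  proof -
    have "fst e \<in> \<tau> \<and> snd e \<in> \<tau>" if "e \<in> set ps" for e
      using True that by (simp add: well_formed_def \<tau>_def)
    then show ?thesis unfolding free p_def by fastforce
  qed
  ultimately have "accepts cs ps \<longleftrightarrow> (\<forall>a b. (a, b) \<in> p \<longrightarrow> m a = None \<or> m b = None) \<and>
      (\<exists>f. inj_on f (evens (card \<tau>)) \<and> (\<forall>k\<in>evens (card \<tau>). f k \<in> \<tau> \<and> m (f k) = None \<and>
         fits (\<tau>, m, p) k (f k)))"
    using True unfolding accepts_def peeled \<tau>_def by simp
  also have "\<dots> \<longleftrightarrow> (\<exists>s. solution (\<tau>, m, p) s)"
    (is "?l \<longleftrightarrow> ?r")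
  proof
    assume ?l
    then obtain f where "inj_on f (evens (card \<tau>))"
      "\<And>k. k \<in> evens (card \<tau>) \<Longrightarrow> f k \<in> \<tau> \<and> m (f k) = None \<and> fits (\<tau>, m, p) k (f k)" by blast
    with \<open>?l\<close> show ?r using matching_imp_solution[OF game odds, of f] by blast
  next
    assume ?r
    then obtain s where "solution (\<tau>, m, p) s" ..
    from solution_imp_matching[OF game odds this] show ?l .
  qed
  finally show ?thesis using True by (simp only: well_formed_iff g) blast
next
  case False
  then show ?thesis by (auto simp: accepts_def well_formed_iff)
qed

section \<open>The decision procedure runs in polynomial time\<close>

lemma ptime_compose2:
  assumes "ptime (\<lambda>p. F (fst p) (snd p))" "ptime f" "ptime g"
  shows "ptime (\<lambda>x. F (f x) (g x))"
  using ptime_compose[OF assms(1) ptime_Pair[OF assms(2,3)]] by simp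

lemma ptime_compose3:
  assumes "ptime (\<lambda>p. F (fst p) (fst (snd p)) (snd (snd p)))" "ptime f" "ptime g" "ptime h"
  shows "ptime (\<lambda>x. F (f x) (g x) (h x))"
  using ptime_compose[OF assms(1) ptime_Pair[OF assms(2) ptime_Pair[OF assms(3,4)]]] by simp

lemma ptime_compose4:
  assumes "ptime (\<lambda>p. F (fst p) (fst (snd p)) (fst (snd (snd p))) (snd (snd (snd p))))"
    "ptime f" "ptime g" "ptime h" "ptime k"
  shows "ptime (\<lambda>x. F (f x) (g x) (h x) (k x))"
  using ptime_compose[OF assms(1) ptime_Pair[OF assms(2) ptime_Pair[OF assms(3) ptime_Pair[OF assms(4,5)]]]]
  by simp

text \<open>Differences of \<open>-1\<close> are turned around, so that every condition is an
  equality or an instance of \<open>ptime_int_succ\<close>.\<close>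

lemma adjacent_differences: "adjacent c c' \<longleftrightarrow>
    fst c' - fst c = 1 \<and> snd c' = snd c \<or> fst c - fst c' = 1 \<and> snd c' = snd c \<or>
    fst c' = fst c \<and> snd c' - snd c = 1 \<or> fst c' = fst c \<and> snd c - snd c' = 1 \<or>
    fst c' - fst c = 1 \<and> snd c - snd c' = 1 \<or> fst c - fst c' = 1 \<and> snd c' - snd c = 1"
proof -
  have neg: "a - b = - 1 \<longleftrightarrow> b - a = 1" for a b :: int by linarith
  show ?thesis
    unfolding adjacent_def insert_iff empty_iff prod.inject neg right_minus_eq by blast
qed

lemma ptime_adjacent': "ptime (\<lambda>p. adjacent (fst p) (snd p))"
  unfolding adjacent_differences by (intro ptime_disj ptime_conj ptime_int_succ ptime_intros)

lemmas ptime_adjacent [ptime_intros] = ptime_compose2[OF ptime_adjacent']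

lemma sz_filter: "sz (filter P l) \<le> sz l"
  by (induction l) auto

lemma ptime_spread': "ptime (\<lambda>p. spread (fst p) (snd p))"
  unfolding spread_def by (intro ptime_intros)

lemmas ptime_spread [ptime_intros] = ptime_compose2[OF ptime_spread']

text \<open>\<open>spread\<close> filters its list, so the accumulator does not grow and
  \<open>C\<close> is zero; the same holds for peeling below.\<close>

lemma ptime_unreached': "ptime unreached"
proof -
  have "ptime (\<lambda>cs. foldl (\<lambda>us _. spread cs us) (tl cs) cs)"
    by (rule ptime_foldl[where C = "\<lambda>_. 0"])
      ((intro ptime_intros pbound_intros)+, simp add: spread_def sz_filter)
  then show ?thesis by (simp add: foldl_iterate unreached_def[abs_def])
qed

lemmas ptime_unreached [ptime_intros] = ptime_compose[OF ptime_unreached']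

lemma ptime_peel': "ptime (peel :: ('k::enc \<times> 'v::enc list) list \<times> 'v list \<Rightarrow> _)"
  unfolding peel_def[abs_def] by (intro ptime_intros)

lemmas ptime_peel [ptime_intros] = ptime_compose[OF ptime_peel']

lemma sz_peel: "sz (peel s) \<le> sz s"
proof (cases s rule: peel_cases)
  case (step v)
  have "sz (filter (\<lambda>r. v \<notin> set (snd r)) (fst s)) + sz (filter (\<lambda>u. u \<noteq> v) (snd s)) \<le> sz (fst s) + sz (snd s)"
    by (intro add_mono sz_filter)
  then show ?thesis using step(3) by (cases s) simp
qed simp

lemma ptime_near': "ptime (\<lambda>p. near (fst p) (snd p))"
  unfolding near_def by (intro ptime_intros)

lemmas ptime_near [ptime_intros] = ptime_compose2[OF ptime_near']

lemma ptime_placed': "ptime placed"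
  unfolding placed_def[abs_def] by (intro ptime_intros)

lemmas ptime_placed [ptime_intros] = ptime_compose[OF ptime_placed']

lemma ptime_free': "ptime free"
  unfolding free_def[abs_def] by (intro ptime_intros)

lemmas ptime_free [ptime_intros] = ptime_compose[OF ptime_free']

lemma ptime_odd_check': "ptime (\<lambda>p. odd_check (fst p) (snd p))"
  unfolding odd_check_def by (intro ptime_intros)

lemmas ptime_odd_check [ptime_intros] = ptime_compose2[OF ptime_odd_check']

lemma ptime_fits_list':
  "ptime (\<lambda>p. fits_list (fst p) (fst (snd p)) (fst (snd (snd p))) (snd (snd (snd p))))"
  unfolding fits_list_def by (intro ptime_intros)

lemmas ptime_fits_list [ptime_intros] = ptime_compose4[OF ptime_fits_list']

lemma ptime_even_list': "ptime even_list"
  unfolding even_list_def[abs_def] by (intro ptime_intros)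

lemmas ptime_even_list [ptime_intros] = ptime_compose[OF ptime_even_list']

lemma ptime_candidates': "ptime (\<lambda>p. candidates (fst p) (fst (snd p)) (snd (snd p)))"
  unfolding candidates_def by (intro ptime_intros)

lemmas ptime_candidates [ptime_intros] = ptime_compose3[OF ptime_candidates']

lemma ptime_peeled': "ptime (\<lambda>p. peeled (fst p) (fst (snd p)) (snd (snd p)))"
  unfolding peeled_def
  by (rule ptime_foldl[where C = "\<lambda>_. 0"]) ((intro ptime_intros pbound_intros)+, simp add: sz_peel)

lemmas ptime_peeled [ptime_intros] = ptime_compose3[OF ptime_peeled']

lemma ptime_well_formed': "ptime (\<lambda>p. well_formed (fst p) (snd p))"
  unfolding well_formed_def by (intro ptime_intros)

lemma ptime_accepts': "ptime (\<lambda>p. accepts (fst p) (snd p))"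
  unfolding accepts_def by (intro ptime_intros ptime_compose2[OF ptime_well_formed'])

section \<open>Reading games from words\<close>

text \<open>
  Words are read from right to left, so that every record is opened by its semicolon. The state
  consists of the number just being read, the records of the current part of the word and those of
  the part behind the bar; a record has the integers read so far and the number behind the hash.
\<close>

type_synonym parser_record = "int list \<times> nat option"

type_synonym parser_state = "nat \<times> parser_record list \<times> parser_record list"

definition on_head :: "(parser_record \<Rightarrow> parser_record) \<Rightarrow> parser_record list \<Rightarrow> parser_record list" where
  "on_head f rs = (case rs of [] \<Rightarrow> [] | r # rs' \<Rightarrow> f r # rs')"

text \<open>Read from the right, the most significant digit comes first, so digits are absorbed by
  Horner's rule. A sign or a hash closes the number and resets it to \<open>0\<close>. The last
  branch is the bar: the records collected so far become those of the part behind it.\<close>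

definition parse_letter :: "letter \<Rightarrow> parser_state \<Rightarrow> parser_state" where
  "parse_letter d s =
    (if d = Digit True then (of_bool True + 2 * fst s, fst (snd s), snd (snd s))
     else if d = Digit False then (of_bool False + 2 * fst s, fst (snd s), snd (snd s))
     else if d = Plus then (0, on_head (\<lambda>r. (int (fst s) # fst r, snd r)) (fst (snd s)), snd (snd s))
     else if d = Minus then (0, on_head (\<lambda>r. (- int (fst s) # fst r, snd r)) (fst (snd s)), snd (snd s))
     else if d = Hash then (0, on_head (\<lambda>r. (fst r, Some (fst s))) (fst (snd s)), snd (snd s))
     else if d = Semicolon then (0, ([], None) # fst (snd s), snd (snd s))
     else (0, [], fst (snd s)))"

text \<open>The default values arise for malformed words, which \<open>decider\<close> rejects by
  comparing encodings.\<close>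

definition record_cell :: "parser_record \<Rightarrow> cell \<times> nat option" where
  "record_cell r = (case fst r of [] \<Rightarrow> ((0, 0), None) | x # l \<Rightarrow>
     (case l of [] \<Rightarrow> ((0, 0), None) | y # _ \<Rightarrow> ((x, y), snd r)))"

definition record_pair :: "parser_record \<Rightarrow> cell \<times> cell" where
  "record_pair r = (fst (record_cell r), fst (record_cell (tl (tl (fst r)), None)))"

definition parse :: "letter list \<Rightarrow> (cell \<times> nat option) list \<times> (cell \<times> cell) list" where
  "parse w = (let s = foldr parse_letter w (0, [], []) in
     (map record_cell (fst (snd s)), map record_pair (snd (snd s))))"

definition encode :: "(cell \<times> nat option) list \<Rightarrow> (cell \<times> cell) list \<Rightarrow> letter list" where
  "encode cs ps = concat (map (\<lambda>x. enc_cell (\<lambda>_. snd x) (fst x)) cs) @ [Bar] @ concat (map enc_pair ps)"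

lemma parse_enc_nat: "foldr parse_letter (enc_nat k) (0, rs, t) = (k, rs, t)"
proof (induction k rule: less_induct)
  case (less k)
  show ?case
  proof (cases "k = 0")
    case False
    then have "foldr parse_letter (enc_nat k) (0, rs, t) =
        parse_letter (Digit (odd k)) (k div 2, rs, t)"
      using less[of "k div 2"] by (subst enc_nat.simps) simp
    also have "\<dots> = (k, rs, t)"
      by (cases "odd k") (auto simp: parse_letter_def)
    finally show ?thesis .
  qed simp
qed

lemma parse_enc_int:
  "foldr parse_letter (enc_int z) (0, (l, k) # rs, t) = (0, (z # l, k) # rs, t)"
  by (simp add: enc_int_def parse_enc_nat parse_letter_def on_head_def)

lemma parse_enc_cell:
  "foldr parse_letter (enc_cell m c) (0, rs, t) = (0, ([fst c, snd c], m c) # rs, t)"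
proof -
  have "foldr parse_letter [Semicolon] (0, rs, t) = (0, ([], None) # rs, t)"
    by (simp add: parse_letter_def)
  moreover have "foldr parse_letter (case m c of None \<Rightarrow> [] | Some k \<Rightarrow> Hash # enc_nat k)
      (0, ([], None) # rs, t) = (0, ([], m c) # rs, t)"
    by (simp add: parse_enc_nat parse_letter_def on_head_def split: option.split)
  ultimately show ?thesis
    unfolding enc_cell_def enc_coords_def foldr_append by (simp add: parse_enc_int del: foldr.simps)
qed

lemma parse_enc_pair:
  "foldr parse_letter (enc_pair e) (0, rs, t) =
     (0, ([fst (fst e), snd (fst e), fst (snd e), snd (snd e)], None) # rs, t)"
proof -
  have "foldr parse_letter [Semicolon] (0, rs, t) = (0, ([], None) # rs, t)"
    by (simp add: parse_letter_def)
  then show ?thesis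
    unfolding enc_pair_def enc_coords_def foldr_append by (simp add: parse_enc_int del: foldr.simps)
qed

lemma parse_encode: "parse (encode cs ps) = (cs, ps)"
proof -
  have 1: "foldr parse_letter (concat (map enc_pair ps)) (0, [], t) =
      (0, map (\<lambda>e. ([fst (fst e), snd (fst e), fst (snd e), snd (snd e)], None)) ps, t)" for t
    by (induction ps) (simp_all add: parse_enc_pair)
  have 2: "foldr parse_letter (concat (map (\<lambda>x. enc_cell (\<lambda>_. snd x) (fst x)) cs)) (0, [], t) =
      (0, map (\<lambda>x. ([fst (fst x), snd (fst x)], snd x)) cs, t)" for t
    by (induction cs) (simp_all add: parse_enc_cell)
  have 3: "foldr parse_letter [Bar] (0, rs, t) = (0, [], rs)" for rs t
    by (simp add: parse_letter_def)
  show ?thesis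
    unfolding parse_def encode_def foldr_append 1 3 2 Let_def
    by (simp add: comp_def record_cell_def record_pair_def)
qed

lemma ptime_parse_letter': "ptime (\<lambda>p. parse_letter (fst p) (snd p))"
  unfolding parse_letter_def on_head_def by (intro ptime_intros)

lemmas ptime_parse_letter [ptime_intros] = ptime_compose2[OF ptime_parse_letter']

text \<open>A number that is moved into a record leaves \<open>0\<close> behind, so no letter
  duplicates data and the state grows by at most a constant per letter.\<close>

lemma ptime_parse: "ptime parse"
proof -
  have int_le: "sz (int n) \<le> sz n + 4" "sz (- int n) \<le> sz n + 4" for n
    using sz_int[of "int n"] sz_int[of "- int n"] by simp_all
  have dig: "sz (of_bool True + 2 * n :: nat) \<le> sz n + 6" "sz (of_bool False + 2 * n :: nat) \<le> sz n + 6" for n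
    by (rule sz_double)+
  have "sz (parse_letter d s) \<le> sz s + 20" for d s
  proof -
    obtain n rs t where s: "s = (n, rs, t)" by (cases s) auto
    show ?thesis
      using int_le[of n] dig[of n] sz_pos[of n] sz_pos[of t] sz_pos[of rs] unfolding parse_letter_def s
      by (cases rs) (auto simp: on_head_def simp del: of_bool_eq split: prod.splits option.splits)
  qed
  note le = this
  have "ptime (\<lambda>w. foldr (\<lambda>d s. parse_letter d s) w (0, [], []))"
    by (rule ptime_foldr[where C = "\<lambda>_. 20"])
      ((intro ptime_intros pbound_intros)+, rule le)
  then show ?thesis
    unfolding parse_def[abs_def] record_cell_def record_pair_def by (intro ptime_intros)
qed

lemma ptime_encode': "ptime (\<lambda>p. encode (fst p) (snd p))"
  unfolding encode_def enc_cell_def enc_pair_def enc_coords_def by (intro ptime_intros)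

text \<open>The comparison with the re-encoded result makes the total function \<open>parse\<close>
  a recogniser: words that are no encodings differ from every \<open>encode cs ps\<close>.\<close>

definition decider :: "letter list \<Rightarrow> bool" where
  "decider w \<longleftrightarrow> w = encode (fst (parse w)) (snd (parse w)) \<and> accepts (fst (parse w)) (snd (parse w))"

lemma ptime_decider: "ptime decider"
  unfolding decider_def[abs_def]
  by (intro ptime_intros ptime_compose2[OF ptime_accepts'] ptime_compose2[OF ptime_encode'] ptime_parse
      ptime_compose[OF ptime_parse])

text \<open>The order of the two lists read from the word provides the enumeration that
  \<open>encodes\<close> asks for. Conversely, \<open>parse\<close> recovers the enumeration from
  the word, and pairing each cell with its number gives back \<open>m\<close> as
  \<open>label\<close>.\<close>

lemma decider_iff: "decider w \<longleftrightarrow> w \<in> one_over_two_rikudo"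
proof
  assume d: "decider w"
  obtain cs ps where parse: "parse w = (cs, ps)" by force
  have w: "w = encode cs ps" and acc: "accepts cs ps"
    using d unfolding decider_def parse by auto
  have dist: "distinct (map fst cs)" "distinct ps" using acc by (auto simp: accepts_iff)
  have "map (\<lambda>x. enc_cell (\<lambda>_. snd x) (fst x)) cs = map (enc_cell (label cs)) (map fst cs)"
    using label_eq[OF dist(1)] by (simp add: enc_cell_def)
  then have "encodes w (game_of cs ps)"
    unfolding w encode_def game_of_def encodes.simps
    by (intro exI[of _ "map fst cs"] exI[of _ ps]) (simp only: dist simp_thms)
  then show "w \<in> one_over_two_rikudo"
    using acc unfolding one_over_two_rikudo_def accepts_iff by blast
next
  assume "w \<in> one_over_two_rikudo"
  then obtain \<tau> m p s where g: "encodes w (\<tau>, m, p)" "rikudo_game (\<tau>, m, p)"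
    "odd_numbers_placed (\<tau>, m, p)" "solution (\<tau>, m, p) s"
    unfolding one_over_two_rikudo_def by (auto simp del: encodes.simps rikudo_game.simps
        odd_numbers_placed.simps solution.simps)
  then obtain l ps where l: "distinct l" "set l = \<tau>" "distinct ps" "set ps = p"
    "w = concat (map (enc_cell m) l) @ [Bar] @ concat (map enc_pair ps)"
    by auto
  let ?cs = "map (\<lambda>c. (c, m c)) l"
  have w: "w = encode ?cs ps" unfolding l(5) encode_def by (simp add: comp_def enc_cell_def[abs_def])
  have fst: "map fst ?cs = l" by (simp add: comp_def)
  have "label ?cs = m"
  proof
    fix c
    show "label ?cs c = m c"
    proof (cases "c \<in> \<tau>")
      case True
      then show ?thesis using label_eq[of ?cs "(c, m c)"] l(1,2) by (simp add: comp_def)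
    next
      case False
      then have "m c = None" using g(2) by auto
      then show ?thesis using label_outside[of c ?cs] False l(2) by force
    qed
  qed
  then have "game_of ?cs ps = (\<tau>, m, p)" unfolding game_of_def fst using l by simp
  then have "accepts ?cs ps" using g l(1,3) by (auto simp only: accepts_iff fst)
  then show "decider w" unfolding decider_def w parse_encode by simp
qed

section \<open>The input word\<close>

definition push_letter :: "letter \<Rightarrow> letter prog" where
  "push_letter d = push_tree (enc d) ;; Push 0 (Work 1)"

definition letters :: "letter list" where
  "letters = [Digit True, Digit False, Plus, Minus, Hash, Semicolon, Bar]"

definition push_top :: "letter prog" where
  "push_top = foldr (\<lambda>d p. Cond 1 {Letter d} (push_letter d) p) letters Skip"

text \<open>The input carries no mark at its end; the first loop stops at the \<open>Blank\<close>
  that an empty stack shows. The word is reversed onto stack \<open>1\<close> because the code of a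
  list is built from its tail, starting with \<open>Work 0\<close> for the empty list.\<close>

definition read_input :: "letter prog" where
  "read_input = Push 1 mark ;; Loop 0 (range Letter) (Copy 0 1 ;; Pop 0) ;; Push 0 (Work 0) ;;
     Loop 1 (- {mark}) (push_top ;; Pop 1) ;; Pop 1"

lemma sz_letter_le: "sz (d :: letter) \<le> 7"
  by (cases d) simp_all

lemma runs_push_top:
  "runs push_top 40 [code t, Letter d # r, s2, s3] [Work 1 # code (enc d) @ code t, Letter d # r, s2, s3]"
proof -
  have push: "runs (push_letter d) 20 [code t, Letter d # r, s2, s3]
      [Work 1 # code (enc d) @ code t, Letter d # r, s2, s3]"
    unfolding push_letter_def
    by (rule runs_weaken[OF runs_Seq[OF runs_push_tree runs_Push]])
      (use sz_letter_le[of d] in \<open>simp_all add: sz_def\<close>)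
  have "runs (foldr (\<lambda>d p. Cond 1 {Letter d} (push_letter d) p) ds Skip) (20 + 2 * length ds)
      [code t, Letter d # r, s2, s3] [Work 1 # code (enc d) @ code t, Letter d # r, s2, s3]"
    if "d \<in> set ds" for ds
    using that
  proof (induction ds)
    case (Cons c ds)
    show ?case
    proof (cases "c = d")
      case True
      show ?thesis
        unfolding foldr.simps comp_apply True
        by (rule runs_weaken[OF runs_CondT[OF _ _ push]]) simp_all
    next
      case False
      with Cons have IH: "runs (foldr (\<lambda>d p. Cond 1 {Letter d} (push_letter d) p) ds Skip) (20 + 2 * length ds)
          [code t, Letter d # r, s2, s3] [Work 1 # code (enc d) @ code t, Letter d # r, s2, s3]" by simp
      show ?thesis
        unfolding foldr.simps comp_apply
        by (rule runs_weaken[OF runs_CondF[OF _ _ IH]]) (use False in simp_all)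
    qed
  qed simp
  moreover have "d \<in> set letters" by (cases d) (auto simp: letters_def)
  ultimately have "runs push_top (20 + 2 * length letters) [code t, Letter d # r, s2, s3]
      [Work 1 # code (enc d) @ code t, Letter d # r, s2, s3]"
    unfolding push_top_def by blast
  then show ?thesis by (rule runs_mono) (simp add: letters_def)
qed

lemma runs_read_input:
  "runs read_input (50 * length w + 10) [map Letter w, [], [], []] [code (enc w), [], [], []]"
proof -
  have 1: "runs (Push 1 mark) 2 [map Letter w, [], [], []] [map Letter w, [mark], [], []]"
    by (rule runs_weaken[OF runs_Push]) simp_all
  have 2: "runs (Loop 0 (range Letter) (Copy 0 1 ;; Pop 0)) (5 * length w + 1)
      [map Letter w, x, [], []] [[], rev (map Letter w) @ x, [], []]" for x
  proof (induction w arbitrary: x)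
    case Nil
    show ?case by (rule runs_weaken[OF runs_Loop_end]) auto
  next
    case (Cons d w)
    have step: "runs (Copy 0 1 ;; Pop 0) 3 [map Letter (d # w), x, [], []] [map Letter w, Letter d # x, [], []]"
      by (rule runs_weaken[OF runs_Seq[OF runs_Copy runs_Pop]]) simp_all
    show ?case by (rule runs_weaken[OF runs_Loop_step[OF _ _ step Cons]]) simp_all
  qed
  have 3: "runs (Push 0 (Work 0)) 2 [[], x, [], []] [code (enc ([] :: letter list)), x, [], []]" for x
    by (rule runs_weaken[OF runs_Push]) simp_all
  have 4: "runs (Loop 1 (- {mark}) (push_top ;; Pop 1)) (43 * length v + 1)
      [code (enc u), map Letter v @ [mark], [], []] [code (enc (rev v @ u)), [mark], [], []]" for u v
  proof (induction v arbitrary: u)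
    case Nil
    show ?case by (rule runs_weaken[OF runs_Loop_end]) auto
  next
    case (Cons d v)
    have step: "runs (push_top ;; Pop 1) 41 [code (enc u), map Letter (d # v) @ [mark], [], []]
        [code (enc (d # u)), map Letter v @ [mark], [], []]"
      unfolding list.map append_Cons
      by (rule runs_weaken[OF runs_Seq[OF runs_push_top runs_Pop]]) simp_all
    show ?case by (rule runs_weaken[OF runs_Loop_step[OF _ _ step Cons]]) simp_all
  qed
  have second: "runs (Loop 1 (- {mark}) (push_top ;; Pop 1)) (43 * length w + 1)
      [code (enc ([] :: letter list)), rev (map Letter w) @ [mark], [], []] [code (enc w), [mark], [], []]"
    using 4[of "rev w" "[]"] by (simp add: rev_map)
  have 5: "runs (Pop 1) 1 [x, [mark], [], []] [x, [], [], []]" for x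
    by (rule runs_weaken[OF runs_Pop]) simp_all
  show ?thesis
    unfolding read_input_def
    by (rule runs_mono[OF runs_Seq[OF 1 runs_Seq[OF 2 runs_Seq[OF 3 runs_Seq[OF second 5]]]]]) simp
qed

lemma wf_read_input: "valid_prog read_input"
proof -
  have "valid_prog (foldr (\<lambda>d p. Cond 1 {Letter d} (push_letter d) p) ds Skip)" for ds
    by (induction ds) (simp_all add: push_letter_def wf_stack_programs Work_in_stack_symbols)
  then show ?thesis by (simp add: read_input_def push_top_def Work_in_stack_symbols)
qed

text \<open>A letter contributes at most \<open>7 + 1\<close> to the size of the word, so a
  polynomial in the size is one in the length. The verdict is visible in the first symbol of the
  resulting truth value.\<close>

lemma class_P_if_ptime:
  fixes L :: "letter list set"
  assumes "ptime f" "\<And>w. f w \<longleftrightarrow> w \<in> L"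
  shows "L \<in> class_P"
proof -
  from assms(1) obtain p h where p: "valid_prog p" "pbound h"
    "\<And>x s0 s1 s2 s3. runs p (h x) [code (enc x) @ s0, s1, s2, s3] [code (enc (f x)) @ s0, s1, s2, s3]"
    unfolding ptime_def by blast
  from p(2) obtain P where P: "\<And>x. h x \<le> poly P (sz x)" unfolding pbound_def by blast
  have sz_word: "sz w \<le> 8 * length w + 1" for w :: "letter list"
  proof (induction w)
    case (Cons d w)
    then show ?case using sz_letter_le[of d] by simp
  qed simp
  \<comment> \<open>The linear part pays for \<open>read_input\<close>; the composition replaces the
    size of the word by \<open>8 * length w + 1\<close>.\<close>
  let ?b = "[:10, 50:] + pcompose P [:1, 8:]"
  show ?thesis
  proof (rule class_P_if_runs[where k = 3 and S = stack_symbols and p = "read_input ;; p" and b = ?b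
        and yes = "Work 1"])
    show "wf_prog (Suc 3) stack_symbols (read_input ;; p)"
      using p(1) wf_read_input by simp
    show "finite stack_symbols" "Blank \<in> stack_symbols" "range Letter \<subseteq> stack_symbols"
      by (auto simp: stack_symbols_def)
    fix w
    have "h w \<le> poly P (8 * length w + 1)"
      by (rule le_trans[OF P poly_nat_mono[OF sz_word]])
    then have le: "50 * length w + 10 + h w \<le> poly ?b (length w)"
      by (simp add: poly_pcompose algebra_simps)
    have "runs p (h w) [code (enc w), [], [], []] [code (enc (f w)), [], [], []]"
      using p(3)[of w "[]" "[]" "[]" "[]"] by simp
    from runs_mono[OF runs_Seq[OF runs_read_input this] le]
    have "runs (read_input ;; p) (poly ?b (length w)) (map Letter w # replicate 3 [])
        [code (enc (f w)), [], [], []]" by (simp add: numeral_3_eq_3)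
    moreover have "peek ([code (enc (f w)), [], [], []] ! 0) = Work 1 \<longleftrightarrow> w \<in> L"
      using assms(2)[of w] by (auto simp: enc_bool_def)
    ultimately show "\<exists>st. runs (read_input ;; p) (poly ?b (length w)) (map Letter w # replicate 3 []) st \<and>
        (peek (st ! 0) = Work 1 \<longleftrightarrow> w \<in> L)" by blast
  qed
qed

theorem theorem3:
  shows "one_over_two_rikudo \<in> class_P"
  by (rule class_P_if_ptime[OF ptime_decider decider_iff])

end
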